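(* Let $k$ be a field, $n$ a positive integer, and $R=k\langle x_0,\ldots,x_n\rangle$ the free algebra graded by $\deg x_i=1$. Let $\mathcal{O}=\pi^*R$ be the image of $R$ in $\mathsf{Qcoh}\,\mathbb{X}^n:=\mathsf{QGr}\,R$. Then $\mathcal{O}$ is a finitely generated, projective generator in $\mathsf{Qcoh}\,\mathbb{X}^n$.
   Context: $\mathsf{Gr}\,R$ is the category of $\mathbb{Z}$-graded left $R$-modules with degree-preserving homomorphisms; $\mathsf{Fdim}\,R$ is its full subcategory of direct limits (unions) of finite-dimensional graded modules; $\mathsf{QGr}\,R:=\mathsf{Gr}\,R/\mathsf{Fdim}\,R$ is the quotient category, with quotient functor $\pi^*:\mathsf{Gr}\,R\to\mathsf{QGr}\,R$. An object $\mathcal{M}$ is finitely generated if whenever $\mathcal{M}=\sum\mathcal{M}_i$ for a directed family of subobjects $\mathcal{M}_i$, there is an index $j$ with $\mathcal{M}=\mathcal{M}_j$. *)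

theory Defs
  imports "HOL-Algebra.AbelCoset" "HOL-Algebra.Module" "HOL-Library.Poly_Mapping"
begin

section \<open>Notions from category theory\<close>

text \<open>
  Composition and identities carry their objects as arguments, so hom-sets need not be disjoint:
  \<open>Comp C X Y Z g f\<close> is the composite of \<open>f : X \<rightarrow> Y\<close> and \<open>g : Y \<rightarrow> Z\<close>.
\<close>

record ('o, 'm) category =
  Obj :: "'o set"
  Hom :: "'o \<Rightarrow> 'o \<Rightarrow> 'm set"
  Comp :: "'o \<Rightarrow> 'o \<Rightarrow> 'o \<Rightarrow> 'm \<Rightarrow> 'm \<Rightarrow> 'm"
  Id :: "'o \<Rightarrow> 'm"

definition monomorphism :: "('o, 'm) category \<Rightarrow> 'o \<Rightarrow> 'o \<Rightarrow> 'm \<Rightarrow> bool" where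
  "monomorphism C X Y f \<longleftrightarrow> X \<in> Obj C \<and> Y \<in> Obj C \<and> f \<in> Hom C X Y \<and>
     (\<forall>T\<in>Obj C. \<forall>g\<in>Hom C T X. \<forall>h\<in>Hom C T X. Comp C T X Y f g = Comp C T X Y f h \<longrightarrow> g = h)"

definition epimorphism :: "('o, 'm) category \<Rightarrow> 'o \<Rightarrow> 'o \<Rightarrow> 'm \<Rightarrow> bool" where
  "epimorphism C X Y f \<longleftrightarrow> X \<in> Obj C \<and> Y \<in> Obj C \<and> f \<in> Hom C X Y \<and>
     (\<forall>T\<in>Obj C. \<forall>g\<in>Hom C Y T. \<forall>h\<in>Hom C Y T. Comp C X Y T g f = Comp C X Y T h f \<longrightarrow> g = h)"

definition projective_object :: "('o, 'm) category \<Rightarrow> 'o \<Rightarrow> bool" where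
  "projective_object C P \<longleftrightarrow> P \<in> Obj C \<and>
     (\<forall>X Y e. epimorphism C X Y e \<longrightarrow>
        (\<forall>f\<in>Hom C P Y. \<exists>g\<in>Hom C P X. Comp C P X Y e g = f))"

definition generator_object :: "('o, 'm) category \<Rightarrow> 'o \<Rightarrow> bool" where
  "generator_object C G \<longleftrightarrow> G \<in> Obj C \<and>
     (\<forall>X\<in>Obj C. \<forall>Y\<in>Obj C. \<forall>f\<in>Hom C X Y. \<forall>g\<in>Hom C X Y. f \<noteq> g \<longrightarrow>
        (\<exists>h\<in>Hom C G X. Comp C G X Y f h \<noteq> Comp C G X Y g h))"

text \<open>
  A subobject of \<open>X\<close> is represented by a monomorphism into \<open>X\<close>; two representatives denote the same
  subobject iff each factors through the other.
\<close>

definition subobjects :: "('o, 'm) category \<Rightarrow> 'o \<Rightarrow> ('o \<times> 'm) set" where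
  "subobjects C X = {(A, i). monomorphism C A X i}"

definition sub_le :: "('o, 'm) category \<Rightarrow> 'o \<Rightarrow> 'o \<times> 'm \<Rightarrow> 'o \<times> 'm \<Rightarrow> bool" where
  "sub_le C X a b \<longleftrightarrow>
     (\<exists>h\<in>Hom C (fst a) (fst b). Comp C (fst a) (fst b) X (snd b) h = snd a)"

definition sub_eq :: "('o, 'm) category \<Rightarrow> 'o \<Rightarrow> 'o \<times> 'm \<Rightarrow> 'o \<times> 'm \<Rightarrow> bool" where
  "sub_eq C X a b \<longleftrightarrow> sub_le C X a b \<and> sub_le C X b a"

definition directed_family :: "('o, 'm) category \<Rightarrow> 'o \<Rightarrow> ('o \<times> 'm) set \<Rightarrow> bool" where
  "directed_family C X F \<longleftrightarrow> F \<subseteq> subobjects C X \<and> F \<noteq> {} \<and>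
     (\<forall>a\<in>F. \<forall>b\<in>F. \<exists>c\<in>F. sub_le C X a c \<and> sub_le C X b c)"

text \<open>The sum of a family of subobjects is the smallest subobject containing all of them.\<close>

definition is_sum :: "('o, 'm) category \<Rightarrow> 'o \<Rightarrow> ('o \<times> 'm) set \<Rightarrow> 'o \<times> 'm \<Rightarrow> bool" where
  "is_sum C X F s \<longleftrightarrow> s \<in> subobjects C X \<and> (\<forall>a\<in>F. sub_le C X a s) \<and>
     (\<forall>t\<in>subobjects C X. (\<forall>a\<in>F. sub_le C X a t) \<longrightarrow> sub_le C X s t)"

definition finitely_generated_object :: "('o, 'm) category \<Rightarrow> 'o \<Rightarrow> bool" where
  "finitely_generated_object C X \<longleftrightarrow> X \<in> Obj C \<and>
     (\<forall>F. directed_family C X F \<and> is_sum C X F (X, Id C X) \<longrightarrow>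
        (\<exists>a\<in>F. sub_eq C X a (X, Id C X)))"


section \<open>Graded algebras and graded left modules\<close>

text \<open>
  One record type serves both for graded \<open>k\<close>-algebras, \<open>('k, 'r) graded\<close>, where \<open>smult\<close> is the
  action of \<open>k\<close>, and for graded left \<open>R\<close>-modules, \<open>('r, 'u) graded\<close>, where \<open>smult\<close> is the action
  of \<open>R\<close>. As in \<^typ>\<open>('a, 'b) module\<close>, the fields \<open>mult\<close> and \<open>one\<close> of a module play no role.
\<close>

record ('a, 'b) graded = "('a, 'b) module" +
  part :: "int \<Rightarrow> 'b set"

text \<open>The carrier is the internal direct sum of the homogeneous parts.\<close>

definition is_grading :: "('a, 'b) graded \<Rightarrow> bool" where
  "is_grading M \<longleftrightarrow> (\<forall>d. subgroup (part M d) (add_monoid M)) \<and>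
     (\<forall>m\<in>carrier M. \<exists>!c. (\<forall>d. c d \<in> part M d) \<and> finite {d. c d \<noteq> \<zero>\<^bsub>M\<^esub>} \<and>
        m = (\<Oplus>\<^bsub>M\<^esub>d\<in>{d. c d \<noteq> \<zero>\<^bsub>M\<^esub>}. c d))"

text \<open>The library's locale \<^locale>\<open>module\<close> assumes a commutative ring of scalars.\<close>

locale graded_left_module = R?: ring R + M?: abelian_group M
  for R :: "('k, 'r) graded" (structure) and M :: "('r, 'u) graded" (structure) +
  assumes smult_closed: "\<lbrakk>a \<in> carrier R; x \<in> carrier M\<rbrakk> \<Longrightarrow> a \<odot>\<^bsub>M\<^esub> x \<in> carrier M"
    and smult_l_distr: "\<lbrakk>a \<in> carrier R; b \<in> carrier R; x \<in> carrier M\<rbrakk> \<Longrightarrow>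
      (a \<oplus>\<^bsub>R\<^esub> b) \<odot>\<^bsub>M\<^esub> x = a \<odot>\<^bsub>M\<^esub> x \<oplus>\<^bsub>M\<^esub> b \<odot>\<^bsub>M\<^esub> x"
    and smult_r_distr: "\<lbrakk>a \<in> carrier R; x \<in> carrier M; y \<in> carrier M\<rbrakk> \<Longrightarrow>
      a \<odot>\<^bsub>M\<^esub> (x \<oplus>\<^bsub>M\<^esub> y) = a \<odot>\<^bsub>M\<^esub> x \<oplus>\<^bsub>M\<^esub> a \<odot>\<^bsub>M\<^esub> y"
    and smult_assoc: "\<lbrakk>a \<in> carrier R; b \<in> carrier R; x \<in> carrier M\<rbrakk> \<Longrightarrow>
      (a \<otimes>\<^bsub>R\<^esub> b) \<odot>\<^bsub>M\<^esub> x = a \<odot>\<^bsub>M\<^esub> (b \<odot>\<^bsub>M\<^esub> x)"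
    and smult_one: "x \<in> carrier M \<Longrightarrow> \<one>\<^bsub>R\<^esub> \<odot>\<^bsub>M\<^esub> x = x"
    and grading: "is_grading M"
    and smult_part: "\<lbrakk>a \<in> part R i; x \<in> part M j\<rbrakk> \<Longrightarrow> a \<odot>\<^bsub>M\<^esub> x \<in> part M (i + j)"

definition restrict_mod :: "('r, 'u) graded \<Rightarrow> 'u set \<Rightarrow> ('r, 'u) graded" where
  "restrict_mod M H = M\<lparr>carrier := H, part := \<lambda>d. part M d \<inter> H\<rparr>"

definition graded_submodule ::
    "('k, 'r) graded \<Rightarrow> 'u set \<Rightarrow> ('r, 'u) graded \<Rightarrow> bool" where
  "graded_submodule R H M \<longleftrightarrow> submodule H R M \<and> is_grading (restrict_mod M H)"

definition quot_mod :: "('r, 'u) graded \<Rightarrow> 'u set \<Rightarrow> ('r, 'u set) graded" where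
  "quot_mod M H =
    \<lparr>carrier = a_rcosets\<^bsub>M\<^esub> H, mult = undefined, one = undefined,
     zero = H, add = set_add M,
     smult = (\<lambda>a X. \<Union>x\<in>X. H +>\<^bsub>M\<^esub> (a \<odot>\<^bsub>M\<^esub> x)),
     part = (\<lambda>d. (\<lambda>x. H +>\<^bsub>M\<^esub> x) ` part M d)\<rparr>"

definition gr_hom ::
    "('k, 'r) graded \<Rightarrow> ('r, 'u) graded \<Rightarrow> ('r, 'v) graded \<Rightarrow> ('u \<Rightarrow> 'v) set" where
  "gr_hom R M N = {f \<in> carrier M \<rightarrow> carrier N.
     (\<forall>x\<in>carrier M. \<forall>y\<in>carrier M. f (x \<oplus>\<^bsub>M\<^esub> y) = f x \<oplus>\<^bsub>N\<^esub> f y) \<and>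
     (\<forall>a\<in>carrier R. \<forall>x\<in>carrier M. f (a \<odot>\<^bsub>M\<^esub> x) = a \<odot>\<^bsub>N\<^esub> f x) \<and>
     (\<forall>d. f ` part M d \<subseteq> part N d)}"

text \<open>Dimension is over \<open>k\<close>, which acts on \<open>M\<close> through \<open>c \<mapsto> c \<cdot> 1\<^sub>R\<close>.\<close>

definition finite_dim :: "('k, 'r) graded \<Rightarrow> ('r, 'u) graded \<Rightarrow> bool" where
  "finite_dim R M \<longleftrightarrow> (\<exists>B. finite B \<and> B \<subseteq> carrier M \<and>
     (\<forall>m\<in>carrier M. \<exists>c :: 'u \<Rightarrow> 'k. m = (\<Oplus>\<^bsub>M\<^esub>b\<in>B. (c b \<odot>\<^bsub>R\<^esub> \<one>\<^bsub>R\<^esub>) \<odot>\<^bsub>M\<^esub> b)))"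

text \<open>Directed unions of finite-dimensional graded submodules.\<close>

definition fdim :: "('k, 'r) graded \<Rightarrow> ('r, 'u) graded \<Rightarrow> bool" where
  "fdim R M \<longleftrightarrow> graded_left_module R M \<and>
     (\<exists>F. F \<noteq> {} \<and> (\<forall>H\<in>F. graded_submodule R H M \<and> finite_dim R (restrict_mod M H)) \<and>
        (\<forall>H\<in>F. \<forall>H'\<in>F. \<exists>H''\<in>F. H \<union> H' \<subseteq> H'') \<and> carrier M = \<Union>F)"


section \<open>The quotient category\<close>

text \<open>
  Gabriel's construction: the objects of \<open>QGr R\<close> are those of \<open>Gr R\<close>, and
  \<open>Hom(M, N) = colim Hom\<^bsub>Gr\<^esub>(M', N/N')\<close> over the graded submodules \<open>M' \<subseteq> M\<close> and \<open>N' \<subseteq> N\<close>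
  with \<open>M/M'\<close> and \<open>N'\<close> in \<open>Fdim R\<close>. An element of the colimit is an equivalence class of
  triples \<open>(M', N', f)\<close>. The values of \<open>f\<close> outside \<open>M'\<close> are irrelevant, and \<open>q_rel\<close> ignores them.
\<close>

type_synonym 'u q_triple = "'u set \<times> 'u set \<times> ('u \<Rightarrow> 'u set)"

definition q_dom :: "('k, 'r) graded \<Rightarrow> ('r, 'u) graded \<Rightarrow> 'u set set" where
  "q_dom R M = {H. graded_submodule R H M \<and> fdim R (quot_mod M H)}"

definition q_tor :: "('k, 'r) graded \<Rightarrow> ('r, 'u) graded \<Rightarrow> 'u set set" where
  "q_tor R N = {H. graded_submodule R H N \<and> fdim R (restrict_mod N H)}"

definition q_triples ::
    "('k, 'r) graded \<Rightarrow> ('r, 'u) graded \<Rightarrow> ('r, 'u) graded \<Rightarrow> 'u q_triple set" where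
  "q_triples R M N = {(M', N', f). M' \<in> q_dom R M \<and> N' \<in> q_tor R N \<and>
     f \<in> gr_hom R (restrict_mod M M') (quot_mod N N')}"

text \<open>Two triples are related iff they have the same image in some later term of the system.\<close>

definition q_rel ::
    "('k, 'r) graded \<Rightarrow> ('r, 'u) graded \<Rightarrow> ('r, 'u) graded \<Rightarrow> ('u q_triple \<times> 'u q_triple) set" where
  "q_rel R M N = {((M1, N1, f1), (M2, N2, f2)).
     (M1, N1, f1) \<in> q_triples R M N \<and> (M2, N2, f2) \<in> q_triples R M N \<and>
     (\<exists>M3\<in>q_dom R M. \<exists>N3\<in>q_tor R N. M3 \<subseteq> M1 \<inter> M2 \<and> N1 \<union> N2 \<subseteq> N3 \<and>
        (\<forall>m\<in>M3. N3 <+>\<^bsub>N\<^esub> f1 m = N3 <+>\<^bsub>N\<^esub> f2 m))}"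

definition q_hom ::
    "('k, 'r) graded \<Rightarrow> ('r, 'u) graded \<Rightarrow> ('r, 'u) graded \<Rightarrow> 'u q_triple set set" where
  "q_hom R M N = q_triples R M N // q_rel R M N"

text \<open>
  For \<open>f : M' \<rightarrow> N/N'\<close> and \<open>g : N'' \<rightarrow> P/P'\<close> the composite is
  \<open>f\<^sup>-\<^sup>1((N' + N'')/N') \<rightarrow> (N' + N'')/N' \<cong> N''/(N' \<inter> N'') \<rightarrow> P/(P' + g(N' \<inter> N''))\<close>,
  where \<open>P' + g(N' \<inter> N'')\<close> is the union of the cosets \<open>g y\<close> for \<open>y \<in> N' \<inter> N''\<close>.
\<close>

fun triple_comp :: "'u q_triple \<Rightarrow> 'u q_triple \<Rightarrow> 'u q_triple" where
  "triple_comp (N'', P', g) (M', N', f) =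
     ({m \<in> M'. f m \<inter> N'' \<noteq> {}}, \<Union>y\<in>N' \<inter> N''. g y, \<lambda>m. \<Union>y\<in>f m \<inter> N''. g y)"

definition q_comp :: "('k, 'r) graded \<Rightarrow> ('r, 'u) graded \<Rightarrow> ('r, 'u) graded \<Rightarrow> ('r, 'u) graded \<Rightarrow>
    'u q_triple set \<Rightarrow> 'u q_triple set \<Rightarrow> 'u q_triple set" where
  "q_comp R M N P G F = (\<Union>g\<in>G. \<Union>f\<in>F. q_rel R M P `` {triple_comp g f})"

text \<open>The quotient functor \<open>\<pi>\<^sup>*\<close> on objects and on morphisms.\<close>

definition pi_obj :: "('r, 'u) graded \<Rightarrow> ('r, 'u) graded" where
  "pi_obj M = M"

definition pi_arr :: "('k, 'r) graded \<Rightarrow> ('r, 'u) graded \<Rightarrow> ('r, 'u) graded \<Rightarrow> ('u \<Rightarrow> 'u) \<Rightarrow>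
    'u q_triple set" where
  "pi_arr R M N f = q_rel R M N `` {(carrier M, {\<zero>\<^bsub>N\<^esub>}, \<lambda>m. {\<zero>\<^bsub>N\<^esub>} +>\<^bsub>N\<^esub> f m)}"

text \<open>
  The type \<open>'u\<close> is the universe: the modules considered are those whose underlying set
  is a subset of \<open>'u\<close>. When \<open>'u\<close> is infinite and at least as large as \<open>R\<close>, they are closed,
  up to isomorphism, under submodules, quotients and finite direct sums.
\<close>

definition QGr :: "('k, 'r) graded \<Rightarrow> (('r, 'u) graded, 'u q_triple set) category" where
  "QGr R = \<lparr>Obj = {M. graded_left_module R M}, Hom = q_hom R, Comp = q_comp R,
     Id = (\<lambda>M. pi_arr R M M (\<lambda>m. m))\<rparr>"


section \<open>The free algebra\<close>

text \<open>
  Words form a monoid under concatenation, written additively so that the product of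
  \<^typ>\<open>'a \<Rightarrow>\<^sub>0 'b\<close> is the one of the monoid algebra.
\<close>

datatype 'a word = Word (letters: "'a list")

instantiation word :: (type) monoid_add
begin

definition zero_word :: "'a word" where
  "0 = Word []"

definition plus_word :: "'a word \<Rightarrow> 'a word \<Rightarrow> 'a word" where
  "v + w = Word (letters v @ letters w)"

instance
  by standard (simp_all add: zero_word_def plus_word_def)

end

text \<open>\<open>k\<langle>x\<^sub>0, \<dots>, x\<^sub>n\<rangle>\<close>: the letter \<open>i\<close> stands for \<open>x\<^sub>i\<close>, and \<open>deg x\<^sub>i = 1\<close>.\<close>

definition free_algebra :: "nat \<Rightarrow> ('k::field, nat word \<Rightarrow>\<^sub>0 'k) graded" where
  "free_algebra n =
    (let A = {p :: nat word \<Rightarrow>\<^sub>0 'k. \<forall>w\<in>Poly_Mapping.keys p. set (letters w) \<subseteq> {0..n}} in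
    \<lparr>carrier = A, mult = (*), one = 1, zero = 0, add = (+),
     smult = (\<lambda>c p. Poly_Mapping.map ((*) c) p),
     part = (\<lambda>d. {p \<in> A. \<forall>w\<in>Poly_Mapping.keys p. int (length (letters w)) = d})\<rparr>)"

text \<open>The algebra \<open>R\<close> as a graded left module over itself, and transport along an injection.\<close>

definition regular_mod :: "('k, 'r) graded \<Rightarrow> ('r, 'r) graded" where
  "regular_mod R =
    \<lparr>carrier = carrier R, mult = undefined, one = undefined,
     zero = \<zero>\<^bsub>R\<^esub>, add = add R, smult = mult R, part = part R\<rparr>"

definition transport_mod :: "('u \<Rightarrow> 'v) \<Rightarrow> ('r, 'u) graded \<Rightarrow> ('r, 'v) graded" where
  "transport_mod \<iota> M =
    (let \<rho> = inv_into (carrier M) \<iota> in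
    \<lparr>carrier = \<iota> ` carrier M, mult = undefined, one = undefined,
     zero = \<iota> \<zero>\<^bsub>M\<^esub>, add = (\<lambda>x y. \<iota> (\<rho> x \<oplus>\<^bsub>M\<^esub> \<rho> y)),
     smult = (\<lambda>a x. \<iota> (a \<odot>\<^bsub>M\<^esub> \<rho> x)), part = (\<lambda>d. \<iota> ` part M d)\<rparr>)"

end

theory Submission
  imports Defs
begin

text \<open>
  A graded module lies in \<open>Fdim R\<close> iff each of its elements is killed by all long words, because there
  are only finitely many words of each length. A morphism \<open>M \<rightarrow> N\<close> of \<open>QGr R\<close> is determined by the graph
  \<open>G \<subseteq> M \<times> N\<close> of a representing triple, a graded linear relation whose domain contains \<open>w x\<close> for every
  \<open>x\<close> and all long words \<open>w\<close>, and for which \<open>G(0)\<close> is torsion; composition of triples becomes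
  composition of relations, and two graphs give the same morphism iff their values differ by torsion.
  Everything then rests on the fact that \<open>R\<^bsub>\<ge>D\<^esub>\<close>, which equals \<open>R\<close> in the quotient, is free on the
  finitely many words of length \<open>D\<close>. Hence a morphism out of \<open>\<O>\<close> may be prescribed on the words of
  some large length: this lifts maps along epimorphisms (these have cotorsion range) and separates
  morphisms, while finiteness of the set of words of length \<open>D\<close> gives finite generation.
\<close>


section \<open>The free algebra\<close>

text \<open>In a left module the last letters of a word act first, and the last \<open>D\<close>
  letters of a longer word can be cut off in one way only; hence the words of length
  \<open>D\<close> are a basis of the left ideal they generate. Arguments by successive long words
  need bounds that do not depend on the word chosen first; finiteness of the alphabet provides them
  in \<open>ev_ev\<close>, which makes torsion stable under extensions. Two constraints shape the
  constructions. Degrees: a basis word of length \<open>D\<close> may only be sent to an element of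
  degree \<open>D\<close>, so targets are replaced by their components of degree \<open>D\<close> or
  multiplied into that degree; in this way \<open>\<O>\<close> detects elements of every degree
  without its shifts. Universe: every test object must have its underlying set in \<open>'u\<close>,
  so quotients are moved there, and direct sums are avoided by treating relations as sets of pairs.
  Relations also have converses: lifts and inverses of morphisms arise by reversing a relation, with
  no prior proof that the quotient category is abelian.\<close>

definition words :: "nat \<Rightarrow> nat word set" where
  "words n = {w. set (letters w) \<subseteq> {0..n}}"

abbreviation wlen :: "'a word \<Rightarrow> nat" where
  "wlen w \<equiv> length (letters w)"

abbreviation X :: "nat word \<Rightarrow> nat word \<Rightarrow>\<^sub>0 'k::field" where
  "X w \<equiv> Poly_Mapping.single w 1"

abbreviation const :: "'k::field \<Rightarrow> nat word \<Rightarrow>\<^sub>0 'k" where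
  "const c \<equiv> Poly_Mapping.single 0 c"

lemma letters_simps [simp]:
  "letters 0 = []" "letters (v + w) = letters v @ letters w"
  by (simp_all add: zero_word_def plus_word_def)

lemma words_simps [simp]:
  "0 \<in> words n" "v + w \<in> words n \<longleftrightarrow> v \<in> words n \<and> w \<in> words n"
  by (auto simp: words_def)

text \<open>Cuts off the last \<open>D\<close> letters. Since \<open>u + v\<close> acts as
  \<open>u\<close> after \<open>v\<close>, a statement about words of length \<open>D\<close> passes
  to all longer words through the suffix \<open>v\<close>.\<close>

lemma word_split:
  assumes "w \<in> words n" "D \<le> wlen w"
  obtains u v where "w = u + v" "u \<in> words n" "v \<in> words n" "wlen v = D" "wlen u = wlen w - D"
proof
  let ?k = "wlen w - D"
  show eq: "w = Word (take ?k (letters w)) + Word (drop ?k (letters w))"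
    by (cases w) (simp add: plus_word_def)
  then show "Word (take ?k (letters w)) \<in> words n" "Word (drop ?k (letters w)) \<in> words n"
    using assms(1) by (metis words_simps(2))+
  show "wlen (Word (drop ?k (letters w))) = D" "wlen (Word (take ?k (letters w))) = wlen w - D"
    using assms(2) by simp_all
qed

text \<open>A suffix of known length determines the cut. This uniqueness is the combinatorial core
  of \<open>words_independent\<close>.\<close>

lemma words_eqI: "\<lbrakk>u + v = u' + v'; wlen v = wlen v'\<rbrakk> \<Longrightarrow> u = u' \<and> v = (v' :: 'a word)"
  by (cases u; cases v; cases u'; cases v') (auto simp: plus_word_def)

text \<open>The finite alphabet enters here. It yields the uniform bound in \<open>ev_ev\<close>,
  finite spanning sets for torsion elements, and the finite generation of
  \<open>\<O>\<close>.\<close>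

lemma finite_words_of_length: "finite {w \<in> words n. wlen w = D}"
proof -
  have "{w \<in> words n. wlen w = D} \<subseteq> Word ` {xs. set xs \<subseteq> {0..n} \<and> length xs = D}"
  proof
    fix w assume "w \<in> {w \<in> words n. wlen w = D}"
    then show "w \<in> Word ` {xs. set xs \<subseteq> {0..n} \<and> length xs = D}"
      by (cases w) (auto simp: words_def)
  qed
  moreover have "finite {xs. set xs \<subseteq> {0..n} \<and> length xs = D}"
    using finite_lists_length_eq[of "{0..n}" D] by simp
  ultimately show ?thesis
    by (rule finite_surj[rotated])
qed

lemma finite_words_upto: "finite {w \<in> words n. wlen w < D}"
proof -
  have "{w \<in> words n. wlen w < D} = (\<Union>d<D. {w \<in> words n. wlen w = d})"
    by auto
  then show ?thesis
    using finite_words_of_length by simp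
qed

lemma ex_word_of_length: "\<exists>w\<in>words n. wlen w = D"
  by (rule bexI[of _ "Word (replicate D 0)"]) (auto simp: words_def)

lemma free_algebra_simps:
  "carrier (free_algebra n) = {p. Poly_Mapping.keys p \<subseteq> words n}"
  "add (free_algebra n) = (+)" "mult (free_algebra n) = (*)"
  "zero (free_algebra n) = 0" "one (free_algebra n) = 1"
  "smult (free_algebra n) = (\<lambda>c p. Poly_Mapping.map ((*) c) p)"
  "part (free_algebra n) d =
     {p. Poly_Mapping.keys p \<subseteq> words n \<and> (\<forall>w\<in>Poly_Mapping.keys p. int (wlen w) = d)}"
  by (auto simp: free_algebra_def words_def Let_def)

lemma X_mult: "X v * X w = (X (v + w) :: _ \<Rightarrow>\<^sub>0 'k::field)"
  by (simp add: mult_single)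

lemma single_eq_const_X: "Poly_Mapping.single w c = const c * (X w :: _ \<Rightarrow>\<^sub>0 'k::field)"
  by (simp add: mult_single)

lemma const_X_commute: "const c * X w = (X w * const c :: _ \<Rightarrow>\<^sub>0 'k::field)"
  by (simp add: mult_single)

text \<open>Scalars in \<open>finite_dim\<close> act through the unit; this turns them into the
  constant polynomials used in all later computations.\<close>

lemma smult_one_free_algebra: "c \<odot>\<^bsub>free_algebra n\<^esub> \<one>\<^bsub>free_algebra n\<^esub> = const c"
proof (rule poly_mapping_eqI)
  fix w
  show "poly_mapping.lookup (c \<odot>\<^bsub>free_algebra n\<^esub> \<one>\<^bsub>free_algebra n\<^esub>) w = poly_mapping.lookup (const c) w"
    by (auto simp: free_algebra_simps Poly_Mapping.map.rep_eq lookup_one lookup_single when_def)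
qed

lemma single_in_free_algebra [simp]:
  "w \<in> words n \<Longrightarrow> Poly_Mapping.single w c \<in> carrier (free_algebra n)"
  by (auto simp: free_algebra_simps)

lemma X_in_part: "w \<in> words n \<Longrightarrow> X w \<in> part (free_algebra n) (int (wlen w))"
  by (auto simp: free_algebra_simps)

lemma const_in_part: "const c \<in> part (free_algebra n) 0"
  by (auto simp: free_algebra_simps)

lemma free_algebra_add_closed:
  "\<lbrakk>p \<in> carrier (free_algebra n); q \<in> carrier (free_algebra n)\<rbrakk> \<Longrightarrow> p + q \<in> carrier (free_algebra n)"
  using keys_add[of p q] by (auto simp: free_algebra_simps)

lemma ring_free_algebra: "ring (free_algebra n :: ('k::field, _) graded)"
proof (rule ringI)
  let ?R = "free_algebra n :: ('k::field, _) graded"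
  show "abelian_group ?R"
  proof (rule abelian_groupI)
    fix x assume "x \<in> carrier ?R"
    then show "\<exists>y\<in>carrier ?R. y \<oplus>\<^bsub>?R\<^esub> x = \<zero>\<^bsub>?R\<^esub>"
      by (intro bexI[of _ "- x"]) (simp_all add: free_algebra_simps)
  qed (auto simp: free_algebra_simps ac_simps dest!: subsetD[OF keys_add])
  show "monoid ?R"
    by (rule monoidI)
      (auto simp: free_algebra_simps mult.assoc dest!: subsetD[OF keys_mult])
qed (auto simp: free_algebra_simps algebra_simps)

text \<open>A polynomial is the finite sum of its monomials, so additive statements about scalars
  reduce to a single word with a coefficient.\<close>

lemma free_algebra_induct [consumes 1, case_names zero single add]:
  assumes "p \<in> carrier (free_algebra n)"
    and "P 0"
    and single: "\<And>c w. w \<in> words n \<Longrightarrow> P (Poly_Mapping.single w c)"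
    and add: "\<And>p q. \<lbrakk>p \<in> carrier (free_algebra n); q \<in> carrier (free_algebra n); P p; P q\<rbrakk> \<Longrightarrow> P (p + q)"
  shows "P (p :: _ \<Rightarrow>\<^sub>0 'k::field)"
proof -
  have sum_in: "(\<Sum>w\<in>A. Poly_Mapping.single w (poly_mapping.lookup p w)) \<in> carrier (free_algebra n) \<and>
      P (\<Sum>w\<in>A. Poly_Mapping.single w (poly_mapping.lookup p w))"
    if "finite A" "A \<subseteq> words n" for A
    using that
  proof (induction A rule: finite_induct)
    case (insert w A)
    then show ?case
      by (auto intro!: add single free_algebra_add_closed simp del: single_in_free_algebra intro: single_in_free_algebra)
  qed (use assms(2) in \<open>auto simp: free_algebra_simps\<close>)
  have "p = (\<Sum>w\<in>Poly_Mapping.keys p. Poly_Mapping.single w (poly_mapping.lookup p w))"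
  proof (rule poly_mapping_eqI)
    fix v
    have "(\<Sum>w\<in>Poly_Mapping.keys p. poly_mapping.lookup (Poly_Mapping.single w (poly_mapping.lookup p w)) v) = poly_mapping.lookup p v"
      by (simp add: lookup_single when_def in_keys_iff)
    then show "poly_mapping.lookup p v = poly_mapping.lookup (\<Sum>w\<in>Poly_Mapping.keys p. Poly_Mapping.single w (poly_mapping.lookup p w)) v"
      by (simp add: lookup_sum)
  qed
  then show ?thesis
    using sum_in[of "Poly_Mapping.keys p"] assms(1) by (simp add: free_algebra_simps)
qed

subsection \<open>Properties of all long words\<close>

text \<open>This is "eventually" for the filter generated by the sets of all words of length at
  least \<open>D\<close>. It hides the bounds, which would otherwise have to be combined explicitly
  in every argument.\<close>

definition ev :: "nat \<Rightarrow> (nat word \<Rightarrow> bool) \<Rightarrow> bool" where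
  "ev n P \<longleftrightarrow> (\<exists>D. \<forall>w\<in>words n. D \<le> wlen w \<longrightarrow> P w)"

lemma ev_mono: "\<lbrakk>ev n P; \<And>w. \<lbrakk>w \<in> words n; P w\<rbrakk> \<Longrightarrow> Q w\<rbrakk> \<Longrightarrow> ev n Q"
  unfolding ev_def by meson

lemma ev_cong: "(\<And>w. w \<in> words n \<Longrightarrow> P w = Q w) \<Longrightarrow> ev n P = ev n Q"
  unfolding ev_def by meson

lemma ev_conj: "\<lbrakk>ev n P; ev n Q\<rbrakk> \<Longrightarrow> ev n (\<lambda>w. P w \<and> Q w)"
proof -
  assume "ev n P" "ev n Q"
  then obtain D D' where "\<forall>w\<in>words n. D \<le> wlen w \<longrightarrow> P w" "\<forall>w\<in>words n. D' \<le> wlen w \<longrightarrow> Q w"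
    unfolding ev_def by blast
  then show ?thesis
    unfolding ev_def by (intro exI[of _ "max D D'"]) simp
qed

lemma ev_all: "(\<And>w. w \<in> words n \<Longrightarrow> P w) \<Longrightarrow> ev n P"
  unfolding ev_def by blast

lemma ev_finite:
  assumes "finite A" "\<And>a. a \<in> A \<Longrightarrow> ev n (P a)"
  shows "ev n (\<lambda>w. \<forall>a\<in>A. P a w)"
  using assms
proof (induction A rule: finite_induct)
  case (insert a A)
  then have "ev n (\<lambda>w. P a w \<and> (\<forall>a\<in>A. P a w))"
    by (intro ev_conj) auto
  then show ?case by simp
qed (simp add: ev_all)

lemma ev_append_right: "\<lbrakk>ev n P; v \<in> words n\<rbrakk> \<Longrightarrow> ev n (\<lambda>u. P (u + v))"
  unfolding ev_def by (metis (no_types, lifting) letters_simps(2) length_append trans_le_add1 words_simps(2))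

text \<open>The bound for \<open>u\<close> depends on \<open>v\<close>, but the \<open>v\<close> of
  one fixed length \<open>D\<close> suffice; they are finitely many, so a common bound exists.
  Algebraically: an extension of torsion by torsion is torsion.\<close>

lemma ev_ev:
  assumes "ev n (\<lambda>v. ev n (\<lambda>u. P (u + v)))"
  shows "ev n P"
proof -
  obtain D where D: "\<And>v. \<lbrakk>v \<in> words n; D \<le> wlen v\<rbrakk> \<Longrightarrow> ev n (\<lambda>u. P (u + v))"
    using assms unfolding ev_def by blast
  have "ev n (\<lambda>u. \<forall>v\<in>{v \<in> words n. wlen v = D}. P (u + v))"
    by (rule ev_finite) (use D finite_words_of_length in auto)
  then obtain D' where D': "\<And>u v. \<lbrakk>u \<in> words n; D' \<le> wlen u; v \<in> words n; wlen v = D\<rbrakk> \<Longrightarrow> P (u + v)"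
    unfolding ev_def by blast
  show ?thesis
    unfolding ev_def
  proof (intro exI[of _ "D + D'"] ballI impI)
    \<comment> \<open>The last \<open>D\<close> letters serve the outer condition, and at least
      \<open>D'\<close> letters remain for the inner one.\<close>
    fix w assume w: "w \<in> words n" "D + D' \<le> wlen w"
    from w have "D \<le> wlen w" by simp
    from word_split[OF w(1) this] obtain u v where
      uv: "w = u + v" "u \<in> words n" "v \<in> words n" "wlen v = D" "wlen u = wlen w - D" .
    have "D' \<le> wlen u"
      using uv(5) w(2) by linarith
    from D'[OF uv(2) this uv(3,4)] show "P w"
      unfolding uv(1) .
  qed
qed


section \<open>Homogeneous components\<close>

lemma (in abelian_monoid) finsum_mem:
  assumes "finite A" "S \<subseteq> carrier G" "\<zero> \<in> S" "\<And>x y. \<lbrakk>x \<in> S; y \<in> S\<rbrakk> \<Longrightarrow> x \<oplus> y \<in> S"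
    and "\<And>i. i \<in> A \<Longrightarrow> f i \<in> S"
  shows "finsum G f A \<in> S"
  using assms(1,5)
proof (induction A rule: finite_induct)
  case (insert i A)
  then have "finsum G f (insert i A) = f i \<oplus> finsum G f A"
    using assms(2) by (intro finsum_insert) auto
  with insert show ?case
    by (simp add: assms(4))
qed (use assms(3) in simp)

lemma (in abelian_monoid) finsum_supset:
  assumes "finite A" "\<And>i. c i \<in> carrier G" "{i. c i \<noteq> \<zero>} \<subseteq> A"
  shows "finsum G c {i. c i \<noteq> \<zero>} = finsum G c A"
  by (rule add.finprod_mono_neutral_cong_left) (use assms in auto)

text \<open>The maps \<open>p d\<close> are candidate component maps. Assumption
  \<open>p_gen\<close> stands for the statement that \<open>x\<close> is the sum of the
  \<open>p d x\<close>: being an induction principle, it passes to submodules and quotients without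
  comparing finite sums in two structures.\<close>

lemma (in abelian_group) is_gradingI:
  fixes p :: "int \<Rightarrow> 'a \<Rightarrow> 'a"
  assumes sub: "\<And>d. subgroup (P d) (add_monoid G)"
    and p_part: "\<And>d x. x \<in> carrier G \<Longrightarrow> p d x \<in> P d"
    and p_add: "\<And>d x y. \<lbrakk>x \<in> carrier G; y \<in> carrier G\<rbrakk> \<Longrightarrow> p d (x \<oplus> y) = p d x \<oplus> p d y"
    and p_proj: "\<And>d e x. x \<in> P e \<Longrightarrow> p d x = (if d = e then x else \<zero>)"
    and p_fin: "\<And>x. x \<in> carrier G \<Longrightarrow> finite {d. p d x \<noteq> \<zero>}"
    and p_gen: "\<And>x S. \<lbrakk>x \<in> carrier G; S \<subseteq> carrier G; \<zero> \<in> S; \<And>x y. \<lbrakk>x \<in> S; y \<in> S\<rbrakk> \<Longrightarrow> x \<oplus> y \<in> S;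
      \<And>d. p d x \<in> S\<rbrakk> \<Longrightarrow> x \<in> S"
    and m: "m \<in> carrier G"
  shows "\<exists>!c. (\<forall>d. c d \<in> P d) \<and> finite {d. c d \<noteq> \<zero>} \<and> m = (\<Oplus>d\<in>{d. c d \<noteq> \<zero>}. c d)"
proof -
  have P_carrier: "x \<in> carrier G" if "x \<in> P d" for x d
    using subgroup.subset[OF sub[of d]] that by auto
  have p_carrier: "p d x \<in> carrier G" if "x \<in> carrier G" for x d
    using p_part[OF that] P_carrier by blast
  have zero_P: "\<zero> \<in> P d" for d
    using subgroup.one_closed[OF sub[of d]] by simp
  have p_zero: "p d \<zero> = \<zero>" for d
    using p_proj[OF zero_P[of d], of d] by simp
  \<comment> \<open>The elements that equal the sum of their components; \<open>p_gen\<close>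
    reduces membership of \<open>m\<close> to that of its components.\<close>
  let ?S = "{x \<in> carrier G. x = (\<Oplus>d\<in>{d. p d x \<noteq> \<zero>}. p d x)}"
  have "m \<in> ?S"
  proof (rule p_gen[OF m])
    show "\<zero> \<in> ?S"
      by (simp add: p_zero)
  next
    fix x y assume xy: "x \<in> ?S" "y \<in> ?S"
    let ?A = "{d. p d x \<noteq> \<zero>} \<union> {d. p d y \<noteq> \<zero>}"
    have A: "finite ?A" using xy p_fin by simp
    have "(\<Oplus>d\<in>{d. p d (x \<oplus> y) \<noteq> \<zero>}. p d (x \<oplus> y)) = (\<Oplus>d\<in>?A. p d (x \<oplus> y))"
      using xy by (intro finsum_supset[OF A]) (auto simp: p_add p_carrier)
    also have "\<dots> = (\<Oplus>d\<in>?A. p d x \<oplus> p d y)"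
      using xy by (intro finsum_cong') (auto simp: p_add p_carrier)
    also have "\<dots> = (\<Oplus>d\<in>?A. p d x) \<oplus> (\<Oplus>d\<in>?A. p d y)"
      using xy by (intro finsum_addf) (auto simp: p_carrier)
    also have "(\<Oplus>d\<in>?A. p d x) = x"
      using xy finsum_supset[OF A, of "\<lambda>d. p d x"] by (auto simp: p_carrier)
    also have "(\<Oplus>d\<in>?A. p d y) = y"
      using xy finsum_supset[OF A, of "\<lambda>d. p d y"] by (auto simp: p_carrier)
    finally show "x \<oplus> y \<in> ?S"
      using xy by simp
  next
    fix e
    have "p d (p e m) = (if d = e then p e m else \<zero>)" for d
      by (rule p_proj) (use m p_part in auto)
    moreover have "(\<Oplus>d\<in>{e}. if d = e then p e m else \<zero>) = p e m"
      using m by (simp add: p_carrier)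
    moreover have "{d. (if d = e then p e m else \<zero>) \<noteq> \<zero>} = (if p e m = \<zero> then {} else {e})"
      by auto
    ultimately show "p e m \<in> ?S"
      using m by (auto simp: p_carrier)
  qed auto
  then have eq: "m = (\<Oplus>d\<in>{d. p d m \<noteq> \<zero>}. p d m)" by simp
  show ?thesis
  proof (rule ex1I[of _ "\<lambda>d. p d m"])
    show "(\<forall>d. p d m \<in> P d) \<and> finite {d. p d m \<noteq> \<zero>} \<and> m = (\<Oplus>d\<in>{d. p d m \<noteq> \<zero>}. p d m)"
      using m eq by (simp add: p_part p_fin)
  next
    fix c assume c: "(\<forall>d. c d \<in> P d) \<and> finite {d. c d \<noteq> \<zero>} \<and> m = (\<Oplus>d\<in>{d. c d \<noteq> \<zero>}. c d)"
    have cc: "c d \<in> carrier G" for d using c P_carrier by blast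
    \<comment> \<open>Applying \<open>p d\<close> to any homogeneous decomposition recovers its term
      of degree \<open>d\<close>, whence uniqueness.\<close>
    have *: "p d (\<Oplus>e\<in>A. c e) = (if d \<in> A then c d else \<zero>)" if "finite A" for A d
      using that
    proof (induction A rule: finite_induct)
      case (insert e A)
      have "(\<Oplus>e\<in>insert e A. c e) = c e \<oplus> (\<Oplus>e\<in>A. c e)"
        using insert cc by (intro finsum_insert) auto
      moreover have "(\<Oplus>e\<in>A. c e) \<in> carrier G"
        using cc by (intro finsum_closed) auto
      moreover have "p d (c e) = (if d = e then c e else \<zero>)"
        by (rule p_proj) (use c in blast)
      ultimately show ?case
        using insert cc by (auto simp: p_add)
    qed (simp add: p_zero)
    have "p d m = (if d \<in> {d. c d \<noteq> \<zero>} then c d else \<zero>)" for d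
      using c *[of "{d. c d \<noteq> \<zero>}" d] by simp
    then show "c = (\<lambda>d. p d m)" by auto
  qed
qed

text \<open>The component of degree \<open>d\<close>; the description is proper by the grading axiom.\<close>

definition hc :: "('r, 'u) graded \<Rightarrow> int \<Rightarrow> 'u \<Rightarrow> 'u" where
  "hc M d x = (THE c. (\<forall>d. c d \<in> part M d) \<and> finite {d. c d \<noteq> \<zero>\<^bsub>M\<^esub>} \<and>
     x = (\<Oplus>\<^bsub>M\<^esub>d\<in>{d. c d \<noteq> \<zero>\<^bsub>M\<^esub>}. c d)) d"

locale gmod = graded_left_module "free_algebra n" M
  for n :: nat and M :: "(nat word \<Rightarrow>\<^sub>0 'k::field, 'u) graded" (structure)
begin

abbreviation R :: "('k, nat word \<Rightarrow>\<^sub>0 'k) graded" where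
  "R \<equiv> free_algebra n"

lemma part_subgroup: "subgroup (part M d) (add_monoid M)"
  using grading by (simp add: is_grading_def)

lemma part_carrier: "x \<in> part M d \<Longrightarrow> x \<in> carrier M"
  using subgroup.subset[OF part_subgroup] by auto

lemma part_zero: "\<zero> \<in> part M d"
  using subgroup.one_closed[OF part_subgroup] by simp

lemma part_add: "\<lbrakk>x \<in> part M d; y \<in> part M d\<rbrakk> \<Longrightarrow> x \<oplus> y \<in> part M d"
  using subgroup.m_closed[OF part_subgroup] by simp

lemma hc_props:
  assumes "x \<in> carrier M"
  shows hc_in_part: "hc M d x \<in> part M d"
    and finite_hc: "finite {d. hc M d x \<noteq> \<zero>}"
    and finsum_hc: "x = (\<Oplus>d\<in>{d. hc M d x \<noteq> \<zero>}. hc M d x)"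
proof -
  let ?P = "\<lambda>c. (\<forall>d. c d \<in> part M d) \<and> finite {d. c d \<noteq> \<zero>} \<and> x = (\<Oplus>d\<in>{d. c d \<noteq> \<zero>}. c d)"
  have "\<exists>!c. ?P c"
    using grading assms unfolding is_grading_def by blast
  then have "?P (THE c. ?P c)"
    by (rule theI')
  moreover have "(THE c. ?P c) = (\<lambda>d. hc M d x)"
    unfolding hc_def by blast
  ultimately have "?P (\<lambda>d. hc M d x)" by simp
  then show "hc M d x \<in> part M d" "finite {d. hc M d x \<noteq> \<zero>}"
    "x = (\<Oplus>d\<in>{d. hc M d x \<noteq> \<zero>}. hc M d x)"
    by blast+
qed

text \<open>Any finite index set containing the support is allowed, so decompositions of two
  elements can be added over the union of their supports, as in \<open>hc_add\<close>.\<close>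

lemma hc_unique:
  assumes "\<And>d. c d \<in> part M d" "finite A" "\<And>d. d \<notin> A \<Longrightarrow> c d = \<zero>" "x = (\<Oplus>d\<in>A. c d)"
  shows "hc M d x = c d"
proof -
  let ?P = "\<lambda>c. (\<forall>d. c d \<in> part M d) \<and> finite {d. c d \<noteq> \<zero>} \<and> x = (\<Oplus>d\<in>{d. c d \<noteq> \<zero>}. c d)"
  have cc: "c d \<in> carrier M" for d
    using assms(1) part_carrier by blast
  have "x \<in> carrier M"
    unfolding assms(4) using cc by (intro M.finsum_closed) auto
  then have ex1: "\<exists>!c. ?P c"
    using grading unfolding is_grading_def by blast
  have sub: "{d. c d \<noteq> \<zero>} \<subseteq> A"
    using assms(3) by blast
  have "?P c"
    using assms(1,4) M.finsum_supset[OF assms(2) cc sub] finite_subset[OF sub assms(2)] by simp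
  from ex1 this have "(THE c. ?P c) = c"
    by (rule the1_equality[of ?P])
  then show ?thesis
    unfolding hc_def by simp
qed

lemma hc_carrier [simp]: "x \<in> carrier M \<Longrightarrow> hc M d x \<in> carrier M"
  using hc_in_part part_carrier by blast

lemma hc_part: "x \<in> part M e \<Longrightarrow> hc M d x = (if d = e then x else \<zero>)"
  by (rule hc_unique[of _ "{e}"]) (auto simp: part_zero part_carrier)

lemma hc_zero [simp]: "hc M d \<zero> = \<zero>"
  using hc_part[OF part_zero[of d], of d] by simp

lemma hc_hc: "x \<in> carrier M \<Longrightarrow> hc M d (hc M e x) = (if d = e then hc M e x else \<zero>)"
  using hc_part[OF hc_in_part] .

lemma hc_add:
  assumes x: "x \<in> carrier M" and y: "y \<in> carrier M"
  shows "hc M d (x \<oplus> y) = hc M d x \<oplus> hc M d y"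
proof -
  let ?A = "{d. hc M d x \<noteq> \<zero>} \<union> {d. hc M d y \<noteq> \<zero>}"
  have A: "finite ?A" using finite_hc x y by simp
  show ?thesis
  proof (rule hc_unique[of _ ?A])
    have "(\<Oplus>d\<in>?A. hc M d x \<oplus> hc M d y) = (\<Oplus>d\<in>?A. hc M d x) \<oplus> (\<Oplus>d\<in>?A. hc M d y)"
      using x y by (intro M.finsum_addf) auto
    also have "(\<Oplus>d\<in>?A. hc M d x) = x"
      using M.finsum_supset[OF A, of "\<lambda>d. hc M d x"] finsum_hc[OF x] x by auto
    also have "(\<Oplus>d\<in>?A. hc M d y) = y"
      using M.finsum_supset[OF A, of "\<lambda>d. hc M d y"] finsum_hc[OF y] y by auto
    finally show "x \<oplus> y = (\<Oplus>d\<in>?A. hc M d x \<oplus> hc M d y)" by simp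
  qed (use A x y in \<open>auto intro: part_add hc_in_part\<close>)
qed

text \<open>Homogeneous induction, from the decomposition in \<open>finsum_hc\<close>. It replaces
  the handling of finite sums in almost all later arguments about components.\<close>

lemma hc_induct:
  assumes "x \<in> carrier M" "S \<subseteq> carrier M" "\<zero> \<in> S" "\<And>x y. \<lbrakk>x \<in> S; y \<in> S\<rbrakk> \<Longrightarrow> x \<oplus> y \<in> S"
    and "\<And>d. hc M d x \<in> S"
  shows "x \<in> S"
  by (subst finsum_hc[OF assms(1)]) (rule M.finsum_mem[OF finite_hc[OF assms(1)] assms(2-5)])

text \<open>Both sides are additive, so homogeneous elements decide. Applied to submodules and
  images, it identifies their components with those of the original module.\<close>

lemma hc_eqI:
  assumes add: "\<And>x y. \<lbrakk>x \<in> carrier M; y \<in> carrier M\<rbrakk> \<Longrightarrow> p (x \<oplus> y) = p x \<oplus> p y"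
    and part: "\<And>e x. x \<in> part M e \<Longrightarrow> p x = (if d = e then x else \<zero>)"
    and x: "x \<in> carrier M"
  shows "hc M d x = p x"
proof -
  have "x \<in> {x \<in> carrier M. hc M d x = p x}"
  proof (rule hc_induct[OF x])
    show "\<zero> \<in> {x \<in> carrier M. hc M d x = p x}"
      using part[OF part_zero[of d]] by simp
  next
    fix e show "hc M e x \<in> {x \<in> carrier M. hc M d x = p x}"
      using part[OF hc_in_part[OF x]] x by (simp add: hc_hc)
  qed (auto simp: hc_add add)
  then show ?thesis by simp
qed

lemma hc_eq_zeroD: "\<lbrakk>x \<in> carrier M; \<And>d. hc M d x = \<zero>\<rbrakk> \<Longrightarrow> x = \<zero>"
  using hc_induct[of x "{\<zero>}"] by simp

lemma smult_carrier [simp]: "\<lbrakk>p \<in> carrier R; x \<in> carrier M\<rbrakk> \<Longrightarrow> p \<odot> x \<in> carrier M"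
  by (rule smult_closed)

lemma smult_add_left: "\<lbrakk>p \<in> carrier R; q \<in> carrier R; x \<in> carrier M\<rbrakk> \<Longrightarrow> (p + q) \<odot> x = p \<odot> x \<oplus> q \<odot> x"
  using smult_l_distr by (simp add: free_algebra_simps)

lemma smult_mult: "\<lbrakk>p \<in> carrier R; q \<in> carrier R; x \<in> carrier M\<rbrakk> \<Longrightarrow> (p * q) \<odot> x = p \<odot> (q \<odot> x)"
  using smult_assoc by (simp add: free_algebra_simps)

lemma smult_X_zero [simp]: "x \<in> carrier M \<Longrightarrow> X 0 \<odot> x = x"
  using smult_one by (simp add: free_algebra_simps)

lemma smult_one_left [simp]: "x \<in> carrier M \<Longrightarrow> 1 \<odot> x = x"
  using smult_one by (simp add: free_algebra_simps)

lemma X_X: "\<lbrakk>v \<in> words n; w \<in> words n; x \<in> carrier M\<rbrakk> \<Longrightarrow> X v \<odot> (X w \<odot> x) = X (v + w) \<odot> x"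
  by (simp add: smult_mult[symmetric] X_mult)

lemma smult_zero_right [simp]: assumes "p \<in> carrier R" shows "p \<odot> \<zero> = \<zero>"
proof -
  have "p \<odot> \<zero> \<oplus> p \<odot> \<zero> = p \<odot> \<zero>"
    using smult_r_distr[OF assms M.zero_closed M.zero_closed] by simp
  then show ?thesis
    using assms M.add.l_cancel_one[of "p \<odot> \<zero>" "p \<odot> \<zero>"] by simp
qed

lemma zero_in_carrier [simp]: "0 \<in> carrier R"
  by (simp add: free_algebra_simps)

lemma smult_zero_left [simp]: assumes "x \<in> carrier M" shows "0 \<odot> x = \<zero>"
proof -
  have "0 \<odot> x \<oplus> 0 \<odot> x = 0 \<odot> x"
    using smult_add_left[of 0 0 x] assms by simp
  then show ?thesis
    using assms M.add.l_cancel_one[of "0 \<odot> x" "0 \<odot> x"] by simp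
qed

text \<open>Negation is a scalar multiplication, so closure under scalars already gives closure
  under negatives; \<open>gsub\<close> and \<open>rsub\<close> therefore do not list it.\<close>

lemma smult_minus: assumes "x \<in> carrier M" shows "const (-1) \<odot> x = \<ominus> x"
proof -
  have "const (-1) \<odot> x \<oplus> x = (const (-1) + const 1) \<odot> x"
    using assms smult_add_left[of "const (-1)" "const 1" x] smult_X_zero[of x]
    by (simp del: smult_X_zero single_one)
  also have "\<dots> = \<zero>"
    using assms by (simp flip: single_add del: single_one)
  finally show ?thesis
    using assms M.minus_equality[of "const (-1) \<odot> x" x] by simp
qed

lemma minus_part: "x \<in> part M d \<Longrightarrow> \<ominus> x \<in> part M d"
  using smult_part[OF const_in_part, of x d "-1"] smult_minus part_carrier by simp

lemma const_X_smult:
  "\<lbrakk>w \<in> words n; x \<in> carrier M\<rbrakk> \<Longrightarrow> X w \<odot> (const c \<odot> x) = const c \<odot> (X w \<odot> x)"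
  by (simp add: smult_mult[symmetric] const_X_commute del: mult_single)

lemma single_smult:
  "\<lbrakk>w \<in> words n; x \<in> carrier M\<rbrakk> \<Longrightarrow> Poly_Mapping.single w c \<odot> x = const c \<odot> (X w \<odot> x)"
  by (subst single_eq_const_X) (simp add: smult_mult)

text \<open>It suffices to test homogeneous \<open>x\<close>, where \<open>smult_part\<close> places
  the product in degree \<open>i + e\<close>.\<close>

lemma hc_smult:
  assumes "p \<in> part R i" "p \<in> carrier R" "x \<in> carrier M"
  shows "hc M d (p \<odot> x) = p \<odot> hc M (d - i) x"
proof -
  have "x \<in> {x \<in> carrier M. hc M d (p \<odot> x) = p \<odot> hc M (d - i) x}"
  proof (rule hc_induct[OF assms(3)])
    fix e
    have "hc M d (p \<odot> hc M e x) = (if d = i + e then p \<odot> hc M e x else \<zero>)"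
      by (rule hc_part) (rule smult_part[OF assms(1) hc_in_part[OF assms(3)]])
    moreover have "hc M (d - i) (hc M e x) = (if d - i = e then hc M e x else \<zero>)"
      using assms(3) by (rule hc_hc)
    ultimately show "hc M e x \<in> {x \<in> carrier M. hc M d (p \<odot> x) = p \<odot> hc M (d - i) x}"
      using assms by auto
  qed (use assms in \<open>auto simp: hc_add smult_r_distr\<close>)
  then show ?thesis by simp
qed

lemma hc_X: "\<lbrakk>w \<in> words n; x \<in> carrier M\<rbrakk> \<Longrightarrow> hc M d (X w \<odot> x) = X w \<odot> hc M (d - int (wlen w)) x"
  by (rule hc_smult) (auto simp: X_in_part)

lemma hc_const: "x \<in> carrier M \<Longrightarrow> hc M d (const c \<odot> x) = const c \<odot> hc M d x"
  using hc_smult[OF const_in_part, of c x d] by simp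

lemma hc_minus: "x \<in> carrier M \<Longrightarrow> hc M d (\<ominus> x) = \<ominus> hc M d x"
  by (simp flip: smult_minus add: hc_const)

end


section \<open>Graded submodules, quotients and transport\<close>

lemma (in abelian_group) subgroup_addI:
  assumes "S \<subseteq> carrier G" "\<zero> \<in> S" "\<And>x y. \<lbrakk>x \<in> S; y \<in> S\<rbrakk> \<Longrightarrow> x \<oplus> y \<in> S"
    and "\<And>x. x \<in> S \<Longrightarrow> \<exists>y\<in>S. y \<oplus> x = \<zero>"
  shows "subgroup S (add_monoid G)"
proof (rule add.subgroupI)
  fix x assume "x \<in> S"
  moreover from this obtain y where "y \<in> S" "y \<oplus> x = \<zero>"
    using assms(4) by blast
  ultimately show "\<ominus> x \<in> S"
    using assms(1) minus_equality by (metis subsetD)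
qed (use assms in auto)

lemma gmodI:
  fixes Q :: "(nat word \<Rightarrow>\<^sub>0 'k::field, 'u) graded" (structure)
  assumes "abelian_group Q" "is_grading Q"
    and "\<And>p x. \<lbrakk>p \<in> carrier (free_algebra n); x \<in> carrier Q\<rbrakk> \<Longrightarrow> p \<odot> x \<in> carrier Q"
    and "\<And>p q x. \<lbrakk>p \<in> carrier (free_algebra n); q \<in> carrier (free_algebra n); x \<in> carrier Q\<rbrakk> \<Longrightarrow>
      (p + q) \<odot> x = p \<odot> x \<oplus> q \<odot> x"
    and "\<And>p x y. \<lbrakk>p \<in> carrier (free_algebra n); x \<in> carrier Q; y \<in> carrier Q\<rbrakk> \<Longrightarrow>
      p \<odot> (x \<oplus> y) = p \<odot> x \<oplus> p \<odot> y"
    and "\<And>p q x. \<lbrakk>p \<in> carrier (free_algebra n); q \<in> carrier (free_algebra n); x \<in> carrier Q\<rbrakk> \<Longrightarrow>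
      (p * q) \<odot> x = p \<odot> (q \<odot> x)"
    and "\<And>x. x \<in> carrier Q \<Longrightarrow> 1 \<odot> x = x"
    and "\<And>p i x j. \<lbrakk>p \<in> part (free_algebra n) i; x \<in> part Q j\<rbrakk> \<Longrightarrow> p \<odot> x \<in> part Q (i + j)"
  shows "gmod n Q"
  using assms by (intro gmod.intro graded_left_module.intro graded_left_module_axioms.intro ring_free_algebra)
    (simp_all only: free_algebra_simps(2,3,5))

text \<open>An elementwise form of \<open>graded_submodule\<close>: closure under
  \<open>hc M\<close> replaces the requirement that the restricted structure carry a grading. The
  equivalence is \<open>graded_submodule_iff\<close>.\<close>

definition gsub :: "nat \<Rightarrow> (nat word \<Rightarrow>\<^sub>0 'k::field, 'u) graded \<Rightarrow> 'u set \<Rightarrow> bool" where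
  "gsub n M K \<longleftrightarrow> K \<subseteq> carrier M \<and> \<zero>\<^bsub>M\<^esub> \<in> K \<and> (\<forall>x\<in>K. \<forall>y\<in>K. x \<oplus>\<^bsub>M\<^esub> y \<in> K) \<and>
     (\<forall>p\<in>carrier (free_algebra n). \<forall>x\<in>K. p \<odot>\<^bsub>M\<^esub> x \<in> K) \<and> (\<forall>x\<in>K. \<forall>d. hc M d x \<in> K)"

lemma gsubD:
  assumes "gsub n M K"
  shows "K \<subseteq> carrier M" "\<zero>\<^bsub>M\<^esub> \<in> K" "\<lbrakk>x \<in> K; y \<in> K\<rbrakk> \<Longrightarrow> x \<oplus>\<^bsub>M\<^esub> y \<in> K"
    "\<lbrakk>p \<in> carrier (free_algebra n); x \<in> K\<rbrakk> \<Longrightarrow> p \<odot>\<^bsub>M\<^esub> x \<in> K" "x \<in> K \<Longrightarrow> hc M d x \<in> K"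
    "x \<in> K \<Longrightarrow> x \<in> carrier M"
  using assms by (auto simp: gsub_def)

lemma restrict_mod_simps [simp]:
  "carrier (restrict_mod M K) = K" "zero (restrict_mod M K) = zero M" "add (restrict_mod M K) = add M"
  "smult (restrict_mod M K) = smult M" "part (restrict_mod M K) d = part M d \<inter> K"
  by (simp_all add: restrict_mod_def)

context gmod
begin

lemma minus_zero: "\<ominus> \<zero> = \<zero>"
  using M.minus_equality[of \<zero> \<zero>] by simp

lemma gsub_minus: "\<lbrakk>gsub n M K; x \<in> K\<rbrakk> \<Longrightarrow> \<ominus> x \<in> K"
  using gsubD(4)[of n M K "const (-1)" x] smult_minus[of x] gsubD(1)[of n M K] by auto

lemma gsub_carrier: "gsub n M (carrier M)"
  by (simp add: gsub_def)

lemma gsub_zero: "gsub n M {\<zero>}"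
  by (simp add: gsub_def)

lemma abelian_group_restrict: "gsub n M K \<Longrightarrow> abelian_group (restrict_mod M K)"
proof (rule abelian_groupI)
  assume K: "gsub n M K"
  fix x assume x: "x \<in> carrier (restrict_mod M K)"
  show "\<exists>y\<in>carrier (restrict_mod M K). y \<oplus>\<^bsub>restrict_mod M K\<^esub> x = \<zero>\<^bsub>restrict_mod M K\<^esub>"
    using gsub_minus[OF K, of x] x gsubD(6)[OF K, of x]
    by (intro bexI[of _ "\<ominus> x"]) (auto simp: M.l_neg)
qed (use gsubD[of n M K] M.a_assoc M.a_comm in \<open>simp_all add: subset_iff\<close>)

text \<open>The grading is an assumption because it comes from two sources: from closure under
  components in \<open>gmod_restrict\<close>, and from the definition of a graded submodule in
  \<open>graded_submodule_iff\<close>.\<close>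

lemma gmod_restrictI:
  assumes "K \<subseteq> carrier M" "abelian_group (restrict_mod M K)" "is_grading (restrict_mod M K)"
    and closed: "\<And>p x. \<lbrakk>p \<in> carrier R; x \<in> K\<rbrakk> \<Longrightarrow> p \<odot> x \<in> K"
  shows "gmod n (restrict_mod M K)"
proof (rule gmodI)
  fix p i x j assume p: "p \<in> part R i" and x: "x \<in> part (restrict_mod M K) j"
  have "p \<in> carrier R" using p by (simp add: free_algebra_simps)
  then show "p \<odot>\<^bsub>restrict_mod M K\<^esub> x \<in> part (restrict_mod M K) (i + j)"
    using closed x smult_part[OF p, of x j] by simp
next
  fix x assume "x \<in> carrier (restrict_mod M K)"
  then show "1 \<odot>\<^bsub>restrict_mod M K\<^esub> x = x"
    using assms(1) smult_one[of x] by (simp add: subsetD free_algebra_simps(5))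
qed (use assms in \<open>simp_all add: smult_add_left smult_r_distr smult_mult subset_iff\<close>)

lemma gmod_restrict:
  assumes K: "gsub n M K"
  shows "gmod n (restrict_mod M K)"
proof (rule gmod_restrictI)
  interpret K: abelian_group "restrict_mod M K"
    using K by (rule abelian_group_restrict)
  show "abelian_group (restrict_mod M K)" ..
  have sub: "subgroup (part (restrict_mod M K) d) (add_monoid (restrict_mod M K))" for d
  proof (rule K.subgroup_addI)
    fix x assume x: "x \<in> part (restrict_mod M K) d"
    then have "x \<in> carrier M" by (auto dest: part_carrier)
    then show "\<exists>y\<in>part (restrict_mod M K) d. y \<oplus>\<^bsub>restrict_mod M K\<^esub> x = \<zero>\<^bsub>restrict_mod M K\<^esub>"
      using x gsub_minus[OF K, of x] minus_part[of x d]
      by (intro bexI[of _ "\<ominus> x"]) (auto simp: M.l_neg)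
  qed (auto simp: part_zero part_add gsubD[OF K])
  show "is_grading (restrict_mod M K)"
    unfolding is_grading_def
  proof (intro conjI allI ballI)
    fix d
    show "subgroup (part (restrict_mod M K) d) (add_monoid (restrict_mod M K))"
      by (rule sub)
  next
    fix x assume x: "x \<in> carrier (restrict_mod M K)"
    show "\<exists>!c. (\<forall>d. c d \<in> part (restrict_mod M K) d) \<and> finite {d. c d \<noteq> \<zero>\<^bsub>restrict_mod M K\<^esub>} \<and>
        x = (\<Oplus>\<^bsub>restrict_mod M K\<^esub>d\<in>{d. c d \<noteq> \<zero>\<^bsub>restrict_mod M K\<^esub>}. c d)"
    proof (rule K.is_gradingI[where p = "hc M"])
      show "subgroup (part (restrict_mod M K) d) (add_monoid (restrict_mod M K))" for d
        by (rule sub)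
    next
      fix x S assume "x \<in> carrier (restrict_mod M K)" "S \<subseteq> carrier (restrict_mod M K)"
        "\<zero>\<^bsub>restrict_mod M K\<^esub> \<in> S" "\<And>x y. \<lbrakk>x \<in> S; y \<in> S\<rbrakk> \<Longrightarrow> x \<oplus>\<^bsub>restrict_mod M K\<^esub> y \<in> S"
        "\<And>d. hc M d x \<in> S"
      then show "x \<in> S"
        using gsubD(1)[OF K] by (intro hc_induct[of x S]) auto
    qed (use x gsubD[OF K] in \<open>auto simp: hc_in_part hc_add finite_hc hc_part\<close>)
  qed
qed (use gsubD[OF K] in auto)

lemma hc_restrict:
  assumes "gsub n M K" "x \<in> K"
  shows "hc (restrict_mod M K) d x = hc M d x"
  by (rule gmod.hc_eqI[OF gmod_restrict[OF assms(1)], where p = "hc M d"])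
    (use assms gsubD[OF assms(1)] in \<open>auto simp: hc_add hc_part\<close>)

lemma graded_submodule_iff: "graded_submodule (free_algebra n) K M \<longleftrightarrow> gsub n M K"
proof
  assume K: "gsub n M K"
  have "subgroup K (add_monoid M)"
  proof (rule M.subgroup_addI)
    fix x assume "x \<in> K"
    then show "\<exists>y\<in>K. y \<oplus> x = \<zero>"
      using gsub_minus[OF K] gsubD(6)[OF K] M.l_neg by blast
  qed (auto simp: gsubD[OF K])
  then have "submodule K (free_algebra n) M"
    using gsubD[OF K] by (intro submodule.intro submodule_axioms.intro) auto
  then show "graded_submodule (free_algebra n) K M"
    unfolding graded_submodule_def
    using graded_left_module.grading[OF gmod.axioms[OF gmod_restrict[OF K]]] by (rule conjI)
next
  assume "graded_submodule (free_algebra n) K M"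
  then have sub: "submodule K (free_algebra n) M" and gr: "is_grading (restrict_mod M K)"
    by (auto simp: graded_submodule_def)
  interpret K: submodule K "free_algebra n" M by (rule sub)
  have closed: "x \<oplus> y \<in> K" if "x \<in> K" "y \<in> K" for x y
    using K.m_closed[of x y] that by simp
  have zero: "\<zero> \<in> K" using K.one_closed by simp
  have subset: "K \<subseteq> carrier M" using K.subset by simp
  have neg: "\<ominus> x \<in> K" if "x \<in> K" for x
    using K.smult_closed[of "const (-1)" x] smult_minus[of x] that subset by (simp add: subsetD)
  have "abelian_group (restrict_mod M K)"
  proof (rule abelian_groupI)
    fix x assume x: "x \<in> carrier (restrict_mod M K)"
    then show "\<exists>y\<in>carrier (restrict_mod M K). y \<oplus>\<^bsub>restrict_mod M K\<^esub> x = \<zero>\<^bsub>restrict_mod M K\<^esub>"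
      using neg[of x] subset by (intro bexI[of _ "\<ominus> x"]) (auto simp: M.l_neg subsetD)
  qed (use closed zero subset M.a_assoc M.a_comm in \<open>simp_all add: subset_iff\<close>)
  from subset this gr K.smult_closed have N: "gmod n (restrict_mod M K)"
    by (rule gmod_restrictI)
  \<comment> \<open>Elements of a part of the restricted structure are homogeneous in
    \<open>M\<close>, so \<open>hc M d\<close> and the component map of \<open>K\<close> agree on
    them and hence on all of \<open>K\<close>; closure of \<open>K\<close> under \<open>hc M\<close>
    follows.\<close>
  have hc_eq: "hc M d x = hc (restrict_mod M K) d x" if "x \<in> K" for d x
  proof -
    have "hc (restrict_mod M K) d x = hc M d x"
    proof (rule gmod.hc_eqI[OF N, where p = "hc M d"])
      fix x y assume "x \<in> carrier (restrict_mod M K)" "y \<in> carrier (restrict_mod M K)"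
      then show "hc M d (x \<oplus>\<^bsub>restrict_mod M K\<^esub> y) = hc M d x \<oplus>\<^bsub>restrict_mod M K\<^esub> hc M d y"
        using subset by (simp add: hc_add subset_iff)
    qed (use that hc_part in auto)
    then show ?thesis by (rule sym)
  qed
  show "gsub n M K"
    unfolding gsub_def
  proof (intro conjI ballI allI)
    fix x d assume "x \<in> K"
    then show "hc M d x \<in> K"
      using gmod.hc_carrier[OF N, of x d] by (simp add: hc_eq)
  qed (fact subset zero closed K.smult_closed)+
qed

text \<open>A common source for transported and quotient modules. The structure is carried along
  \<open>\<phi>\<close>, and \<open>ker\<close> says that the kernel of \<open>\<phi>\<close> is
  compatible with components, which is what they need in order to descend.\<close>

lemma image_gmod:
  fixes Q :: "(nat word \<Rightarrow>\<^sub>0 'k, 'v) graded"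
  assumes carr: "carrier Q = \<phi> ` carrier M" and zero: "\<zero>\<^bsub>Q\<^esub> = \<phi> \<zero>"
    and add: "\<And>x y. \<lbrakk>x \<in> carrier M; y \<in> carrier M\<rbrakk> \<Longrightarrow> \<phi> x \<oplus>\<^bsub>Q\<^esub> \<phi> y = \<phi> (x \<oplus> y)"
    and smult: "\<And>p x. \<lbrakk>p \<in> carrier R; x \<in> carrier M\<rbrakk> \<Longrightarrow> p \<odot>\<^bsub>Q\<^esub> \<phi> x = \<phi> (p \<odot> x)"
    and part: "\<And>d. part Q d = \<phi> ` part M d"
    and ker: "\<And>x d. \<lbrakk>x \<in> carrier M; \<phi> x = \<phi> \<zero>\<rbrakk> \<Longrightarrow> \<phi> (hc M d x) = \<phi> \<zero>"
  shows "gmod n Q" and "x \<in> carrier M \<Longrightarrow> hc Q d (\<phi> x) = \<phi> (hc M d x)"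
proof -
  have "abelian_group Q"
  proof (rule abelian_groupI)
    fix q assume "q \<in> carrier Q"
    then obtain x where "q = \<phi> x" "x \<in> carrier M" using carr by blast
    then show "\<exists>y\<in>carrier Q. y \<oplus>\<^bsub>Q\<^esub> q = \<zero>\<^bsub>Q\<^esub>"
      by (intro bexI[of _ "\<phi> (\<ominus> x)"]) (auto simp: carr add zero M.l_neg)
  qed (auto simp: carr add zero M.a_ac)
  then interpret Q: abelian_group Q .
  \<comment> \<open>Apply \<open>ker\<close> to the difference \<open>?z\<close> of \<open>x\<close>
    and \<open>y\<close>, then recover the component of \<open>x\<close> from those of
    \<open>?z\<close> and \<open>y\<close>.\<close>
  have hc_cong: "\<phi> (hc M d x) = \<phi> (hc M d y)"
    if xy: "x \<in> carrier M" "y \<in> carrier M" "\<phi> x = \<phi> y" for x y d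
  proof -
    let ?z = "x \<oplus> const (-1) \<odot> y"
    have "\<phi> ?z = \<phi> (y \<oplus> const (-1) \<odot> y)"
      using xy by (simp flip: add)
    also have "\<dots> = \<phi> \<zero>"
      using xy by (simp add: smult_minus M.r_neg)
    finally have "\<phi> (hc M d ?z) = \<phi> \<zero>"
      using ker[of ?z] xy by simp
    moreover have "hc M d x = hc M d ?z \<oplus> hc M d y"
      using xy by (simp add: hc_add hc_minus smult_minus M.a_assoc M.l_neg)
    ultimately have "\<phi> (hc M d x) = \<phi> \<zero> \<oplus>\<^bsub>Q\<^esub> \<phi> (hc M d y)"
      using xy by (simp flip: add)
    also have "\<dots> = \<phi> (\<zero> \<oplus> hc M d y)"
      using xy by (intro add) auto
    finally show ?thesis
      using xy by simp
  qed
  \<comment> \<open>The components of \<open>q\<close> are read off an arbitrary preimage;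
    \<open>hc_cong\<close> makes the choice irrelevant.\<close>
  define p where "p d q = \<phi> (hc M d (SOME x. x \<in> carrier M \<and> \<phi> x = q))" for d q
  have p: "p d (\<phi> x) = \<phi> (hc M d x)" if "x \<in> carrier M" for d x
  proof -
    have "(SOME y. y \<in> carrier M \<and> \<phi> y = \<phi> x) \<in> carrier M \<and> \<phi> (SOME y. y \<in> carrier M \<and> \<phi> y = \<phi> x) = \<phi> x"
      by (rule someI[of _ x]) (use that in simp)
    then show ?thesis
      unfolding p_def using hc_cong that by blast
  qed
  have sub: "subgroup (part Q d) (add_monoid Q)" for d
  proof (rule Q.subgroup_addI)
    fix q assume "q \<in> part Q d"
    then obtain x where x: "q = \<phi> x" "x \<in> part M d" using part by blast
    then have "const (-1) \<odot> x \<in> part M d" "x \<in> carrier M"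
      using smult_part[OF const_in_part, of x d "-1"] part_carrier by auto
    then show "\<exists>y\<in>part Q d. y \<oplus>\<^bsub>Q\<^esub> q = \<zero>\<^bsub>Q\<^esub>"
      using x by (intro bexI[of _ "\<phi> (const (-1) \<odot> x)"]) (auto simp: part add zero smult_minus M.l_neg)
  qed (auto simp: part carr part_carrier add part_add zero part_zero)
  have "is_grading Q"
    unfolding is_grading_def
  proof (intro conjI allI ballI sub)
    fix q assume q: "q \<in> carrier Q"
    show "\<exists>!c. (\<forall>d. c d \<in> part Q d) \<and> finite {d. c d \<noteq> \<zero>\<^bsub>Q\<^esub>} \<and> q = (\<Oplus>\<^bsub>Q\<^esub>d\<in>{d. c d \<noteq> \<zero>\<^bsub>Q\<^esub>}. c d)"
    proof (rule Q.is_gradingI[where p = p, OF sub])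
      fix q S assume q: "q \<in> carrier Q" and S: "S \<subseteq> carrier Q"
        "\<zero>\<^bsub>Q\<^esub> \<in> S" "\<And>x y. \<lbrakk>x \<in> S; y \<in> S\<rbrakk> \<Longrightarrow> x \<oplus>\<^bsub>Q\<^esub> y \<in> S" "\<And>d. p d q \<in> S"
      obtain x where x: "q = \<phi> x" "x \<in> carrier M" using q carr by blast
      have "x \<in> {x \<in> carrier M. \<phi> x \<in> S}"
        by (rule hc_induct) (use x S in \<open>auto simp: p zero simp flip: add\<close>)
      then show "q \<in> S" using x by simp
    next
      fix q assume "q \<in> carrier Q"
      then obtain x where x: "q = \<phi> x" "x \<in> carrier M" using carr by blast
      have "{d. p d q \<noteq> \<zero>\<^bsub>Q\<^esub>} \<subseteq> {d. hc M d x \<noteq> \<zero>}"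
        using x by (auto simp: p zero)
      then show "finite {d. p d q \<noteq> \<zero>\<^bsub>Q\<^esub>}"
        using finite_hc[OF x(2)] finite_subset by blast
    qed (use q in \<open>auto simp: carr part p add hc_add hc_in_part hc_part part_carrier zero\<close>)
  qed
  then show Q: "gmod n Q"
  proof (intro gmodI)
    fix p i q j assume p: "p \<in> part R i" and "q \<in> part Q j"
    then obtain x where x: "q = \<phi> x" "x \<in> part M j" using part by blast
    have "p \<in> carrier R" using p by (simp add: free_algebra_simps)
    then show "p \<odot>\<^bsub>Q\<^esub> q \<in> part Q (i + j)"
      using x smult_part[OF p x(2)] part_carrier[OF x(2)] by (simp add: smult part)
  next
    fix p q x assume pq: "p \<in> carrier R" "q \<in> carrier R" and "x \<in> carrier Q"
    then obtain y where "x = \<phi> y" "y \<in> carrier M" using carr by blast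
    then show "(p + q) \<odot>\<^bsub>Q\<^esub> x = p \<odot>\<^bsub>Q\<^esub> x \<oplus>\<^bsub>Q\<^esub> q \<odot>\<^bsub>Q\<^esub> x"
      "(p * q) \<odot>\<^bsub>Q\<^esub> x = p \<odot>\<^bsub>Q\<^esub> (q \<odot>\<^bsub>Q\<^esub> x)"
      using pq free_algebra_add_closed[OF pq] ring.ring_simprules(5)[OF ring_free_algebra pq]
      by (simp_all add: smult add smult_add_left smult_mult free_algebra_simps(3))
  next
    fix x assume "x \<in> carrier Q"
    then obtain y where "x = \<phi> y" "y \<in> carrier M" using carr by blast
    then show "1 \<odot>\<^bsub>Q\<^esub> x = x"
      using smult[of 1 y] smult_one[of y] single_in_free_algebra[of 0 n 1] by (simp add: free_algebra_simps(5))
  qed (use \<open>abelian_group Q\<close> in \<open>auto simp: carr smult add smult_r_distr\<close>)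
  show "hc Q d (\<phi> x) = \<phi> (hc M d x)" if x: "x \<in> carrier M"
  proof -
    have "hc Q d (\<phi> x) = p d (\<phi> x)"
      by (rule gmod.hc_eqI[OF Q, where p = "p d"]) (use x in \<open>auto simp: carr part p add hc_add hc_part part_carrier zero\<close>)
    then show ?thesis
      using x by (simp add: p)
  qed
qed

lemma transport_mod_image:
  assumes "inj_on \<iota> (carrier M)"
  shows gmod_transport: "gmod n (transport_mod \<iota> M)"
    and add_transport: "\<lbrakk>x \<in> carrier M; y \<in> carrier M\<rbrakk> \<Longrightarrow> \<iota> x \<oplus>\<^bsub>transport_mod \<iota> M\<^esub> \<iota> y = \<iota> (x \<oplus> y)"
    and smult_transport: "x \<in> carrier M \<Longrightarrow> p \<odot>\<^bsub>transport_mod \<iota> M\<^esub> \<iota> x = \<iota> (p \<odot> x)"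
    and zero_transport: "\<zero>\<^bsub>transport_mod \<iota> M\<^esub> = \<iota> \<zero>"
    and carrier_transport: "carrier (transport_mod \<iota> M) = \<iota> ` carrier M"
    and part_transport: "part (transport_mod \<iota> M) d = \<iota> ` part M d"
proof -
  let ?T = "transport_mod \<iota> M"
  show *: "\<iota> x \<oplus>\<^bsub>?T\<^esub> \<iota> y = \<iota> (x \<oplus> y)" if "x \<in> carrier M" "y \<in> carrier M" for x y
    using assms that by (simp add: transport_mod_def Let_def inv_into_f_f)
  show **: "p \<odot>\<^bsub>?T\<^esub> \<iota> x = \<iota> (p \<odot> x)" if "x \<in> carrier M" for x p
    using assms that by (simp add: transport_mod_def Let_def inv_into_f_f)
  show ***: "\<zero>\<^bsub>?T\<^esub> = \<iota> \<zero>" "carrier ?T = \<iota> ` carrier M" "part ?T d = \<iota> ` part M d" for d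
    by (simp_all add: transport_mod_def Let_def)
  have "\<iota> (hc M d x) = \<iota> \<zero>" if "x \<in> carrier M" "\<iota> x = \<iota> \<zero>" for x d
    using inj_onD[OF assms that(2,1)] by simp
  then show "gmod n ?T"
    using image_gmod(1)[where Q = ?T and \<phi> = \<iota>, OF ***(2,1) * ** ***(3)] by simp
qed

lemma coset_mem: "z \<in> K +>\<^bsub>M\<^esub> x \<longleftrightarrow> (\<exists>h\<in>K. z = h \<oplus> x)"
  by (auto simp: a_r_coset_def')

lemma coset_mem_iff:
  assumes "gsub n M K" "x \<in> carrier M"
  shows "z \<in> K +>\<^bsub>M\<^esub> x \<longleftrightarrow> z \<in> carrier M \<and> z \<ominus> x \<in> K"
proof -
  have "z = z \<ominus> x \<oplus> x" if "z \<in> carrier M"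
    using that assms by (simp add: a_minus_def M.a_assoc M.l_neg)
  moreover have "h \<oplus> x \<ominus> x = h" if "h \<in> K" for h
    using that assms gsubD[OF assms(1)] by (simp add: a_minus_def M.a_assoc M.r_neg)
  ultimately show ?thesis
    unfolding coset_mem using assms gsubD[OF assms(1)] by auto
qed

lemma gsub_abelian_subgroup: "gsub n M K \<Longrightarrow> abelian_subgroup K M"
  using graded_submodule_iff[of K]
  by (intro abelian_subgroupI3 additive_subgroupI)
    (auto simp: graded_submodule_def submodule_def M.abelian_group_axioms)

lemma coset_eq_iff:
  assumes "gsub n M K" "x \<in> carrier M" "y \<in> carrier M"
  shows "K +>\<^bsub>M\<^esub> x = K +>\<^bsub>M\<^esub> y \<longleftrightarrow> x \<ominus> y \<in> K"
proof -
  interpret K: abelian_subgroup K M using assms(1) by (rule gsub_abelian_subgroup)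
  show ?thesis
    using K.a_repr_independence'[of x y] K.a_rcos_self[of x] assms
      coset_mem_iff[OF assms(1,3), of x] by auto
qed

lemma coset_self: "\<lbrakk>gsub n M K; x \<in> carrier M\<rbrakk> \<Longrightarrow> x \<in> K +>\<^bsub>M\<^esub> x"
  by (simp add: coset_mem_iff a_minus_def M.r_neg gsubD)

lemma coset_eq_self_iff: "\<lbrakk>gsub n M K; x \<in> carrier M\<rbrakk> \<Longrightarrow> K +>\<^bsub>M\<^esub> x = K +>\<^bsub>M\<^esub> \<zero> \<longleftrightarrow> x \<in> K"
  by (subst coset_eq_iff) (auto simp: a_minus_def minus_zero)

lemma coset_zero: "gsub n M K \<Longrightarrow> K +>\<^bsub>M\<^esub> \<zero> = K"
  by (rule M.a_coset_add_zero) (rule gsubD)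

text \<open>The case of \<open>image_gmod\<close> in which \<open>\<phi>\<close> is the coset map.
  Since \<open>smult\<close> is defined as a union over a coset, the point to settle is that all
  representatives give the same coset.\<close>

lemma quot_mod_image:
  assumes K: "gsub n M K"
  shows gmod_quot: "gmod n (quot_mod M K)"
    and hc_quot: "x \<in> carrier M \<Longrightarrow> hc (quot_mod M K) d (K +> x) = K +> hc M d x"
    and add_quot: "\<lbrakk>x \<in> carrier M; y \<in> carrier M\<rbrakk> \<Longrightarrow>
      (K +> x) \<oplus>\<^bsub>quot_mod M K\<^esub> (K +> y) = K +> (x \<oplus> y)"
    and smult_quot: "\<lbrakk>p \<in> carrier R; x \<in> carrier M\<rbrakk> \<Longrightarrow>
      p \<odot>\<^bsub>quot_mod M K\<^esub> (K +> x) = K +> (p \<odot> x)"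
    and zero_quot: "\<zero>\<^bsub>quot_mod M K\<^esub> = K +> \<zero>"
    and carrier_quot: "carrier (quot_mod M K) = (\<lambda>x. K +> x) ` carrier M"
    and part_quot: "part (quot_mod M K) d = (\<lambda>x. K +> x) ` part M d"
proof -
  let ?Q = "quot_mod M K"
  interpret K: abelian_subgroup K M using K by (rule gsub_abelian_subgroup)
  show add: "(K +> x) \<oplus>\<^bsub>?Q\<^esub> (K +> y) = K +> (x \<oplus> y)" if "x \<in> carrier M" "y \<in> carrier M" for x y
    using that by (simp add: quot_mod_def K.a_rcos_sum)
  show smult: "p \<odot>\<^bsub>?Q\<^esub> (K +> x) = K +> (p \<odot> x)" if p: "p \<in> carrier R" and x: "x \<in> carrier M" for p x
  proof -
    have "K +> (p \<odot> z) = K +> (p \<odot> x)" if z: "z \<in> K +> x" for z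
    proof -
      obtain h where h: "h \<in> K" "z = h \<oplus> x" using z coset_mem by blast
      have "p \<odot> z = p \<odot> h \<oplus> p \<odot> x"
        using h p x gsubD(6)[OF K] by (simp add: smult_r_distr)
      then have "p \<odot> z \<in> K +> (p \<odot> x)"
        using gsubD(4)[OF K p h(1)] coset_mem by blast
      then show ?thesis
        using K.a_repr_independence'[of "p \<odot> z" "p \<odot> x"] smult_carrier[OF p x] by simp
    qed
    then have "(\<Union>z\<in>K +> x. K +> (p \<odot> z)) = (\<Union>z\<in>K +> x. K +> (p \<odot> x))"
      by (rule SUP_cong[OF refl])
    also have "\<dots> = K +> (p \<odot> x)"
      using coset_self[OF K x] by blast
    finally show ?thesis
      by (simp add: quot_mod_def)
  qed
  show zero: "\<zero>\<^bsub>?Q\<^esub> = K +> \<zero>"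
    using coset_zero[OF K] by (simp add: quot_mod_def)
  show car: "carrier ?Q = (\<lambda>x. K +> x) ` carrier M"
    by (auto simp: quot_mod_def A_RCOSETS_def')
  show part: "part ?Q d = (\<lambda>x. K +> x) ` part M d" for d
    by (simp add: quot_mod_def)
  show "gmod n ?Q" "x \<in> carrier M \<Longrightarrow> hc ?Q d (K +> x) = K +> hc M d x"
    using image_gmod[where Q = ?Q and \<phi> = "\<lambda>x. K +> x", OF car zero add smult part]
      coset_eq_self_iff[OF K] gsubD(5)[OF K] by simp_all
qed

end


section \<open>Torsion\<close>

text \<open>For a graded submodule \<open>K\<close> this is the preimage in \<open>M\<close> of the
  torsion submodule of the quotient by \<open>K\<close>; that it is all of \<open>M\<close>
  expresses that the quotient is torsion.\<close>

definition satur :: "nat \<Rightarrow> (nat word \<Rightarrow>\<^sub>0 'k::field, 'u) graded \<Rightarrow> 'u set \<Rightarrow> 'u set" where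
  "satur n M K = {x \<in> carrier M. ev n (\<lambda>w. X w \<odot>\<^bsub>M\<^esub> x \<in> K)}"

abbreviation torsion :: "nat \<Rightarrow> (nat word \<Rightarrow>\<^sub>0 'k::field, 'u) graded \<Rightarrow> 'u set" where
  "torsion n M \<equiv> satur n M {\<zero>\<^bsub>M\<^esub>}"

lemma saturD: "x \<in> satur n M K \<Longrightarrow> x \<in> carrier M" "x \<in> satur n M K \<Longrightarrow> ev n (\<lambda>w. X w \<odot>\<^bsub>M\<^esub> x \<in> K)"
  by (simp_all add: satur_def)

lemma saturI: "\<lbrakk>x \<in> carrier M; ev n (\<lambda>w. X w \<odot>\<^bsub>M\<^esub> x \<in> K)\<rbrakk> \<Longrightarrow> x \<in> satur n M K"
  by (simp add: satur_def)

lemma satur_mono: "K \<subseteq> L \<Longrightarrow> satur n M K \<subseteq> satur n M L"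
  by (auto simp: satur_def elim: ev_mono)

context gmod
begin

lemma satur_subset: "gsub n M K \<Longrightarrow> K \<subseteq> satur n M K"
  using gsubD[of n M K] by (auto simp: satur_def intro!: ev_all)

text \<open>For scalars: a word \<open>w\<close> applied to a multiple by \<open>v\<close> is the
  longer word \<open>w + v\<close>, and constants commute with words. For components: multiplication
  by \<open>X w\<close> only shifts the degree.\<close>

lemma gsub_satur:
  assumes K: "gsub n M K"
  shows "gsub n M (satur n M K)"
  unfolding gsub_def
proof (intro conjI ballI allI)
  show "\<zero> \<in> satur n M K"
    using satur_subset[OF K] gsubD(2)[OF K] by blast
  show add: "x \<oplus> y \<in> satur n M K" if "x \<in> satur n M K" "y \<in> satur n M K" for x y
  proof -
    have "ev n (\<lambda>w. X w \<odot> x \<in> K \<and> X w \<odot> y \<in> K)"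
      using that by (intro ev_conj) (auto dest: saturD)
    then have "ev n (\<lambda>w. X w \<odot> (x \<oplus> y) \<in> K)"
      by (rule ev_mono) (use that[THEN saturD(1)] gsubD(3)[OF K] in \<open>simp add: smult_r_distr\<close>)
    then show ?thesis
      using that by (auto simp: satur_def)
  qed
  show "p \<odot> x \<in> satur n M K" if p: "p \<in> carrier R" and x: "x \<in> satur n M K" for p x
    using p
  proof (induction p rule: free_algebra_induct)
    case zero
    then show ?case using x \<open>\<zero> \<in> satur n M K\<close> by (simp add: saturD)
  next
    case (single c v)
    have "ev n (\<lambda>w. X (w + v) \<odot> x \<in> K)"
      using ev_append_right[OF saturD(2)[OF x] single] .
    then have "ev n (\<lambda>w. X w \<odot> (Poly_Mapping.single v c \<odot> x) \<in> K)"
    proof (rule ev_mono)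
      fix w assume w: "w \<in> words n" "X (w + v) \<odot> x \<in> K"
      have "X w \<odot> (Poly_Mapping.single v c \<odot> x) = const c \<odot> (X (w + v) \<odot> x)"
        by (subst single_smult[OF single saturD(1)[OF x]])
          (use single w(1) saturD(1)[OF x] in \<open>simp add: const_X_smult X_X\<close>)
      then show "X w \<odot> (Poly_Mapping.single v c \<odot> x) \<in> K"
        using w(2) gsubD(4)[OF K] by simp
    qed
    then show ?case
      using single saturD(1)[OF x] by (intro saturI) simp_all
  next
    case (add p q)
    then show ?case
      using x \<open>\<And>y x. \<lbrakk>x \<in> satur n M K; y \<in> satur n M K\<rbrakk> \<Longrightarrow> x \<oplus> y \<in> satur n M K\<close>
      by (simp add: smult_add_left saturD)
  qed
  show "hc M d x \<in> satur n M K" if x: "x \<in> satur n M K" for x d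
  proof -
    have "ev n (\<lambda>w. X w \<odot> hc M d x \<in> K)"
      using saturD(2)[OF x]
    proof (rule ev_mono)
      fix w assume w: "w \<in> words n" "X w \<odot> x \<in> K"
      have "X w \<odot> hc M d x = hc M (d + int (wlen w)) (X w \<odot> x)"
        using x w by (simp add: hc_X saturD)
      then show "X w \<odot> hc M d x \<in> K"
        using w gsubD(5)[OF K] by simp
    qed
    then show ?thesis using x by (simp add: satur_def)
  qed
qed (auto dest: saturD)

lemma gsub_torsion: "gsub n M (torsion n M)"
  using gsub_satur[OF gsub_zero] .

text \<open>Two successive layers of long words merge into one by \<open>ev_ev\<close>. For the zero
  submodule this says that the quotient by torsion has no torsion.\<close>

lemma satur_satur: "satur n M (satur n M K) = satur n M K" if "gsub n M K"
proof
  show "satur n M (satur n M K) \<subseteq> satur n M K"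
  proof
    fix x assume x: "x \<in> satur n M (satur n M K)"
    have "ev n (\<lambda>v. ev n (\<lambda>u. X (u + v) \<odot> x \<in> K))"
      using saturD(2)[OF x]
    proof (rule ev_mono)
      fix v assume "v \<in> words n" "X v \<odot> x \<in> satur n M K"
      then show "ev n (\<lambda>u. X (u + v) \<odot> x \<in> K)"
        using saturD(1)[OF x] by (intro ev_mono[OF saturD(2)[of "X v \<odot> x" n M K]]) (simp_all add: X_X)
    qed
    then show "x \<in> satur n M K"
      using x ev_ev[of n "\<lambda>w. X w \<odot> x \<in> K"] by (simp add: satur_def)
  qed
qed (rule satur_subset[OF gsub_satur[OF that]])

lemma gsub_Int: "\<lbrakk>gsub n M K; gsub n M L\<rbrakk> \<Longrightarrow> gsub n M (K \<inter> L)"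
  by (auto simp: gsub_def)

lemma satur_Int: "satur n M (K \<inter> L) = satur n M K \<inter> satur n M L"
  by (auto simp: satur_def intro: ev_conj elim: ev_mono)

text \<open>A finite spanning set has components in finitely many degrees only, and a sufficiently
  long word moves every degree out of this range.\<close>

lemma finite_dim_imp_torsion:
  assumes "finite_dim (free_algebra n) M" "x \<in> carrier M"
  shows "x \<in> torsion n M"
proof -
  obtain B where B: "finite B" "B \<subseteq> carrier M"
    and span: "\<And>m. m \<in> carrier M \<Longrightarrow> \<exists>c :: _ \<Rightarrow> 'k. m = (\<Oplus>b\<in>B. (c b \<odot>\<^bsub>R\<^esub> \<one>\<^bsub>R\<^esub>) \<odot> b)"
    using assms(1) unfolding finite_dim_def by blast
  let ?E = "\<Union>b\<in>B. {d. hc M d b \<noteq> \<zero>}"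
  have "finite ?E"
    using B finite_hc by blast
  then have "finite ((\<lambda>d. nat \<bar>d\<bar>) ` ?E)" by simp
  then obtain D where D: "\<And>d. d \<in> ?E \<Longrightarrow> nat \<bar>d\<bar> \<le> D"
    by (auto simp: finite_nat_set_iff_bounded_le)
  have supp: "hc M d m = \<zero>" if m: "m \<in> carrier M" and d: "d \<notin> ?E" for m d
  proof -
    obtain c :: "_ \<Rightarrow> 'k" where c: "m = (\<Oplus>b\<in>B. const (c b) \<odot> b)"
      using span[OF m] unfolding smult_one_free_algebra by blast
    have "m \<in> {m \<in> carrier M. hc M d m = \<zero>}"
      unfolding c by (rule M.finsum_mem) (use B d in \<open>auto simp: hc_add hc_const subset_iff\<close>)
    then show ?thesis by simp
  qed
  \<comment> \<open>All occurring degrees lie between \<open>-D\<close> and \<open>D\<close>, so a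
    shift by at least \<open>2 * D + 1\<close> leaves this interval.\<close>
  have "X w \<odot> x = \<zero>" if w: "w \<in> words n" "2 * D + 1 \<le> wlen w" for w
  proof (rule hc_eq_zeroD)
    fix d
    show "hc M d (X w \<odot> x) = \<zero>"
    proof (cases "d \<in> ?E")
      case True
      have "d - int (wlen w) \<notin> ?E"
        using D[OF True] D[of "d - int (wlen w)"] w(2) by linarith
      then show ?thesis
        using w assms(2) by (simp add: hc_X supp)
    next
      case False
      with w assms(2) show ?thesis
        using supp[of "X w \<odot> x" d] by simp
    qed
  qed (use w assms(2) in simp)
  then show ?thesis
    using assms(2) unfolding satur_def ev_def by blast
qed

section \<open>Finite-dimensional graded submodules around torsion elements\<close>

inductive_set lin :: "'u set \<Rightarrow> 'u set" for B where
  lin_zero: "\<zero> \<in> lin B"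
| lin_base: "b \<in> B \<Longrightarrow> b \<in> lin B"
| lin_add: "\<lbrakk>x \<in> lin B; y \<in> lin B\<rbrakk> \<Longrightarrow> x \<oplus> y \<in> lin B"
| lin_scale: "x \<in> lin B \<Longrightarrow> const c \<odot> x \<in> lin B"

lemma lin_mono: "B \<subseteq> B' \<Longrightarrow> lin B \<subseteq> lin B'"
proof
  fix x assume "x \<in> lin B" "B \<subseteq> B'"
  then show "x \<in> lin B'"
    by (induction rule: lin.induct) (auto intro: lin.intros)
qed

lemma lin_carrier: "\<lbrakk>B \<subseteq> carrier M; x \<in> lin B\<rbrakk> \<Longrightarrow> x \<in> carrier M"
  by (rotate_tac, induction rule: lin.induct) auto

text \<open>
  Closure under the letters up to \<open>0\<close> makes the span a submodule, and it passes to unions of two such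
  sets, which yields the directed family required by the definition of \<open>Fdim\<close>.
\<close>

definition stable_basis :: "'u set \<Rightarrow> bool" where
  "stable_basis B \<longleftrightarrow> finite B \<and> (\<forall>b\<in>B. \<exists>d. b \<in> part M d) \<and>
     (\<forall>b\<in>B. \<forall>w\<in>words n. wlen w = 1 \<longrightarrow> X w \<odot> b \<in> insert \<zero> B)"

text \<open>Stability under letters extends to the span by linearity, to words by induction on the
  length, and to all scalars by \<open>free_algebra_induct\<close>.\<close>

lemma gsub_lin:
  assumes B: "stable_basis B"
  shows "gsub n M (lin B)"
proof -
  have Bc: "B \<subseteq> carrier M"
    using B part_carrier by (auto simp: stable_basis_def)
  note lc = lin_carrier[OF Bc]
  have letter: "X w \<odot> x \<in> lin B" if "x \<in> lin B" "w \<in> words n" "wlen w = 1" for w x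
    using that
  proof (induction rule: lin.induct)
    case (lin_base b)
    then have "X w \<odot> b \<in> insert \<zero> B"
      using B by (auto simp: stable_basis_def)
    then show ?case by (auto intro: lin.intros)
  qed (auto simp: smult_r_distr const_X_smult lc intro: lin.intros simp del: mult_single)
  have word: "X w \<odot> x \<in> lin B" if "x \<in> lin B" "w \<in> words n" for w x
    using that(2)
  proof (induction "wlen w" arbitrary: w)
    case 0
    then have "w = 0" by (cases w) (simp add: zero_word_def)
    then show ?case using that lc by simp
  next
    case (Suc k)
    from Suc(2) have "k \<le> wlen w" by simp
    from word_split[OF Suc(3) this] obtain u v where
      uv: "w = u + v" "u \<in> words n" "v \<in> words n" "wlen v = k" "wlen u = wlen w - k" .
    have "wlen u = 1" using uv(5) Suc(2) by linarith
    then have "X u \<odot> (X v \<odot> x) \<in> lin B"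
      using letter[OF Suc(1)[OF uv(4)[symmetric] uv(3)] uv(2)] by simp
    then show ?case
      unfolding uv(1) X_X[OF uv(2,3) lc[OF that(1)]] .
  qed
  show ?thesis
    unfolding gsub_def
  proof (intro conjI ballI allI)
    fix p x assume p: "p \<in> carrier R" and x: "x \<in> lin B"
    show "p \<odot> x \<in> lin B"
      using p
    proof (induction p rule: free_algebra_induct)
      case (single c w)
      show ?case
        by (subst single_smult[OF single lc[OF x]]) (intro lin_scale word x single)
    qed (use x lc in \<open>auto simp: smult_add_left intro: lin.intros\<close>)
  next
    fix x d assume "x \<in> lin B"
    then show "hc M d x \<in> lin B"
    proof (induction rule: lin.induct)
      case (lin_base b)
      then obtain e where "b \<in> part M e" using B by (auto simp: stable_basis_def)
      then show ?case using lin_base by (auto simp: hc_part intro: lin.intros)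
    qed (auto simp: hc_add hc_const lc intro: lin.intros)
  qed (auto intro: lin.intros lc)
qed

lemma finite_dim_lin:
  assumes B: "stable_basis B"
  shows "finite_dim (free_algebra n) (restrict_mod M (lin B))"
  unfolding finite_dim_def
proof (intro exI[of _ B] conjI ballI)
  let ?N = "restrict_mod M (lin B)"
  have fin: "finite B" and Bc: "B \<subseteq> carrier M"
    using B part_carrier by (auto simp: stable_basis_def)
  interpret N: abelian_group ?N
    using gsub_lin[OF B] by (rule abelian_group_restrict)
  have Bl: "b \<in> lin B" if "b \<in> B" for b using that by (rule lin_base)
  have cl: "const (c b) \<odot> b \<in> lin B" if "b \<in> B" for c b using that by (intro lin_scale lin_base)
  show "finite B" by (rule fin)
  show "B \<subseteq> carrier ?N" using Bl by auto
  fix m assume "m \<in> carrier ?N"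
  then have "m \<in> lin B" by simp
  then have "\<exists>c :: 'u \<Rightarrow> 'k. m = (\<Oplus>\<^bsub>?N\<^esub>b\<in>B. const (c b) \<odot> b)"
  proof (induction rule: lin.induct)
    case lin_zero
    have "(\<Oplus>\<^bsub>?N\<^esub>b\<in>B. const 0 \<odot> b) = (\<Oplus>\<^bsub>?N\<^esub>b\<in>B. \<zero>\<^bsub>?N\<^esub>)"
      using Bc by (intro N.finsum_cong') (auto intro: lin.intros)
    also have "\<dots> = \<zero>"
      using N.finsum_zero[of B] by simp
    finally have "\<zero> = (\<Oplus>\<^bsub>?N\<^esub>b\<in>B. const 0 \<odot> b)" by (rule sym)
    then show ?case by (rule exI[where x = "\<lambda>_. 0"])
  next
    case (lin_base b)
    have "(\<Oplus>\<^bsub>?N\<^esub>a\<in>B. const (if b = a then 1 else 0) \<odot> a) = (\<Oplus>\<^bsub>?N\<^esub>a\<in>B. if b = a then a else \<zero>\<^bsub>?N\<^esub>)"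
      using Bc by (intro N.finsum_cong') (auto intro: lin.intros)
    also have "\<dots> = b"
      using fin lin_base Bl by (subst N.finsum_singleton) auto
    finally have "b = (\<Oplus>\<^bsub>?N\<^esub>a\<in>B. const (if b = a then 1 else 0) \<odot> a)" by (rule sym)
    then show ?case by (rule exI[where x = "\<lambda>a. if b = a then 1 else 0"])
  next
    case (lin_add x y)
    then obtain c c' :: "'u \<Rightarrow> 'k" where
      "x = (\<Oplus>\<^bsub>?N\<^esub>b\<in>B. const (c b) \<odot> b)" "y = (\<Oplus>\<^bsub>?N\<^esub>b\<in>B. const (c' b) \<odot> b)" by blast
    then have "x \<oplus> y = (\<Oplus>\<^bsub>?N\<^esub>b\<in>B. const (c b) \<odot> b \<oplus>\<^bsub>?N\<^esub> const (c' b) \<odot> b)"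
      using cl N.finsum_addf[of "\<lambda>b. const (c b) \<odot> b" B "\<lambda>b. const (c' b) \<odot> b"] by (simp add: Pi_def)
    also have "\<dots> = (\<Oplus>\<^bsub>?N\<^esub>b\<in>B. const (c b + c' b) \<odot> b)"
      using Bc cl by (intro N.finsum_cong') (auto simp: single_add smult_add_left Bc[THEN subsetD] intro!: lin.lin_add)
    finally show ?case by (rule exI[where x = "\<lambda>b. c b + c' b"])
  next
    case (lin_scale x a)
    then obtain c :: "'u \<Rightarrow> 'k" where c: "x = (\<Oplus>\<^bsub>?N\<^esub>b\<in>B. const (c b) \<odot> b)" by blast
    have "const a \<odot> (\<Oplus>\<^bsub>?N\<^esub>b\<in>A. const (c b) \<odot> b) = (\<Oplus>\<^bsub>?N\<^esub>b\<in>A. const (a * c b) \<odot> b)"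
      if "A \<subseteq> B" for A
      using finite_subset[OF that fin] that
    proof (induction A rule: finite_induct)
      case (insert b A)
      have mem: "(\<Oplus>\<^bsub>?N\<^esub>b\<in>A. const (c b) \<odot> b) \<in> lin B"
        using N.finsum_closed[of "\<lambda>b. const (c b) \<odot> b" A] insert cl by (auto simp: Pi_def)
      have "(\<Oplus>\<^bsub>?N\<^esub>b\<in>insert b A. const (c b) \<odot> b) =
          const (c b) \<odot> b \<oplus> (\<Oplus>\<^bsub>?N\<^esub>b\<in>A. const (c b) \<odot> b)"
        by (subst N.finsum_insert) (use insert cl in auto)
      moreover have "(\<Oplus>\<^bsub>?N\<^esub>b\<in>insert b A. const (a * c b) \<odot> b) =
          const (a * c b) \<odot> b \<oplus> (\<Oplus>\<^bsub>?N\<^esub>b\<in>A. const (a * c b) \<odot> b)"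
        by (subst N.finsum_insert) (use insert cl[where c = "\<lambda>b. a * c b"] in auto)
      moreover have "const (a * c b) \<odot> b = const a \<odot> (const (c b) \<odot> b)"
        using insert Bc by (subst smult_mult[symmetric]) (auto simp: mult_single)
      ultimately show ?case
        using insert Bc mem lin_carrier[OF Bc] by (simp add: smult_r_distr subset_iff)
    qed simp
    from this[OF order_refl] show ?case
      unfolding c by (rule exI[where x = "\<lambda>b. a * c b"])
  qed
  then show "\<exists>c :: 'u \<Rightarrow> 'k. m = (\<Oplus>\<^bsub>?N\<^esub>b\<in>B. (c b \<odot>\<^bsub>R\<^esub> \<one>\<^bsub>R\<^esub>) \<odot>\<^bsub>?N\<^esub> b)"
    unfolding smult_one_free_algebra by simp
qed

text \<open>The components of \<open>x\<close>, multiplied by all short words, form a finite set of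
  homogeneous elements. Longer words annihilate each component, because they annihilate
  \<open>x\<close> and commute with taking components up to a shift of degree.\<close>

lemma torsion_stable_basis:
  assumes x: "x \<in> torsion n M"
  obtains B where "stable_basis B" "x \<in> lin B"
proof -
  have xc: "x \<in> carrier M" using x by (rule saturD)
  let ?E = "{d. hc M d x \<noteq> \<zero>}"
  obtain D where D: "\<And>w. \<lbrakk>w \<in> words n; D \<le> wlen w\<rbrakk> \<Longrightarrow> X w \<odot> x = \<zero>"
    using saturD(2)[OF x] unfolding ev_def by auto
  have D_hc: "X w \<odot> hc M d x = \<zero>" if w: "w \<in> words n" "D \<le> wlen w" for w d
  proof -
    have "X w \<odot> hc M d x = hc M (d + int (wlen w)) (X w \<odot> x)"
      using xc w by (simp add: hc_X)
    then show ?thesis using D w by simp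
  qed
  \<comment> \<open>The bound \<open>Suc D\<close> keeps the empty word in range for every
    \<open>D\<close>, so that the nonzero components of \<open>x\<close> themselves belong to the
    set.\<close>
  let ?B = "(\<lambda>(w, d). X w \<odot> hc M d x) ` ({w \<in> words n. wlen w < Suc D} \<times> ?E)"
  have "stable_basis ?B"
    unfolding stable_basis_def
  proof (intro conjI ballI impI)
    show "finite ?B"
      using finite_words_upto[of n "Suc D"] finite_hc[OF xc] by simp
  next
    fix b assume "b \<in> ?B"
    then obtain w d where "w \<in> words n" "b = X w \<odot> hc M d x" by auto
    then have "b \<in> part M (int (wlen w) + d)"
      using smult_part[OF X_in_part hc_in_part[OF xc]] by simp
    then show "\<exists>d. b \<in> part M d" ..
  next
    fix b v assume "b \<in> ?B" and v: "v \<in> words n" "wlen v = 1"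
    then obtain w d where w: "w \<in> words n" "wlen w < Suc D" "d \<in> ?E" "b = X w \<odot> hc M d x" by auto
    then have b: "X v \<odot> b = X (v + w) \<odot> hc M d x"
      using v xc by (simp add: X_X)
    show "X v \<odot> b \<in> insert \<zero> ?B"
    proof (cases "wlen (v + w) < Suc D")
      case True
      then have "X v \<odot> b \<in> ?B"
        unfolding b using v w by (intro image_eqI[of _ _ "(v + w, d)"]) auto
      then show ?thesis by blast
    next
      case False
      then have "X v \<odot> b = \<zero>"
        unfolding b using v w by (intro D_hc) auto
      then show ?thesis by blast
    qed
  qed
  moreover have "x \<in> lin ?B"
  proof (rule hc_induct[OF xc])
    have "?B \<subseteq> carrier M" using xc by auto
    then show "lin ?B \<subseteq> carrier M" using lin_carrier by blast
  next
    fix d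
    show "hc M d x \<in> lin ?B"
    proof (cases "d \<in> ?E")
      case True
      have "hc M d x \<in> ?B"
        using True xc by (intro image_eqI[of _ _ "(0, d)"]) (auto simp del: single_one)
      then show ?thesis by (rule lin_base)
    qed (auto intro: lin.intros)
  qed (auto intro: lin.intros)
  ultimately show ?thesis by (rule that)
qed

text \<open>Finite-dimensional submodules are torsion, which gives one direction. Conversely the
  spans \<open>lin B\<close> of stable sets are finite-dimensional and directed, and they reach
  every torsion element.\<close>

lemma fdim_iff: "fdim (free_algebra n) M \<longleftrightarrow> torsion n M = carrier M"
proof
  assume "fdim (free_algebra n) M"
  then obtain F where F: "\<forall>H\<in>F. graded_submodule (free_algebra n) H M \<and>
      finite_dim (free_algebra n) (restrict_mod M H)" and M: "carrier M = \<Union>F"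
    unfolding fdim_def by (elim conjE exE)
  have "x \<in> torsion n M" if x: "x \<in> carrier M" for x
  proof -
    obtain H where H: "H \<in> F" "x \<in> H" using x M by blast
    have "gsub n M H" using F H(1) by (simp add: graded_submodule_iff)
    then have "x \<in> torsion n (restrict_mod M H)"
      using gmod.finite_dim_imp_torsion[OF gmod_restrict] F H by simp
    then show ?thesis using x by (simp add: satur_def)
  qed
  then show "torsion n M = carrier M" by (auto dest: saturD)
next
  assume T: "torsion n M = carrier M"
  let ?F = "{lin B | B. stable_basis B}"
  have "?F \<noteq> {}"
    by (auto simp: stable_basis_def intro!: exI[of _ "{}"])
  moreover have "graded_submodule (free_algebra n) H M \<and> finite_dim (free_algebra n) (restrict_mod M H)"
    if "H \<in> ?F" for H
    using that gsub_lin finite_dim_lin by (auto simp: graded_submodule_iff)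
  moreover have "\<exists>H''\<in>?F. H \<union> H' \<subseteq> H''" if "H \<in> ?F" "H' \<in> ?F" for H H'
  proof -
    obtain B B' where B: "H = lin B" "H' = lin B'" "stable_basis B" "stable_basis B'"
      using \<open>H \<in> ?F\<close> \<open>H' \<in> ?F\<close> by blast
    then have "stable_basis (B \<union> B')" by (auto simp: stable_basis_def)
    then show ?thesis
      using B lin_mono[of B "B \<union> B'"] lin_mono[of B' "B \<union> B'"] by blast
  qed
  moreover have "carrier M = \<Union>?F"
  proof
    show "carrier M \<subseteq> \<Union>?F"
    proof
      fix x assume "x \<in> carrier M"
      then obtain B where "stable_basis B" "x \<in> lin B"
        using torsion_stable_basis[of x] T by blast
      then show "x \<in> \<Union>?F" by blast
    qed
  qed (use gsubD(1)[OF gsub_lin] in blast)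
  ultimately show "fdim (free_algebra n) M"
    unfolding fdim_def using graded_left_module_axioms by (intro conjI exI[of _ ?F]) simp_all
qed

text \<open>A word annihilates the coset of \<open>x\<close> exactly when it moves \<open>x\<close>
  into \<open>K\<close>.\<close>

lemma fdim_quot_iff:
  assumes K: "gsub n M K"
  shows "fdim (free_algebra n) (quot_mod M K) \<longleftrightarrow> satur n M K = carrier M"
proof -
  have iff: "K +> x \<in> torsion n (quot_mod M K) \<longleftrightarrow> x \<in> satur n M K" if x: "x \<in> carrier M" for x
  proof -
    have "X w \<odot>\<^bsub>quot_mod M K\<^esub> (K +> x) = \<zero>\<^bsub>quot_mod M K\<^esub> \<longleftrightarrow> X w \<odot> x \<in> K" if "w \<in> words n" for w
      unfolding smult_quot[OF K single_in_free_algebra[OF that] x] zero_quot[OF K]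
      by (rule coset_eq_self_iff[OF K]) (use that x in simp)
    then have "ev n (\<lambda>w. X w \<odot>\<^bsub>quot_mod M K\<^esub> (K +> x) \<in> {\<zero>\<^bsub>quot_mod M K\<^esub>}) = ev n (\<lambda>w. X w \<odot> x \<in> K)"
      by (intro ev_cong) simp
    then show ?thesis
      using x by (simp add: satur_def carrier_quot[OF K])
  qed
  have "fdim (free_algebra n) (quot_mod M K) \<longleftrightarrow> (\<forall>x\<in>carrier M. K +> x \<in> torsion n (quot_mod M K))"
    unfolding gmod.fdim_iff[OF gmod_quot[OF K]] by (auto simp: carrier_quot[OF K] dest: saturD)
  also have "\<dots> \<longleftrightarrow> satur n M K = carrier M"
    using iff by (auto dest: saturD)
  finally show ?thesis .
qed

lemma q_dom_iff: "K \<in> q_dom (free_algebra n) M \<longleftrightarrow> gsub n M K \<and> satur n M K = carrier M"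
  unfolding q_dom_def using fdim_quot_iff graded_submodule_iff by auto

lemma q_tor_iff: "K \<in> q_tor (free_algebra n) M \<longleftrightarrow> gsub n M K \<and> K \<subseteq> torsion n M"
proof -
  have "fdim (free_algebra n) (restrict_mod M K) \<longleftrightarrow> K \<subseteq> torsion n M" if K: "gsub n M K"
    unfolding gmod.fdim_iff[OF gmod_restrict[OF K]]
    using gsubD(6)[OF K] by (auto simp: satur_def)
  then show ?thesis
    unfolding q_tor_def using graded_submodule_iff by auto
qed

end


section \<open>Morphisms of the quotient category as graded linear relations\<close>

text \<open>Congruence modulo torsion, see \<open>teq_iff\<close>, phrased without subtraction: the
  laws of an equivalence relation are then properties of \<open>ev\<close> alone.\<close>

definition teq :: "nat \<Rightarrow> (nat word \<Rightarrow>\<^sub>0 'k::field, 'u) graded \<Rightarrow> 'u \<Rightarrow> 'u \<Rightarrow> bool" where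
  "teq n N y y' \<longleftrightarrow> ev n (\<lambda>w. X w \<odot>\<^bsub>N\<^esub> y = X w \<odot>\<^bsub>N\<^esub> y')"

lemma teq_refl: "teq n N y y"
  by (simp add: teq_def ev_all)

lemma teq_sym: "teq n N y y' \<Longrightarrow> teq n N y' y"
  unfolding teq_def by (elim ev_mono) simp

lemma teq_trans: "\<lbrakk>teq n N x y; teq n N y z\<rbrakk> \<Longrightarrow> teq n N x z"
  unfolding teq_def by (drule (1) ev_conj) (elim ev_mono, simp)

text \<open>A graded submodule of the direct sum of \<open>M\<close> and \<open>N\<close>, spelled
  out on pairs so that the direct sum need not be formed.\<close>

definition rsub :: "nat \<Rightarrow> (nat word \<Rightarrow>\<^sub>0 'k::field, 'u) graded \<Rightarrow> (nat word \<Rightarrow>\<^sub>0 'k, 'v) graded \<Rightarrow>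
    ('u \<times> 'v) set \<Rightarrow> bool" where
  "rsub n M N G \<longleftrightarrow> G \<subseteq> carrier M \<times> carrier N \<and> (\<zero>\<^bsub>M\<^esub>, \<zero>\<^bsub>N\<^esub>) \<in> G \<and>
     (\<forall>x y x' y'. (x, y) \<in> G \<longrightarrow> (x', y') \<in> G \<longrightarrow> (x \<oplus>\<^bsub>M\<^esub> x', y \<oplus>\<^bsub>N\<^esub> y') \<in> G) \<and>
     (\<forall>p\<in>carrier (free_algebra n). \<forall>x y. (x, y) \<in> G \<longrightarrow> (p \<odot>\<^bsub>M\<^esub> x, p \<odot>\<^bsub>N\<^esub> y) \<in> G) \<and>
     (\<forall>d x y. (x, y) \<in> G \<longrightarrow> (hc M d x, hc N d y) \<in> G)"

lemma rsubD:
  assumes "rsub n M N G"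
  shows "(x, y) \<in> G \<Longrightarrow> x \<in> carrier M" "(x, y) \<in> G \<Longrightarrow> y \<in> carrier N" "(\<zero>\<^bsub>M\<^esub>, \<zero>\<^bsub>N\<^esub>) \<in> G"
    "\<lbrakk>(x, y) \<in> G; (x', y') \<in> G\<rbrakk> \<Longrightarrow> (x \<oplus>\<^bsub>M\<^esub> x', y \<oplus>\<^bsub>N\<^esub> y') \<in> G"
    "\<lbrakk>p \<in> carrier (free_algebra n); (x, y) \<in> G\<rbrakk> \<Longrightarrow> (p \<odot>\<^bsub>M\<^esub> x, p \<odot>\<^bsub>N\<^esub> y) \<in> G"
    "(x, y) \<in> G \<Longrightarrow> (hc M d x, hc N d y) \<in> G"
  using assms unfolding rsub_def by blast+

lemma rsub_X: "\<lbrakk>rsub n M N G; w \<in> words n; (x, y) \<in> G\<rbrakk> \<Longrightarrow> (X w \<odot>\<^bsub>M\<^esub> x, X w \<odot>\<^bsub>N\<^esub> y) \<in> G"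
  by (erule rsubD(5)[OF _ single_in_free_algebra])

lemma rsubI:
  assumes "\<And>x y. (x, y) \<in> G \<Longrightarrow> x \<in> carrier M \<and> y \<in> carrier N" "(\<zero>\<^bsub>M\<^esub>, \<zero>\<^bsub>N\<^esub>) \<in> G"
    and "\<And>x y x' y'. \<lbrakk>(x, y) \<in> G; (x', y') \<in> G\<rbrakk> \<Longrightarrow> (x \<oplus>\<^bsub>M\<^esub> x', y \<oplus>\<^bsub>N\<^esub> y') \<in> G"
    and "\<And>p x y. \<lbrakk>p \<in> carrier (free_algebra n); (x, y) \<in> G\<rbrakk> \<Longrightarrow> (p \<odot>\<^bsub>M\<^esub> x, p \<odot>\<^bsub>N\<^esub> y) \<in> G"
    and "\<And>x y d. (x, y) \<in> G \<Longrightarrow> (hc M d x, hc N d y) \<in> G"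
  shows "rsub n M N G"
  unfolding rsub_def using assms(1) by (intro conjI allI impI ballI assms(2-5) subsetI) auto

lemma rsub_converse:
  assumes "rsub n M N G"
  shows "rsub n N M (G\<inverse>)"
  by (rule rsubI) (simp_all add: rsubD[OF assms])

lemma rsub_comp:
  assumes G: "rsub n M N G" and H: "rsub n N P H"
  shows "rsub n M P (G O H)"
proof (rule rsubI)
  fix x z x' z' assume "(x, z) \<in> G O H" "(x', z') \<in> G O H"
  then obtain y y' where "(x, y) \<in> G" "(y, z) \<in> H" "(x', y') \<in> G" "(y', z') \<in> H" by blast
  then show "(x \<oplus>\<^bsub>M\<^esub> x', z \<oplus>\<^bsub>P\<^esub> z') \<in> G O H"
    using rsubD(4)[OF G] rsubD(4)[OF H] by blast
next
  show "(\<zero>\<^bsub>M\<^esub>, \<zero>\<^bsub>P\<^esub>) \<in> G O H"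
    using rsubD(3)[OF G] rsubD(3)[OF H] by (rule relcompI)
next
  fix x z assume "(x, z) \<in> G O H"
  then obtain y where y: "(x, y) \<in> G" "(y, z) \<in> H" by blast
  show "x \<in> carrier M \<and> z \<in> carrier P"
    using rsubD(1)[OF G y(1)] rsubD(2)[OF H y(2)] ..
  show "(hc M d x, hc P d z) \<in> G O H" for d
    using rsubD(6)[OF G y(1)] rsubD(6)[OF H y(2)] by (rule relcompI)
  show "(p \<odot>\<^bsub>M\<^esub> x, p \<odot>\<^bsub>P\<^esub> z) \<in> G O H" if "p \<in> carrier (free_algebra n)" for p
    using rsubD(5)[OF G that y(1)] rsubD(5)[OF H that y(2)] by (rule relcompI)
qed

lemma gsub_Domain:
  assumes "rsub n M N G"
  shows "gsub n M (Domain G)"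
  unfolding gsub_def
proof (intro conjI ballI allI subsetI)
  show "\<zero>\<^bsub>M\<^esub> \<in> Domain G" using rsubD(3)[OF assms] by (rule DomainI)
  fix x assume "x \<in> Domain G"
  then obtain y where y: "(x, y) \<in> G" by (rule DomainE)
  show "x \<in> carrier M" using rsubD(1)[OF assms y] .
  show "hc M d x \<in> Domain G" for d using rsubD(6)[OF assms y] by (rule DomainI)
  show "p \<odot>\<^bsub>M\<^esub> x \<in> Domain G" if "p \<in> carrier (free_algebra n)" for p
    using rsubD(5)[OF assms that y] by (rule DomainI)
  fix x' assume "x' \<in> Domain G"
  then obtain y' where y': "(x', y') \<in> G" by (rule DomainE)
  show "x \<oplus>\<^bsub>M\<^esub> x' \<in> Domain G" using rsubD(4)[OF assms y y'] by (rule DomainI)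
qed

lemma gsub_Range: "rsub n M N G \<Longrightarrow> gsub n N (Range G)"
  using gsub_Domain[OF rsub_converse] by simp

lemma rsub_restrict:
  assumes G: "rsub n M N G" and N: "gmod n N" and K: "gsub n N K" "Range G \<subseteq> K"
  shows "rsub n M (restrict_mod N K) G"
proof -
  have K': "y \<in> K" if "(x, y) \<in> G" for x y
    using K(2) that by blast
  have "(hc M d x, hc (restrict_mod N K) d y) \<in> G" if "(x, y) \<in> G" for d x y
    using rsubD(6)[OF G that] gmod.hc_restrict[OF N K(1) K'[OF that]] by simp
  then show ?thesis
    by (intro rsubI) (simp_all add: rsubD[OF G] K')
qed

text \<open>
  The graphs of the triples that represent morphisms: the cokernel of the inclusion of the domain and
  the set of values at \<open>0\<close> are torsion.
\<close>

definition corr :: "nat \<Rightarrow> (nat word \<Rightarrow>\<^sub>0 'k::field, 'u) graded \<Rightarrow> (nat word \<Rightarrow>\<^sub>0 'k, 'v) graded \<Rightarrow>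
    ('u \<times> 'v) set \<Rightarrow> bool" where
  "corr n M N G \<longleftrightarrow> rsub n M N G \<and> satur n M (Domain G) = carrier M \<and> G `` {\<zero>\<^bsub>M\<^esub>} \<subseteq> torsion n N"

lemma corrI:
  assumes "rsub n M N G" "\<And>x. x \<in> carrier M \<Longrightarrow> ev n (\<lambda>w. X w \<odot>\<^bsub>M\<^esub> x \<in> Domain G)"
    and "\<And>y. (\<zero>\<^bsub>M\<^esub>, y) \<in> G \<Longrightarrow> y \<in> torsion n N"
  shows "corr n M N G"
  using assms by (auto simp: corr_def satur_def)

lemma corrD:
  assumes "corr n M N G"
  shows "rsub n M N G" "x \<in> carrier M \<Longrightarrow> ev n (\<lambda>w. X w \<odot>\<^bsub>M\<^esub> x \<in> Domain G)"
    "(\<zero>\<^bsub>M\<^esub>, y) \<in> G \<Longrightarrow> y \<in> torsion n N"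
  using assms by (auto simp: corr_def satur_def)

text \<open>Values are compared only where both relations have one. This alone is not transitive;
  \<open>eqv_trans\<close> asks the middle relation to be defined at all long multiples of each
  element.\<close>

definition eqv :: "nat \<Rightarrow> (nat word \<Rightarrow>\<^sub>0 'k::field, 'v) graded \<Rightarrow> ('u \<times> 'v) set \<Rightarrow> ('u \<times> 'v) set \<Rightarrow> bool" where
  "eqv n N G H \<longleftrightarrow> (\<forall>x y y'. (x, y) \<in> G \<longrightarrow> (x, y') \<in> H \<longrightarrow> teq n N y y')"

lemma eqvI: "(\<And>x y y'. \<lbrakk>(x, y) \<in> G; (x, y') \<in> H\<rbrakk> \<Longrightarrow> teq n N y y') \<Longrightarrow> eqv n N G H"
  by (simp add: eqv_def)

lemma eqvD: "\<lbrakk>eqv n N G H; (x, y) \<in> G; (x, y') \<in> H\<rbrakk> \<Longrightarrow> teq n N y y'"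
  unfolding eqv_def by blast

lemma eqv_sym: "eqv n N G H \<Longrightarrow> eqv n N H G"
  unfolding eqv_def by (blast intro: teq_sym)

context gmod
begin

lemma smult_diff: "\<lbrakk>p \<in> carrier R; x \<in> carrier M; y \<in> carrier M\<rbrakk> \<Longrightarrow> p \<odot> (x \<ominus> y) = p \<odot> x \<ominus> p \<odot> y"
proof -
  assume p: "p \<in> carrier R" and xy: "x \<in> carrier M" "y \<in> carrier M"
  have "p \<odot> (\<ominus> y) \<oplus> p \<odot> y = \<zero>"
    using p xy by (simp add: M.l_neg flip: smult_r_distr)
  then have "p \<odot> (\<ominus> y) = \<ominus> (p \<odot> y)"
    using p xy M.minus_equality[of "p \<odot> (\<ominus> y)" "p \<odot> y"] by simp
  then show ?thesis
    using p xy by (simp add: a_minus_def smult_r_distr)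
qed

lemma diff_eq_zero_iff: "\<lbrakk>x \<in> carrier M; y \<in> carrier M\<rbrakk> \<Longrightarrow> x \<ominus> y = \<zero> \<longleftrightarrow> x = y"
  using M.a_assoc[of x "\<ominus> y" y] by (auto simp: a_minus_def M.l_neg M.r_neg)

lemma teq_iff:
  assumes "x \<in> carrier M" "y \<in> carrier M"
  shows "teq n M x y \<longleftrightarrow> x \<ominus> y \<in> torsion n M"
proof -
  have "ev n (\<lambda>w. X w \<odot> x = X w \<odot> y) = ev n (\<lambda>w. X w \<odot> (x \<ominus> y) \<in> {\<zero>})"
    using assms by (intro ev_cong) (simp add: smult_diff diff_eq_zero_iff)
  then show ?thesis
    using assms by (simp add: teq_def satur_def)
qed

lemma torsion_iff_teq:
  assumes "x \<in> carrier M"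
  shows "x \<in> torsion n M \<longleftrightarrow> teq n M x \<zero>"
proof -
  have "ev n (\<lambda>w. X w \<odot> x = X w \<odot> \<zero>) = ev n (\<lambda>w. X w \<odot> x \<in> {\<zero>})"
    by (intro ev_cong) simp
  then show ?thesis
    using assms by (simp add: teq_def satur_def)
qed

text \<open>Again \<open>ev_ev\<close>: the quotient by torsion has no torsion. Later proofs use it
  to multiply an element into the domain of a relation before comparing values.\<close>

lemma teq_ev:
  assumes "x \<in> carrier M" "y \<in> carrier M" "ev n (\<lambda>v. teq n M (X v \<odot> x) (X v \<odot> y))"
  shows "teq n M x y"
  unfolding teq_def
proof (rule ev_ev, rule ev_mono[OF assms(3)])
  fix v assume v: "v \<in> words n" and "teq n M (X v \<odot> x) (X v \<odot> y)"
  then show "ev n (\<lambda>u. X (u + v) \<odot> x = X (u + v) \<odot> y)"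
    using assms(1,2) unfolding teq_def by (elim ev_mono) (simp add: X_X[OF _ v])
qed

lemma teq_X:
  assumes "teq n M x y" "x \<in> carrier M" "y \<in> carrier M" "v \<in> words n"
  shows "teq n M (X v \<odot> x) (X v \<odot> y)"
  using ev_append_right[OF assms(1)[unfolded teq_def] assms(4)] assms(2-4)
  unfolding teq_def by (elim ev_mono) (simp add: X_X)

lemma rsub_diff:
  assumes "gmod n N" "rsub n M N G" "(x, y) \<in> G" "(x, y') \<in> G"
  shows "(\<zero>, y \<ominus>\<^bsub>N\<^esub> y') \<in> G"
proof -
  interpret N: gmod n N by (rule assms(1))
  have c: "x \<in> carrier M" "y \<in> carrier N" "y' \<in> carrier N"
    using rsubD(1,2)[OF assms(2)] assms(3,4) by blast+
  have "(x \<oplus> const (-1) \<odot> x, y \<oplus>\<^bsub>N\<^esub> const (-1) \<odot>\<^bsub>N\<^esub> y') \<in> G"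
    using rsubD(4,5)[OF assms(2)] assms(3,4) single_in_free_algebra[of 0 n "-1"] by simp
  then show ?thesis
    unfolding smult_minus[OF c(1)] N.smult_minus[OF c(3)] M.r_neg[OF c(1)] by (simp add: a_minus_def)
qed

end

text \<open>Two values at one point differ by a value at zero, and those are torsion: a relation
  satisfying \<open>corr\<close> is single-valued up to torsion.\<close>

lemma corr_fibre_teq:
  assumes M: "gmod n M" and N: "gmod n N" and G: "corr n M N G" and "(x, y) \<in> G" "(x, y') \<in> G"
  shows "teq n N y y'"
proof -
  note Gr = corrD(1)[OF G]
  have "y \<ominus>\<^bsub>N\<^esub> y' \<in> torsion n N"
    using gmod.rsub_diff[OF M N Gr assms(4,5)] by (rule corrD(3)[OF G])
  then show ?thesis
    using gmod.teq_iff[OF N rsubD(2)[OF Gr assms(4)] rsubD(2)[OF Gr assms(5)]] by simp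
qed

lemma eqv_refl: "\<lbrakk>gmod n M; gmod n N; corr n M N G\<rbrakk> \<Longrightarrow> eqv n N G G"
  by (rule eqvI) (rule corr_fibre_teq)

text \<open>\<open>G\<close> and \<open>K\<close> may share a point at which \<open>H\<close> has no
  value. Long multiples of it lie in the domain of \<open>H\<close>, and \<open>teq_ev\<close>
  removes the multiplier.\<close>

lemma eqv_trans:
  assumes M: "gmod n M" and N: "gmod n N" and G: "rsub n M N G" and H: "corr n M N H" and K: "rsub n M N K"
    and GH: "eqv n N G H" and HK: "eqv n N H K"
  shows "eqv n N G K"
proof (rule eqvI)
  fix x y z assume y: "(x, y) \<in> G" and z: "(x, z) \<in> K"
  have "x \<in> carrier M" and yz: "y \<in> carrier N" "z \<in> carrier N"
    using rsubD(1,2)[OF G y] rsubD(2)[OF K z] .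
  from corrD(2)[OF H this(1)] have "ev n (\<lambda>w. teq n N (X w \<odot>\<^bsub>N\<^esub> y) (X w \<odot>\<^bsub>N\<^esub> z))"
  proof (rule ev_mono)
    fix w assume w: "w \<in> words n" "X w \<odot>\<^bsub>M\<^esub> x \<in> Domain H"
    then obtain y' where y': "(X w \<odot>\<^bsub>M\<^esub> x, y') \<in> H" by blast
    show "teq n N (X w \<odot>\<^bsub>N\<^esub> y) (X w \<odot>\<^bsub>N\<^esub> z)"
      using eqvD[OF GH rsub_X[OF G w(1) y] y'] eqvD[OF HK y' rsub_X[OF K w(1) z]] by (rule teq_trans)
  qed
  then show "teq n N y z"
    by (rule gmod.teq_ev[OF N yz])
qed

text \<open>One long word brings \<open>x\<close> into the domain of \<open>G\<close>, a second
  brings the value into the domain of \<open>H\<close>, and \<open>ev_ev\<close> merges the two. A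
  value at zero comes from a torsion element \<open>y\<close>, so its long multiples are values of
  \<open>H\<close> at zero, hence torsion.\<close>

lemma corr_comp:
  assumes M: "gmod n M" and N: "gmod n N" and P: "gmod n P" and G: "corr n M N G" and H: "corr n N P H"
  shows "corr n M P (G O H)"
proof (rule corrI)
  note Gr = corrD(1)[OF G] and Hr = corrD(1)[OF H]
  show GH: "rsub n M P (G O H)"
    using Gr Hr by (rule rsub_comp)
  fix x assume x: "x \<in> carrier M"
  show "ev n (\<lambda>w. X w \<odot>\<^bsub>M\<^esub> x \<in> Domain (G O H))"
  proof (rule ev_ev, rule ev_mono[OF corrD(2)[OF G x]])
    fix v assume v: "v \<in> words n" "X v \<odot>\<^bsub>M\<^esub> x \<in> Domain G"
    then obtain y where y: "(X v \<odot>\<^bsub>M\<^esub> x, y) \<in> G" by blast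
    show "ev n (\<lambda>u. X (u + v) \<odot>\<^bsub>M\<^esub> x \<in> Domain (G O H))"
    proof (rule ev_mono[OF corrD(2)[OF H rsubD(2)[OF Gr y]]])
      fix u assume u: "u \<in> words n" "X u \<odot>\<^bsub>N\<^esub> y \<in> Domain H"
      then show "X (u + v) \<odot>\<^bsub>M\<^esub> x \<in> Domain (G O H)"
        using rsub_X[OF Gr u(1) y] gmod.X_X[OF M u(1) v(1) x] by auto
    qed
  qed
next
  note Gr = corrD(1)[OF G] and Hr = corrD(1)[OF H]
  fix z assume "(\<zero>\<^bsub>M\<^esub>, z) \<in> G O H"
  then obtain y where y: "(\<zero>\<^bsub>M\<^esub>, y) \<in> G" "(y, z) \<in> H" by blast
  have "z \<in> satur n P (torsion n P)"
  proof (rule saturI)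
    show "z \<in> carrier P" using rsubD(2)[OF Hr y(2)] .
    show "ev n (\<lambda>w. X w \<odot>\<^bsub>P\<^esub> z \<in> torsion n P)"
    proof (rule ev_mono[OF saturD(2)[OF corrD(3)[OF G y(1)]]])
      fix w assume w: "w \<in> words n" "X w \<odot>\<^bsub>N\<^esub> y \<in> {\<zero>\<^bsub>N\<^esub>}"
      then show "X w \<odot>\<^bsub>P\<^esub> z \<in> torsion n P"
        using corrD(3)[OF H] rsub_X[OF Hr w(1) y(2)] by simp
    qed
  qed
  then show "z \<in> torsion n P"
    using gmod.satur_satur[OF P gmod.gsub_zero[OF P]] by simp
qed

text \<open>The intermediate values coincide after multiplication by a long word, and
  \<open>H\<close> and \<open>H'\<close> can be compared at that common point.\<close>

lemma eqv_comp:
  assumes N: "gmod n N" and P: "gmod n P"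
    and "rsub n M N G" "rsub n M N G'" "rsub n N P H" "rsub n N P H'"
    and GG: "eqv n N G G'" and HH: "eqv n P H H'"
  shows "eqv n P (G O H) (G' O H')"
proof (rule eqvI)
  fix x z z' assume "(x, z) \<in> G O H" "(x, z') \<in> G' O H'"
  then obtain y y' where y: "(x, y) \<in> G" "(y, z) \<in> H" "(x, y') \<in> G'" "(y', z') \<in> H'" by blast
  have "ev n (\<lambda>w. teq n P (X w \<odot>\<^bsub>P\<^esub> z) (X w \<odot>\<^bsub>P\<^esub> z'))"
  proof (rule ev_mono[OF eqvD[OF GG y(1,3), unfolded teq_def]])
    fix w assume w: "w \<in> words n" "X w \<odot>\<^bsub>N\<^esub> y = X w \<odot>\<^bsub>N\<^esub> y'"
    show "teq n P (X w \<odot>\<^bsub>P\<^esub> z) (X w \<odot>\<^bsub>P\<^esub> z')"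
      using eqvD[OF HH rsub_X[OF assms(5) w(1) y(2)]] rsub_X[OF assms(6) w(1) y(4)] w(2) by simp
  qed
  then show "teq n P z z'"
    by (rule gmod.teq_ev[OF P rsubD(2)[OF assms(5) y(2)] rsubD(2)[OF assms(6) y(4)]])
qed

section \<open>Triples and their graphs\<close>

fun graph :: "'u q_triple \<Rightarrow> ('u \<times> 'u) set" where
  "graph (M', N', f) = {(x, y). x \<in> M' \<and> y \<in> f x}"

lemma gr_hom_zero:
  assumes "gmod n M" "gmod n N" "f \<in> gr_hom (free_algebra n) M N"
  shows "f \<zero>\<^bsub>M\<^esub> = \<zero>\<^bsub>N\<^esub>"
proof -
  interpret M: gmod n M by fact
  interpret N: gmod n N by fact
  have "f (0 \<odot>\<^bsub>M\<^esub> \<zero>\<^bsub>M\<^esub>) = 0 \<odot>\<^bsub>N\<^esub> f \<zero>\<^bsub>M\<^esub>" "f \<zero>\<^bsub>M\<^esub> \<in> carrier N"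
    using assms(3) M.M.zero_closed M.zero_in_carrier unfolding gr_hom_def by blast+
  then show ?thesis by simp
qed

lemma gr_hom_hc:
  assumes "gmod n M" "gmod n N" "f \<in> gr_hom (free_algebra n) M N" "x \<in> carrier M"
  shows "f (hc M d x) = hc N d (f x)"
proof -
  interpret M: gmod n M by fact
  interpret N: gmod n N by fact
  have f: "\<And>x. x \<in> carrier M \<Longrightarrow> f x \<in> carrier N"
    "\<And>x y. \<lbrakk>x \<in> carrier M; y \<in> carrier M\<rbrakk> \<Longrightarrow> f (x \<oplus>\<^bsub>M\<^esub> y) = f x \<oplus>\<^bsub>N\<^esub> f y"
    "\<And>x d. x \<in> part M d \<Longrightarrow> f x \<in> part N d"
    using assms(3) unfolding gr_hom_def by blast+
  have "x \<in> {x \<in> carrier M. f (hc M d x) = hc N d (f x)}"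
  proof (rule M.hc_induct[OF assms(4)])
    fix e
    have "f (hc M d (hc M e x)) = (if d = e then f (hc M e x) else \<zero>\<^bsub>N\<^esub>)"
      using assms(4) gr_hom_zero[OF assms(1-3)] by (simp add: M.hc_hc)
    also have "\<dots> = hc N d (f (hc M e x))"
      using N.hc_part[OF f(3)[OF M.hc_in_part[OF assms(4)]]] by simp
    finally show "hc M e x \<in> {x \<in> carrier M. f (hc M d x) = hc N d (f x)}"
      using assms(4) by simp
  qed (use gr_hom_zero[OF assms(1-3)] in \<open>auto simp: M.hc_add N.hc_add f\<close>)
  then show ?thesis by simp
qed

locale gmod_pair = M: gmod n M + N: gmod n N
  for n :: nat and M N :: "(nat word \<Rightarrow>\<^sub>0 'k::field, 'u) graded"
begin

lemma triple_fibre: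
  assumes t: "(M', N', f) \<in> q_triples (free_algebra n) M N"
  shows "x \<in> M' \<Longrightarrow> f x \<noteq> {}"
    and "\<lbrakk>x \<in> M'; y \<in> f x\<rbrakk> \<Longrightarrow> y \<in> carrier N \<and> f x = N' +>\<^bsub>N\<^esub> y"
proof -
  have N': "gsub n N N'"
    using t by (simp add: q_triples_def N.q_tor_iff)
  have f: "f x \<in> (\<lambda>y. N' +>\<^bsub>N\<^esub> y) ` carrier N" if "x \<in> M'" for x
    using t that unfolding q_triples_def gr_hom_def N.carrier_quot[OF N', symmetric] by auto
  show "f x \<noteq> {}" if "x \<in> M'"
    using f[OF that] N.coset_self[OF N'] by blast
  assume x: "x \<in> M'" "y \<in> f x"
  obtain z where z: "z \<in> carrier N" "f x = N' +>\<^bsub>N\<^esub> z" using f[OF x(1)] by blast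
  then have y: "y \<in> carrier N" "y \<ominus>\<^bsub>N\<^esub> z \<in> N'"
    using x(2) N.coset_mem_iff[OF N' z(1)] by auto
  then show "y \<in> carrier N \<and> f x = N' +>\<^bsub>N\<^esub> y"
    using N.coset_eq_iff[OF N' y(1) z(1)] z(2) by simp
qed

lemma triple_zero:
  assumes t: "(M', N', f) \<in> q_triples (free_algebra n) M N"
  shows "f \<zero>\<^bsub>M\<^esub> = N'"
proof -
  have M': "gsub n M M'" and N': "gsub n N N'" and f: "f \<in> gr_hom (free_algebra n) (restrict_mod M M') (quot_mod N N')"
    using t by (simp_all add: q_triples_def N.q_tor_iff M.q_dom_iff)
  show ?thesis
    using gr_hom_zero[OF M.gmod_restrict[OF M'] N.gmod_quot[OF N'] f]
    by (simp add: quot_mod_def)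
qed

lemma corr_graph:
  assumes t: "t \<in> q_triples (free_algebra n) M N"
  shows "corr n M N (graph t)"
proof -
  obtain M' N' f where tt: "t = (M', N', f)" by (cases t) auto
  note t = t[unfolded tt]
  have M': "gsub n M M'" "satur n M M' = carrier M" and N': "gsub n N N'" "N' \<subseteq> torsion n N"
    and f: "f \<in> gr_hom (free_algebra n) (restrict_mod M M') (quot_mod N N')"
    using t by (simp_all add: q_triples_def N.q_tor_iff M.q_dom_iff)
  note fib = triple_fibre[OF t]
  have fx: "x \<in> M'" "x \<in> carrier M" "y \<in> carrier N" "f x = N' +>\<^bsub>N\<^esub> y" if "(x, y) \<in> graph t" for x y
    using that fib(2)[of x y] gsubD(6)[OF M'(1), of x] by (auto simp: tt)
  have memI: "(x, y) \<in> graph t" if "x \<in> M'" "y \<in> carrier N" "f x = N' +>\<^bsub>N\<^esub> y" for x y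
    using that N.coset_self[OF N'(1) that(2)] by (simp add: tt)
  have dom: "Domain (graph t) = M'"
    using fib(1) by (auto simp: tt)
  show ?thesis
    unfolding corr_def rsub_def
  proof (intro conjI allI impI ballI)
    show "graph t \<subseteq> carrier M \<times> carrier N"
      using fx by auto
    show "(\<zero>\<^bsub>M\<^esub>, \<zero>\<^bsub>N\<^esub>) \<in> graph t"
      using triple_zero[OF t] gsubD(2)[OF M'(1)] gsubD(2)[OF N'(1)] by (simp add: tt)
  next
    fix x y x' y' assume xy: "(x, y) \<in> graph t" "(x', y') \<in> graph t"
    have "f (x \<oplus>\<^bsub>M\<^esub> x') = f x \<oplus>\<^bsub>quot_mod N N'\<^esub> f x'"
      using f fx(1)[OF xy(1)] fx(1)[OF xy(2)] by (simp add: gr_hom_def)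
    then show "(x \<oplus>\<^bsub>M\<^esub> x', y \<oplus>\<^bsub>N\<^esub> y') \<in> graph t"
      using fx[OF xy(1)] fx[OF xy(2)] gsubD(3)[OF M'(1)] by (intro memI) (simp_all add: N.add_quot[OF N'(1)])
  next
    fix p x y assume p: "p \<in> carrier M.R" and xy: "(x, y) \<in> graph t"
    have "f (p \<odot>\<^bsub>M\<^esub> x) = p \<odot>\<^bsub>quot_mod N N'\<^esub> f x"
      using f fx(1)[OF xy] p by (simp add: gr_hom_def)
    then show "(p \<odot>\<^bsub>M\<^esub> x, p \<odot>\<^bsub>N\<^esub> y) \<in> graph t"
      using fx[OF xy] gsubD(4)[OF M'(1) p] p by (intro memI) (simp_all add: N.smult_quot[OF N'(1)])
  next
    fix d x y assume xy: "(x, y) \<in> graph t"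
    have "f (hc M d x) = hc (quot_mod N N') d (f x)"
      using gr_hom_hc[OF M.gmod_restrict[OF M'(1)] N.gmod_quot[OF N'(1)] f, of x d] fx(1)[OF xy]
      by (simp add: M.hc_restrict[OF M'(1)])
    then show "(hc M d x, hc N d y) \<in> graph t"
      using fx[OF xy] gsubD(5)[OF M'(1)] by (intro memI) (simp_all add: N.hc_quot[OF N'(1)])
  next
    show "satur n M (Domain (graph t)) = carrier M"
      unfolding dom by (rule M'(2))
    show "graph t `` {\<zero>\<^bsub>M\<^esub>} \<subseteq> torsion n N"
      using triple_zero[OF t] N'(2) by (auto simp: tt)
  qed
qed

text \<open>The fibres of \<open>G\<close> are cosets of its fibre at zero, so \<open>G\<close> is a
  homomorphism into a quotient. Only the values of \<open>f\<close> on the domain are prescribed,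
  which lets the lemma apply to the explicit functions in \<open>triple_comp\<close> and in the
  identity.\<close>

lemma triple_of_corr:
  assumes G: "corr n M N G" and f: "\<And>x. x \<in> Domain G \<Longrightarrow> f x = G `` {x}"
  shows "(Domain G, G `` {\<zero>\<^bsub>M\<^esub>}, f) \<in> q_triples (free_algebra n) M N"
    and "graph (Domain G, G `` {\<zero>\<^bsub>M\<^esub>}, f) = G"
proof -
  note Gr = corrD(1)[OF G]
  let ?D = "Domain G" and ?K = "G `` {\<zero>\<^bsub>M\<^esub>}"
  have D: "gsub n M ?D" using Gr by (rule gsub_Domain)
  have K: "gsub n N ?K"
    unfolding gsub_def
  proof (intro conjI ballI allI)
    show "?K \<subseteq> carrier N" using rsubD(2)[OF Gr] by blast
    show "\<zero>\<^bsub>N\<^esub> \<in> ?K" using rsubD(3)[OF Gr] by blast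
    show "x \<oplus>\<^bsub>N\<^esub> y \<in> ?K" if "x \<in> ?K" "y \<in> ?K" for x y
      using rsubD(4)[OF Gr, of "\<zero>\<^bsub>M\<^esub>" x "\<zero>\<^bsub>M\<^esub>" y] that by simp
    show "p \<odot>\<^bsub>N\<^esub> x \<in> ?K" if "p \<in> carrier (free_algebra n)" "x \<in> ?K" for p x
      using rsubD(5)[OF Gr that(1), of "\<zero>\<^bsub>M\<^esub>" x] that by simp
    show "hc N d x \<in> ?K" if "x \<in> ?K" for d x
      using rsubD(6)[OF Gr, of "\<zero>\<^bsub>M\<^esub>" x d] that by simp
  qed
  \<comment> \<open>Adding a value at zero stays in the fibre over \<open>x\<close>, and two values
    at \<open>x\<close> differ by a value at zero (\<open>rsub_diff\<close>).\<close>
  have fibre: "f x = ?K +>\<^bsub>N\<^esub> y" if xy: "(x, y) \<in> G" for x y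
  proof -
    have c: "x \<in> carrier M" "y \<in> carrier N" using rsubD(1,2)[OF Gr] xy by blast+
    have "z \<in> ?K +>\<^bsub>N\<^esub> y \<longleftrightarrow> (x, z) \<in> G" for z
    proof
      assume "z \<in> ?K +>\<^bsub>N\<^esub> y"
      then obtain h where "(\<zero>\<^bsub>M\<^esub>, h) \<in> G" "z = h \<oplus>\<^bsub>N\<^esub> y" using N.coset_mem by blast
      then show "(x, z) \<in> G" using rsubD(4)[OF Gr, of "\<zero>\<^bsub>M\<^esub>" h x y] xy c by simp
    next
      assume "(x, z) \<in> G"
      then show "z \<in> ?K +>\<^bsub>N\<^esub> y"
        using M.rsub_diff[OF N.gmod_axioms Gr _ xy] rsubD(2)[OF Gr] N.coset_mem_iff[OF K c(2)] by blast
    qed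
    then show ?thesis using f[of x] xy by blast
  qed
  have "f \<in> gr_hom (free_algebra n) (restrict_mod M ?D) (quot_mod N ?K)"
    unfolding gr_hom_def
  proof (intro CollectI conjI ballI allI)
    show "f \<in> carrier (restrict_mod M ?D) \<rightarrow> carrier (quot_mod N ?K)"
      using fibre rsubD(2)[OF Gr] by (auto simp: N.carrier_quot[OF K])
  next
    fix x y assume "x \<in> carrier (restrict_mod M ?D)" "y \<in> carrier (restrict_mod M ?D)"
    then obtain x' y' where xy: "(x, x') \<in> G" "(y, y') \<in> G" by auto
    show "f (x \<oplus>\<^bsub>restrict_mod M ?D\<^esub> y) = f x \<oplus>\<^bsub>quot_mod N ?K\<^esub> f y"
      using fibre[OF xy(1)] fibre[OF xy(2)] fibre[OF rsubD(4)[OF Gr xy]] rsubD(2)[OF Gr xy(1)] rsubD(2)[OF Gr xy(2)]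
      by (simp add: N.add_quot[OF K])
  next
    fix p x assume p: "p \<in> carrier M.R" and "x \<in> carrier (restrict_mod M ?D)"
    then obtain x' where xy: "(x, x') \<in> G" by auto
    show "f (p \<odot>\<^bsub>restrict_mod M ?D\<^esub> x) = p \<odot>\<^bsub>quot_mod N ?K\<^esub> f x"
      using fibre[OF xy] fibre[OF rsubD(5)[OF Gr p xy]] rsubD(2)[OF Gr xy] p
      by (simp add: N.smult_quot[OF K])
  next
    fix d
    show "f ` part (restrict_mod M ?D) d \<subseteq> part (quot_mod N ?K) d"
    proof
      fix z assume "z \<in> f ` part (restrict_mod M ?D) d"
      then obtain x y where x: "z = f x" "x \<in> part M d" "(x, y) \<in> G" by auto
      have "(x, hc N d y) \<in> G"
        using rsubD(6)[OF Gr x(3), of d] M.hc_part[OF x(2), of d] by simp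
      then show "z \<in> part (quot_mod N ?K) d"
        using fibre[of x "hc N d y"] N.hc_in_part[OF rsubD(2)[OF Gr x(3)]] by (simp add: x(1) N.part_quot[OF K])
    qed
  qed
  then show "(?D, ?K, f) \<in> q_triples (free_algebra n) M N"
    using G D K by (simp add: q_triples_def M.q_dom_iff N.q_tor_iff corr_def)
  show "graph (?D, ?K, f) = G"
    using f by auto
qed

lemma set_add_coset:
  assumes "gsub n N K" "gsub n N L" "K \<subseteq> L" "y \<in> carrier N"
  shows "L <+>\<^bsub>N\<^esub> (K +>\<^bsub>N\<^esub> y) = L +>\<^bsub>N\<^esub> y"
proof
  show "L <+>\<^bsub>N\<^esub> (K +>\<^bsub>N\<^esub> y) \<subseteq> L +>\<^bsub>N\<^esub> y"
  proof
    fix z assume "z \<in> L <+>\<^bsub>N\<^esub> (K +>\<^bsub>N\<^esub> y)"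
    then obtain l k where lk: "l \<in> L" "k \<in> K" "z = l \<oplus>\<^bsub>N\<^esub> (k \<oplus>\<^bsub>N\<^esub> y)"
      by (auto simp: set_add_def' N.coset_mem)
    then have "l \<oplus>\<^bsub>N\<^esub> k \<in> L" "z = (l \<oplus>\<^bsub>N\<^esub> k) \<oplus>\<^bsub>N\<^esub> y"
      using assms gsubD(3,6)[OF assms(2)] by (auto simp: N.M.a_assoc subset_iff)
    then show "z \<in> L +>\<^bsub>N\<^esub> y" unfolding N.coset_mem by blast
  qed
  show "L +>\<^bsub>N\<^esub> y \<subseteq> L <+>\<^bsub>N\<^esub> (K +>\<^bsub>N\<^esub> y)"
  proof
    fix z assume "z \<in> L +>\<^bsub>N\<^esub> y"
    then obtain l where "l \<in> L" "z = l \<oplus>\<^bsub>N\<^esub> y"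
      unfolding N.coset_mem by (elim bexE)
    then show "z \<in> L <+>\<^bsub>N\<^esub> (K +>\<^bsub>N\<^esub> y)"
      unfolding set_add_def' by (intro UN_I[of l] UN_I[OF N.coset_self[OF assms(1,4)]]) simp_all
  qed
qed

text \<open>Equality at a later term forces congruence: points enter \<open>M3\<close> after
  multiplication by long words, and \<open>N3\<close> is torsion. Conversely, the intersection of
  the two domains and the whole torsion submodule serve as \<open>M3\<close> and
  \<open>N3\<close>.\<close>

lemma q_rel_iff:
  assumes t: "t \<in> q_triples (free_algebra n) M N" and t': "t' \<in> q_triples (free_algebra n) M N"
  shows "(t, t') \<in> q_rel (free_algebra n) M N \<longleftrightarrow> eqv n N (graph t) (graph t')"
proof -
  obtain M1 N1 f1 where t1: "t = (M1, N1, f1)" by (cases t) auto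
  obtain M2 N2 f2 where t2: "t' = (M2, N2, f2)" by (cases t') auto
  note q1 = t[unfolded t1] and q2 = t'[unfolded t2]
  have sub: "gsub n M M1" "gsub n M M2" "gsub n N N1" "gsub n N N2" "N1 \<subseteq> torsion n N" "N2 \<subseteq> torsion n N"
    "satur n M M1 = carrier M" "satur n M M2 = carrier M"
    using q1 q2 by (simp_all add: q_triples_def N.q_tor_iff M.q_dom_iff)
  show ?thesis
  proof
    assume "(t, t') \<in> q_rel (free_algebra n) M N"
    then obtain M3 N3 where M3: "M3 \<in> q_dom (free_algebra n) M" and N3: "N3 \<in> q_tor (free_algebra n) N"
      and "M3 \<subseteq> M1 \<inter> M2" and N12: "N1 \<subseteq> N3" "N2 \<subseteq> N3"
      and eq: "\<And>x. x \<in> M3 \<Longrightarrow> N3 <+>\<^bsub>N\<^esub> f1 x = N3 <+>\<^bsub>N\<^esub> f2 x"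
      unfolding q_rel_def t1 t2 by auto
    have M3': "gsub n M M3" "satur n M M3 = carrier M" and N3': "gsub n N N3" "N3 \<subseteq> torsion n N"
      using M3 N3 by (simp_all add: N.q_tor_iff M.q_dom_iff)
    show "eqv n N (graph t) (graph t')"
    proof (rule eqvI)
      fix x y y' assume y: "(x, y) \<in> graph t" and y': "(x, y') \<in> graph t'"
      note G = corrD(1)[OF corr_graph[OF t]] and G' = corrD(1)[OF corr_graph[OF t']]
      have c: "x \<in> carrier M" "y \<in> carrier N" "y' \<in> carrier N"
        using rsubD(1,2)[OF G y] rsubD(2)[OF G' y'] by blast+
      then have "x \<in> satur n M M3" using M3'(2) by simp
      from saturD(2)[OF this] have "ev n (\<lambda>w. teq n N (X w \<odot>\<^bsub>N\<^esub> y) (X w \<odot>\<^bsub>N\<^esub> y'))"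
      proof (rule ev_mono)
        fix w assume w: "w \<in> words n" "X w \<odot>\<^bsub>M\<^esub> x \<in> M3"
        let ?y = "X w \<odot>\<^bsub>N\<^esub> y" and ?y' = "X w \<odot>\<^bsub>N\<^esub> y'"
        have cy: "?y \<in> carrier N" "?y' \<in> carrier N" using c w by simp_all
        have "f1 (X w \<odot>\<^bsub>M\<^esub> x) = N1 +>\<^bsub>N\<^esub> ?y" "f2 (X w \<odot>\<^bsub>M\<^esub> x) = N2 +>\<^bsub>N\<^esub> ?y'"
          using triple_fibre(2)[OF q1, of _ ?y] triple_fibre(2)[OF q2, of _ ?y'] rsub_X[OF G w(1) y] rsub_X[OF G' w(1) y']
          by (simp_all add: t1 t2)
        then have "N3 +>\<^bsub>N\<^esub> ?y = N3 +>\<^bsub>N\<^esub> ?y'"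
          using eq[OF w(2)] set_add_coset[OF sub(3) N3'(1) N12(1) cy(1)] set_add_coset[OF sub(4) N3'(1) N12(2) cy(2)]
          by simp
        then have "?y \<ominus>\<^bsub>N\<^esub> ?y' \<in> torsion n N"
          using N.coset_eq_iff[OF N3'(1) cy] N3'(2) by blast
        then show "teq n N ?y ?y'"
          using N.teq_iff[OF cy] by simp
      qed
      then show "teq n N y y'" by (rule N.teq_ev[OF c(2,3)])
    qed
  next
    assume eqv: "eqv n N (graph t) (graph t')"
    have "torsion n N <+>\<^bsub>N\<^esub> f1 x = torsion n N <+>\<^bsub>N\<^esub> f2 x" if x: "x \<in> M1 \<inter> M2" for x
    proof -
      obtain y y' where y: "y \<in> f1 x" "y' \<in> f2 x"
        using triple_fibre(1)[OF q1, of x] triple_fibre(1)[OF q2, of x] x by blast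
      have f: "y \<in> carrier N" "f1 x = N1 +>\<^bsub>N\<^esub> y" "y' \<in> carrier N" "f2 x = N2 +>\<^bsub>N\<^esub> y'"
        using triple_fibre(2)[OF q1 _ y(1)] triple_fibre(2)[OF q2 _ y(2)] x by blast+
      have "teq n N y y'"
        using eqvD[OF eqv, of x y y'] x y by (simp add: t1 t2)
      then have "torsion n N +>\<^bsub>N\<^esub> y = torsion n N +>\<^bsub>N\<^esub> y'"
        using N.coset_eq_iff[OF N.gsub_torsion f(1,3)] N.teq_iff[OF f(1,3)] by simp
      then show ?thesis
        using set_add_coset[OF sub(3) N.gsub_torsion sub(5) f(1)] set_add_coset[OF sub(4) N.gsub_torsion sub(6) f(3)] f
        by simp
    qed
    moreover have "M1 \<inter> M2 \<in> q_dom (free_algebra n) M"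
      using sub by (simp add: M.q_dom_iff M.gsub_Int M.satur_Int)
    moreover have "torsion n N \<in> q_tor (free_algebra n) N"
      by (simp add: N.q_tor_iff N.gsub_torsion)
    ultimately show "(t, t') \<in> q_rel (free_algebra n) M N"
      using q1 q2 sub(5,6) unfolding q_rel_def t1 t2
      by (intro CollectI case_prodI conjI bexI[of _ "M1 \<inter> M2"] bexI[of _ "torsion n N"]) auto
  qed
qed

end


text \<open>The morphism presented by a relation, defined through all triples with an equivalent
  graph so that no representing triple has to be chosen.\<close>

definition arr :: "nat \<Rightarrow> (nat word \<Rightarrow>\<^sub>0 'k::field, 'u) graded \<Rightarrow> (nat word \<Rightarrow>\<^sub>0 'k, 'u) graded \<Rightarrow>
    ('u \<times> 'u) set \<Rightarrow> 'u q_triple set" where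
  "arr n M N G = {t \<in> q_triples (free_algebra n) M N. eqv n N G (graph t)}"

context gmod_pair
begin

lemma q_rel_Image:
  assumes "t \<in> q_triples (free_algebra n) M N"
  shows "q_rel (free_algebra n) M N `` {t} = arr n M N (graph t)"
proof -
  have "(t, t') \<in> q_rel (free_algebra n) M N \<Longrightarrow> t' \<in> q_triples (free_algebra n) M N" for t'
    unfolding q_rel_def by auto
  then have "t' \<in> q_rel (free_algebra n) M N `` {t} \<longleftrightarrow> t' \<in> arr n M N (graph t)" for t'
    unfolding arr_def Image_singleton_iff using q_rel_iff[OF assms, of t'] by blast
  then show ?thesis by (intro Set.set_eqI)
qed

lemma ex_triple:
  assumes "corr n M N G"
  obtains t where "t \<in> q_triples (free_algebra n) M N" "graph t = G"
  using triple_of_corr[OF assms, of "\<lambda>x. G `` {x}"] by blast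

lemma q_homE:
  assumes "F \<in> q_hom (free_algebra n) M N"
  obtains G where "corr n M N G" "F = arr n M N G"
proof -
  obtain t where "t \<in> q_triples (free_algebra n) M N" "F = q_rel (free_algebra n) M N `` {t}"
    using assms unfolding q_hom_def by (rule quotientE)
  then show ?thesis
    using that[of "graph t"] corr_graph q_rel_Image by simp
qed

lemma arr_in_q_hom:
  assumes "corr n M N G"
  shows "arr n M N G \<in> q_hom (free_algebra n) M N"
proof -
  obtain t where "t \<in> q_triples (free_algebra n) M N" "graph t = G"
    using assms by (rule ex_triple)
  then show ?thesis
    unfolding q_hom_def using q_rel_Image quotientI by metis
qed

lemma arr_eq_iff:
  assumes G: "corr n M N G" and H: "corr n M N H"
  shows "arr n M N G = arr n M N H \<longleftrightarrow> eqv n N G H"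
proof
  assume eq: "arr n M N G = arr n M N H"
  obtain t where t: "t \<in> q_triples (free_algebra n) M N" "graph t = H"
    using H by (rule ex_triple)
  then have "t \<in> arr n M N H"
    using eqv_refl[OF M.gmod_axioms N.gmod_axioms H] by (simp add: arr_def)
  then show "eqv n N G H"
    unfolding eq[symmetric] using t(2) by (simp add: arr_def)
next
  assume GH: "eqv n N G H"
  have "eqv n N G (graph t) \<longleftrightarrow> eqv n N H (graph t)" if "t \<in> q_triples (free_algebra n) M N" for t
  proof -
    note T = corrD(1)[OF corr_graph[OF that]]
    show ?thesis
      using eqv_trans[OF M.gmod_axioms N.gmod_axioms corrD(1)[OF G] H T GH]
        eqv_trans[OF M.gmod_axioms N.gmod_axioms corrD(1)[OF H] G T eqv_sym[OF GH]] by blast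
  qed
  then show "arr n M N G = arr n M N H"
    unfolding arr_def by (intro Collect_cong) blast
qed

end

text \<open>The formula in \<open>triple_comp\<close> is relational composition: its first entry is
  the domain of the composite, and its second is the fibre at zero, because \<open>f\<close> sends
  zero to \<open>N'\<close>.\<close>

lemma triple_comp_graph:
  assumes M: "gmod n M" and N: "gmod n N" and P: "gmod n P"
    and g: "g \<in> q_triples (free_algebra n) M N" and h: "h \<in> q_triples (free_algebra n) N P"
  shows "triple_comp h g \<in> q_triples (free_algebra n) M P" "graph (triple_comp h g) = graph g O graph h"
proof -
  interpret MN: gmod_pair n M N using M N by (rule gmod_pair.intro)
  interpret NP: gmod_pair n N P using N P by (rule gmod_pair.intro)
  interpret MP: gmod_pair n M P using M P by (rule gmod_pair.intro)
  obtain M' N' f where f: "g = (M', N', f)" by (cases g) auto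
  obtain N'' P' e where e: "h = (N'', P', e)" by (cases h) auto
  let ?G = "graph g O graph h"
  have ne: "e y \<noteq> {}" if "y \<in> N''" for y
    using NP.triple_fibre(1)[OF h[unfolded e] that] .
  have f0: "f \<zero>\<^bsub>M\<^esub> = N'"
    using MN.triple_zero[OF g[unfolded f]] .
  have "gsub n M M'"
    using g unfolding f by (simp add: q_triples_def MN.M.q_dom_iff)
  then have z: "\<zero>\<^bsub>M\<^esub> \<in> M'" by (rule gsubD)
  have corr: "corr n M P ?G"
    using M N P MN.corr_graph[OF g] NP.corr_graph[OF h] by (rule corr_comp)
  have "Domain ?G = {x \<in> M'. f x \<inter> N'' \<noteq> {}}"
    using ne unfolding f e by fastforce
  moreover have "?G `` {\<zero>\<^bsub>M\<^esub>} = (\<Union>y\<in>N' \<inter> N''. e y)"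
    using z f0 unfolding f e by auto
  moreover have "(\<Union>y\<in>f x \<inter> N''. e y) = ?G `` {x}" if "x \<in> Domain ?G" for x
    using that unfolding f e by auto
  ultimately show "triple_comp h g \<in> q_triples (free_algebra n) M P" "graph (triple_comp h g) = ?G"
    using MP.triple_of_corr[OF corr, of "\<lambda>x. \<Union>y\<in>f x \<inter> N''. e y"] by (simp_all only: f e triple_comp.simps)
qed

text \<open>The union in \<open>q_comp\<close> runs over all pairs of representatives; by
  \<open>eqv_comp\<close> every pair contributes the same class.\<close>

lemma q_comp_arr:
  assumes M: "gmod n M" and N: "gmod n N" and P: "gmod n P"
    and G: "corr n M N G" and H: "corr n N P H"
  shows "q_comp (free_algebra n) M N P (arr n N P H) (arr n M N G) = arr n M P (G O H)"
proof -
  interpret MN: gmod_pair n M N using M N by (rule gmod_pair.intro)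
  interpret NP: gmod_pair n N P using N P by (rule gmod_pair.intro)
  interpret MP: gmod_pair n M P using M P by (rule gmod_pair.intro)
  have eq: "q_rel (free_algebra n) M P `` {triple_comp h g} = arr n M P (G O H)"
    if hg: "h \<in> arr n N P H" "g \<in> arr n M N G" for h g
  proof -
    have g: "g \<in> q_triples (free_algebra n) M N" "eqv n N G (graph g)"
      and h: "h \<in> q_triples (free_algebra n) N P" "eqv n P H (graph h)"
      using hg by (simp_all add: arr_def)
    note gc = MN.corr_graph[OF g(1)] and hc = NP.corr_graph[OF h(1)]
    have "eqv n P (G O H) (graph g O graph h)"
      by (rule eqv_comp[OF N P corrD(1)[OF G] corrD(1)[OF gc] corrD(1)[OF H] corrD(1)[OF hc] g(2) h(2)])
    then have "arr n M P (G O H) = arr n M P (graph g O graph h)"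
      using MP.arr_eq_iff[OF corr_comp[OF M N P G H] corr_comp[OF M N P gc hc]] by simp
    then show ?thesis
      using MP.q_rel_Image[OF triple_comp_graph(1)[OF M N P g(1) h(1)]]
        triple_comp_graph(2)[OF M N P g(1) h(1)] by simp
  qed
  \<comment> \<open>Representatives exist, so the union of the constant family is not empty.\<close>
  obtain g where "g \<in> q_triples (free_algebra n) M N" "graph g = G" using G by (rule MN.ex_triple)
  then have g: "g \<in> arr n M N G" using eqv_refl[OF M N G] by (simp add: arr_def)
  obtain h where "h \<in> q_triples (free_algebra n) N P" "graph h = H" using H by (rule NP.ex_triple)
  then have h: "h \<in> arr n N P H" using eqv_refl[OF N P H] by (simp add: arr_def)
  have "(\<Union>h\<in>arr n N P H. \<Union>g\<in>arr n M N G. q_rel (free_algebra n) M P `` {triple_comp h g}) =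
      (\<Union>h\<in>arr n N P H. \<Union>g\<in>arr n M N G. arr n M P (G O H))"
    by (intro SUP_cong refl eq)
  also have "\<dots> = arr n M P (G O H)"
    using g h by blast
  finally show ?thesis
    unfolding q_comp_def .
qed

section \<open>Graphs of homomorphisms, identities, epimorphisms and monomorphisms\<close>

lemma corr_fun:
  assumes M: "gmod n M" and N: "gmod n N" and f: "f \<in> gr_hom (free_algebra n) M N"
  shows "corr n M N ((\<lambda>x. (x, f x)) ` carrier M)"
proof -
  interpret M: gmod n M by (rule M)
  interpret N: gmod n N by (rule N)
  have ff: "\<And>x. x \<in> carrier M \<Longrightarrow> f x \<in> carrier N"
    "\<And>x y. \<lbrakk>x \<in> carrier M; y \<in> carrier M\<rbrakk> \<Longrightarrow> f (x \<oplus>\<^bsub>M\<^esub> y) = f x \<oplus>\<^bsub>N\<^esub> f y"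
    "\<And>p x. \<lbrakk>p \<in> carrier M.R; x \<in> carrier M\<rbrakk> \<Longrightarrow> f (p \<odot>\<^bsub>M\<^esub> x) = p \<odot>\<^bsub>N\<^esub> f x"
    using f unfolding gr_hom_def by blast+
  note z = gr_hom_zero[OF M N f] and h = gr_hom_hc[OF M N f]
  show ?thesis
  proof (rule corrI)
    show "rsub n M N ((\<lambda>x. (x, f x)) ` carrier M)"
      by (rule rsubI) (auto simp: ff z[symmetric] h[symmetric] image_iff)
  next
    fix x assume "x \<in> carrier M"
    then show "ev n (\<lambda>w. X w \<odot>\<^bsub>M\<^esub> x \<in> Domain ((\<lambda>x. (x, f x)) ` carrier M))"
      by (intro ev_all) (force simp: Domain_iff image_iff)
  next
    fix y assume "(\<zero>\<^bsub>M\<^esub>, y) \<in> (\<lambda>x. (x, f x)) ` carrier M"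
    then show "y \<in> torsion n N"
      using z N.gsub_torsion gsubD(2) by auto
  qed
qed

lemma zero_gr_hom:
  assumes "gmod n M" and "gmod n N"
  shows "(\<lambda>_. \<zero>\<^bsub>N\<^esub>) \<in> gr_hom (free_algebra n) M N"
proof -
  interpret N: gmod n N by fact
  show ?thesis
    unfolding gr_hom_def by (auto simp: N.part_zero)
qed

lemma incl_gr_hom: "gmod n M \<Longrightarrow> gsub n M K \<Longrightarrow> (\<lambda>x. x) \<in> gr_hom (free_algebra n) (restrict_mod M K) M"
  by (auto simp: gr_hom_def gsubD)

lemma Id_on_image: "Id_on K = (\<lambda>x. (x, x)) ` K"
  by auto

lemma QGr_simps [simp]:
  "M \<in> Obj (QGr (free_algebra n)) \<longleftrightarrow> gmod n M"
  "Hom (QGr R) = q_hom R" "Comp (QGr R) = q_comp R"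
  by (simp_all add: QGr_def gmod_def)

lemma QGr_Id:
  assumes M: "gmod n M"
  shows "Id (QGr (free_algebra n)) M = arr n M M (Id_on (carrier M))"
proof -
  interpret MM: gmod_pair n M M using M M by (rule gmod_pair.intro)
  have corr: "corr n M M (Id_on (carrier M))"
    unfolding Id_on_image by (rule corr_fun[OF M M]) (auto simp: gr_hom_def)
  have "(carrier M, {\<zero>\<^bsub>M\<^esub>}, \<lambda>m. {\<zero>\<^bsub>M\<^esub>} +>\<^bsub>M\<^esub> m) \<in> q_triples (free_algebra n) M M"
    "graph (carrier M, {\<zero>\<^bsub>M\<^esub>}, \<lambda>m. {\<zero>\<^bsub>M\<^esub>} +>\<^bsub>M\<^esub> m) = Id_on (carrier M)"
    using MM.triple_of_corr[OF corr, of "\<lambda>m. {\<zero>\<^bsub>M\<^esub>} +>\<^bsub>M\<^esub> m"] by (auto simp: a_r_coset_def')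
  then show ?thesis
    using MM.q_rel_Image by (simp add: QGr_def pi_arr_def)
qed

text \<open>
  The test object is \<open>N / Range E\<close>, transported to the universe by choosing coset representatives: there
  the projection and the zero map agree after \<open>E\<close>.
\<close>

lemma epimorphism_Range:
  fixes M N :: "(nat word \<Rightarrow>\<^sub>0 'k::field, 'u) graded"
  assumes e: "epimorphism (QGr (free_algebra n)) M N (arr n M N E)"
    and M: "gmod n M" and N: "gmod n N" and E: "corr n M N E"
  shows "satur n N (Range E) = carrier N"
proof -
  interpret N: gmod n N by (rule N)
  let ?H = "Range E"
  have H: "gsub n N ?H"
    using gsub_Range[OF corrD(1)[OF E]] .
  interpret Q: gmod n "quot_mod N ?H" by (rule N.gmod_quot[OF H])
  define \<sigma> :: "'u set \<Rightarrow> 'u" where "\<sigma> C = (SOME y. y \<in> C)" for C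
  have \<sigma>: "\<sigma> (?H +>\<^bsub>N\<^esub> y) \<in> ?H +>\<^bsub>N\<^esub> y" if "y \<in> carrier N" for y
    unfolding \<sigma>_def using N.coset_self[OF H that] by (rule someI)
  have inj: "inj_on \<sigma> (carrier (quot_mod N ?H))"
  proof (rule inj_onI)
    fix C D assume CD: "C \<in> carrier (quot_mod N ?H)" "D \<in> carrier (quot_mod N ?H)" "\<sigma> C = \<sigma> D"
    then obtain x y where x: "x \<in> carrier N" "C = ?H +>\<^bsub>N\<^esub> x" and y: "y \<in> carrier N" "D = ?H +>\<^bsub>N\<^esub> y"
      by (auto simp: N.carrier_quot[OF H])
    have eq: "?H +>\<^bsub>N\<^esub> z = ?H +>\<^bsub>N\<^esub> \<sigma> (?H +>\<^bsub>N\<^esub> z)" if "z \<in> carrier N" for z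
    proof -
      have s: "\<sigma> (?H +>\<^bsub>N\<^esub> z) \<in> carrier N" "\<sigma> (?H +>\<^bsub>N\<^esub> z) \<ominus>\<^bsub>N\<^esub> z \<in> ?H"
        using \<sigma>[OF that] unfolding N.coset_mem_iff[OF H that] by simp_all
      then show ?thesis
        using N.coset_eq_iff[OF H s(1) that] by simp
    qed
    show "C = D"
      using eq[OF x(1)] eq[OF y(1)] CD(3) x(2) y(2) by simp
  qed
  let ?T = "transport_mod \<sigma> (quot_mod N ?H)" and ?\<phi> = "\<lambda>y. \<sigma> (?H +>\<^bsub>N\<^esub> y)"
  have T: "gmod n ?T" by (rule Q.gmod_transport[OF inj])
  interpret T: gmod n ?T by (rule T)
  interpret NT: gmod_pair n N ?T using N T by (rule gmod_pair.intro)
  interpret MT: gmod_pair n M ?T using M T by (rule gmod_pair.intro)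
  have qc: "?H +>\<^bsub>N\<^esub> y \<in> carrier (quot_mod N ?H)" if "y \<in> carrier N" for y
    using that by (simp add: N.carrier_quot[OF H])
  have zero: "\<zero>\<^bsub>?T\<^esub> = ?\<phi> \<zero>\<^bsub>N\<^esub>"
    by (simp only: Q.zero_transport[OF inj] N.zero_quot[OF H])
  have hom: "?\<phi> \<in> gr_hom (free_algebra n) N ?T"
    unfolding gr_hom_def
  proof (intro CollectI conjI ballI allI)
    show "?\<phi> \<in> carrier N \<rightarrow> carrier ?T"
      using qc by (simp add: Q.carrier_transport[OF inj])
    show "?\<phi> (x \<oplus>\<^bsub>N\<^esub> y) = ?\<phi> x \<oplus>\<^bsub>?T\<^esub> ?\<phi> y" if "x \<in> carrier N" "y \<in> carrier N" for x y
      unfolding Q.add_transport[OF inj qc[OF that(1)] qc[OF that(2)]] N.add_quot[OF H that] ..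
    show "?\<phi> (p \<odot>\<^bsub>N\<^esub> x) = p \<odot>\<^bsub>?T\<^esub> ?\<phi> x" if "p \<in> carrier N.R" "x \<in> carrier N" for p x
      unfolding Q.smult_transport[OF inj qc[OF that(2)]] N.smult_quot[OF H that] ..
    show "?\<phi> ` part N d \<subseteq> part ?T d" for d
      unfolding Q.part_transport[OF inj] N.part_quot[OF H] by blast
  qed
  let ?P = "(\<lambda>y. (y, ?\<phi> y)) ` carrier N" and ?Z = "(\<lambda>y. (y, \<zero>\<^bsub>?T\<^esub>)) ` carrier N"
  have P: "corr n N ?T ?P" by (rule corr_fun[OF N T hom])
  have Z: "corr n N ?T ?Z" by (rule corr_fun[OF N T zero_gr_hom[OF N T]])
  \<comment> \<open>All values of \<open>E\<close> lie in \<open>?H\<close>, whose elements have the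
    zero coset.\<close>
  have "eqv n ?T (E O ?P) (E O ?Z)"
  proof (rule eqvI)
    fix x y y' assume "(x, y) \<in> E O ?P" "(x, y') \<in> E O ?Z"
    then obtain z where "z \<in> ?H" "z \<in> carrier N" "y = ?\<phi> z" "y' = \<zero>\<^bsub>?T\<^esub>" by auto
    then show "teq n ?T y y'"
      using N.coset_eq_self_iff[OF H, of z] by (simp add: teq_refl zero)
  qed
  then have "arr n M ?T (E O ?P) = arr n M ?T (E O ?Z)"
    using MT.arr_eq_iff[OF corr_comp[OF M N T E P] corr_comp[OF M N T E Z]] by simp
  then have "q_comp (free_algebra n) M N ?T (arr n N ?T ?P) (arr n M N E) =
      q_comp (free_algebra n) M N ?T (arr n N ?T ?Z) (arr n M N E)"
    unfolding q_comp_arr[OF M N T E P] q_comp_arr[OF M N T E Z] .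
  then have "arr n N ?T ?P = arr n N ?T ?Z"
    using e T NT.arr_in_q_hom[OF P] NT.arr_in_q_hom[OF Z] unfolding epimorphism_def by simp
  then have eqv: "eqv n ?T ?P ?Z"
    using NT.arr_eq_iff[OF P Z] by simp
  \<comment> \<open>Agreement of the projection with zero up to torsion means that long multiples of
    \<open>y\<close> have the zero coset, that is, lie in \<open>?H\<close>.\<close>
  have "y \<in> satur n N ?H" if y: "y \<in> carrier N" for y
  proof (rule saturI[OF y])
    have "teq n ?T (?\<phi> y) \<zero>\<^bsub>?T\<^esub>"
      by (rule eqvD[OF eqv]) (use y in auto)
    then show "ev n (\<lambda>w. X w \<odot>\<^bsub>N\<^esub> y \<in> ?H)"
      unfolding teq_def
    proof (rule ev_mono)
      fix w assume w: "w \<in> words n" "X w \<odot>\<^bsub>?T\<^esub> ?\<phi> y = X w \<odot>\<^bsub>?T\<^esub> \<zero>\<^bsub>?T\<^esub>"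
      have wy: "X w \<odot>\<^bsub>N\<^esub> y \<in> carrier N" using w(1) y by simp
      have "?\<phi> (X w \<odot>\<^bsub>N\<^esub> y) = X w \<odot>\<^bsub>?T\<^esub> ?\<phi> y"
        using hom w(1) y unfolding gr_hom_def by simp
      also have "\<dots> = ?\<phi> \<zero>\<^bsub>N\<^esub>"
        unfolding w(2) zero[symmetric] using w(1) by simp
      finally have "?H +>\<^bsub>N\<^esub> (X w \<odot>\<^bsub>N\<^esub> y) = ?H +>\<^bsub>N\<^esub> \<zero>\<^bsub>N\<^esub>"
        by (rule inj_onD[OF inj _ qc[OF wy] qc[OF N.M.zero_closed]])
      then show "X w \<odot>\<^bsub>N\<^esub> y \<in> ?H"
        using N.coset_eq_self_iff[OF H wy] by blast
    qed
  qed
  then show ?thesis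
    unfolding satur_def by blast
qed

text \<open>The inclusion of \<open>?K\<close>, the elements related to zero, and the zero map agree
  after \<open>I\<close>, so they are the same morphism and \<open>?K\<close> is torsion. Unlike the
  quotient used for epimorphisms, \<open>?K\<close> already lies in the universe.\<close>

lemma monomorphism_kernel:
  assumes i: "monomorphism (QGr (free_algebra n)) M N (arr n M N I)"
    and M: "gmod n M" and N: "gmod n N" and I: "corr n M N I" and x: "(x, \<zero>\<^bsub>N\<^esub>) \<in> I"
  shows "x \<in> torsion n M"
proof -
  interpret M: gmod n M by (rule M)
  interpret N: gmod n N by (rule N)
  note Ir = corrD(1)[OF I]
  let ?K = "I\<inverse> `` {\<zero>\<^bsub>N\<^esub>}"
  have K: "gsub n M ?K"
    unfolding gsub_def
  proof (intro conjI ballI allI)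
    show "?K \<subseteq> carrier M" using rsubD(1)[OF Ir] by blast
    show "\<zero>\<^bsub>M\<^esub> \<in> ?K" using rsubD(3)[OF Ir] by blast
    show "x \<oplus>\<^bsub>M\<^esub> y \<in> ?K" if "x \<in> ?K" "y \<in> ?K" for x y
      using rsubD(4)[OF Ir, of x "\<zero>\<^bsub>N\<^esub>" y "\<zero>\<^bsub>N\<^esub>"] that by simp
    show "p \<odot>\<^bsub>M\<^esub> x \<in> ?K" if "p \<in> carrier M.R" "x \<in> ?K" for p x
      using rsubD(5)[OF Ir that(1), of x "\<zero>\<^bsub>N\<^esub>"] that by simp
    show "hc M d x \<in> ?K" if "x \<in> ?K" for d x
      using rsubD(6)[OF Ir, of x "\<zero>\<^bsub>N\<^esub>" d] that by simp
  qed
  let ?T = "restrict_mod M ?K"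
  have T: "gmod n ?T" by (rule M.gmod_restrict[OF K])
  interpret TM: gmod_pair n ?T M using T M by (rule gmod_pair.intro)
  interpret TN: gmod_pair n ?T N using T N by (rule gmod_pair.intro)
  let ?P = "(\<lambda>y. (y, y)) ` carrier ?T" and ?Z = "(\<lambda>y. (y, \<zero>\<^bsub>M\<^esub>)) ` carrier ?T"
  have P: "corr n ?T M ?P" by (rule corr_fun[OF T M incl_gr_hom[OF M K]])
  have Z: "corr n ?T M ?Z" by (rule corr_fun[OF T M zero_gr_hom[OF T M]])
  have "eqv n N (?P O I) (?Z O I)"
  proof (rule eqvI)
    fix z y y' assume "(z, y) \<in> ?P O I" "(z, y') \<in> ?Z O I"
    then have "(z, y) \<in> I" "(z, \<zero>\<^bsub>N\<^esub>) \<in> I" "(\<zero>\<^bsub>M\<^esub>, y') \<in> I" "(\<zero>\<^bsub>M\<^esub>, \<zero>\<^bsub>N\<^esub>) \<in> I"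
      using rsubD(3)[OF Ir] by auto
    then have "teq n N y \<zero>\<^bsub>N\<^esub>" "teq n N \<zero>\<^bsub>N\<^esub> y'"
      using corr_fibre_teq[OF M N I] by blast+
    then show "teq n N y y'" by (rule teq_trans)
  qed
  then have "arr n ?T N (?P O I) = arr n ?T N (?Z O I)"
    using TN.arr_eq_iff[OF corr_comp[OF T M N P I] corr_comp[OF T M N Z I]] by simp
  then have "q_comp (free_algebra n) ?T M N (arr n M N I) (arr n ?T M ?P) =
      q_comp (free_algebra n) ?T M N (arr n M N I) (arr n ?T M ?Z)"
    unfolding q_comp_arr[OF T M N P I] q_comp_arr[OF T M N Z I] .
  then have "arr n ?T M ?P = arr n ?T M ?Z"
    using i T TM.arr_in_q_hom[OF P] TM.arr_in_q_hom[OF Z] unfolding monomorphism_def by simp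
  then have "eqv n M ?P ?Z"
    using TM.arr_eq_iff[OF P Z] by simp
  then have "teq n M x \<zero>\<^bsub>M\<^esub>"
    by (rule eqvD) (use x in auto)
  then show ?thesis
    using M.torsion_iff_teq rsubD(1)[OF Ir x] by simp
qed

text \<open>Congruence in a submodule is computed with the scalars of \<open>M\<close>, so values in
  \<open>K\<close> that are congruent in \<open>M\<close> are congruent in the submodule.\<close>

lemma monomorphism_incl:
  assumes M: "gmod n M" and K: "gsub n M K"
  shows "corr n (restrict_mod M K) M (Id_on K)"
    and "monomorphism (QGr (free_algebra n)) (restrict_mod M K) M (arr n (restrict_mod M K) M (Id_on K))"
proof -
  let ?K = "restrict_mod M K"
  have KK: "gmod n ?K" by (rule gmod.gmod_restrict[OF M K])
  interpret KM: gmod_pair n ?K M using KK M by (rule gmod_pair.intro)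
  show I: "corr n ?K M (Id_on K)"
    using corr_fun[OF KK M incl_gr_hom[OF M K]] by (simp add: Id_on_image)
  show "monomorphism (QGr (free_algebra n)) ?K M (arr n ?K M (Id_on K))"
    unfolding monomorphism_def QGr_simps
  proof (intro conjI ballI impI)
    fix T g h assume "T \<in> Obj (QGr (free_algebra n))"
      and g: "g \<in> q_hom (free_algebra n) T ?K" and h: "h \<in> q_hom (free_algebra n) T ?K"
      and eq: "q_comp (free_algebra n) T ?K M (arr n ?K M (Id_on K)) g =
        q_comp (free_algebra n) T ?K M (arr n ?K M (Id_on K)) h"
    then have T: "gmod n T" by simp
    interpret TK: gmod_pair n T ?K using T KK by (rule gmod_pair.intro)
    interpret TM: gmod_pair n T M using T M by (rule gmod_pair.intro)
    obtain G where G: "corr n T ?K G" "g = arr n T ?K G" using g by (rule TK.q_homE)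
    obtain H where H: "corr n T ?K H" "h = arr n T ?K H" using h by (rule TK.q_homE)
    have "arr n T M (G O Id_on K) = arr n T M (H O Id_on K)"
      using eq unfolding G(2) H(2) q_comp_arr[OF T KK M G(1) I] q_comp_arr[OF T KK M H(1) I] .
    then have eqv: "eqv n M (G O Id_on K) (H O Id_on K)"
      using TM.arr_eq_iff[OF corr_comp[OF T KK M G(1) I] corr_comp[OF T KK M H(1) I]] by simp
    have "eqv n ?K G H"
    proof (rule eqvI)
      fix x y y' assume xy: "(x, y) \<in> G" "(x, y') \<in> H"
      have "y \<in> K" "y' \<in> K"
        using rsubD(2)[OF corrD(1)[OF G(1)] xy(1)] rsubD(2)[OF corrD(1)[OF H(1)] xy(2)] by simp_all
      then have "teq n M y y'"
        using xy by (intro eqvD[OF eqv]) auto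
      then show "teq n ?K y y'" by (simp add: teq_def)
    qed
    then show "g = h"
      using TK.arr_eq_iff[OF G(1) H(1)] G(2) H(2) by simp
  qed (use KK M KM.arr_in_q_hom[OF I] in simp_all)
qed


section \<open>Morphisms out of the regular module\<close>

context gmod
begin

lemma smult_finsum:
  assumes "finite A" "p \<in> carrier R" "\<And>v. v \<in> A \<Longrightarrow> f v \<in> carrier M"
  shows "p \<odot> (\<Oplus>v\<in>A. f v) = (\<Oplus>v\<in>A. p \<odot> f v)"
  using assms(1,3)
proof (induction A rule: finite_induct)
  case (insert v A)
  have "(\<Oplus>v\<in>insert v A. f v) = f v \<oplus> (\<Oplus>v\<in>A. f v)" "(\<Oplus>v\<in>A. f v) \<in> carrier M"
    using insert by (auto intro!: M.finsum_insert M.finsum_closed)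
  moreover have "(\<Oplus>v\<in>insert v A. p \<odot> f v) = p \<odot> f v \<oplus> (\<Oplus>v\<in>A. p \<odot> f v)"
    using insert assms(2) by (intro M.finsum_insert) auto
  ultimately show ?case
    using insert assms(2) by (simp add: smult_r_distr)
qed (use assms(2) in simp)

lemma hc_finsum:
  assumes "finite A" "\<And>v. v \<in> A \<Longrightarrow> f v \<in> carrier M"
  shows "hc M d (\<Oplus>v\<in>A. f v) = (\<Oplus>v\<in>A. hc M d (f v))"
  using assms
proof (induction A rule: finite_induct)
  case (insert v A)
  have "(\<Oplus>v\<in>insert v A. f v) = f v \<oplus> (\<Oplus>v\<in>A. f v)" "(\<Oplus>v\<in>A. f v) \<in> carrier M"
    using insert by (auto intro!: M.finsum_insert M.finsum_closed)
  moreover have "(\<Oplus>v\<in>insert v A. hc M d (f v)) = hc M d (f v) \<oplus> (\<Oplus>v\<in>A. hc M d (f v))"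
    using insert by (intro M.finsum_insert) auto
  ultimately show ?case
    using insert by (simp add: hc_add)
qed simp

end

section \<open>The regular module and its grading\<close>

definition trunc :: "int \<Rightarrow> (nat word \<Rightarrow>\<^sub>0 'k::field) \<Rightarrow> nat word \<Rightarrow>\<^sub>0 'k" where
  "trunc d p = Poly_Mapping.mapp (\<lambda>w c. if int (wlen w) = d then c else 0) p"

lemma lookup_trunc:
  "poly_mapping.lookup (trunc d p) w = (if int (wlen w) = d then poly_mapping.lookup p w else 0)"
  by (auto simp: trunc_def lookup_mapp when_def in_keys_iff)

lemma keys_trunc: "Poly_Mapping.keys (trunc d p) = {w \<in> Poly_Mapping.keys p. int (wlen w) = d}"
  by (auto simp: in_keys_iff lookup_trunc split: if_splits)

lemma regular_mod_simps [simp]: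
  "carrier (regular_mod R) = carrier R" "zero (regular_mod R) = zero R" "add (regular_mod R) = add R"
  "smult (regular_mod R) = mult R" "part (regular_mod R) = part R"
  by (simp_all add: regular_mod_def)

lemma gmod_regular: "gmod n (regular_mod (free_algebra n :: ('k::field, _) graded))"
proof (rule gmodI)
  let ?R = "free_algebra n :: ('k, _) graded" and ?M = "regular_mod (free_algebra n :: ('k, _) graded)"
  interpret R: ring ?R by (rule ring_free_algebra)
  show ag: "abelian_group ?M"
  proof (rule abelian_groupI)
    fix x assume "x \<in> carrier ?M"
    then show "\<exists>y\<in>carrier ?M. y \<oplus>\<^bsub>?M\<^esub> x = \<zero>\<^bsub>?M\<^esub>"
      using R.l_neg by (intro bexI[of _ "\<ominus>\<^bsub>?R\<^esub> x"]) auto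
  qed (simp_all add: R.a_ac)
  interpret M: abelian_group ?M by (rule ag)
  show "is_grading ?M"
    unfolding is_grading_def
  proof (intro conjI allI ballI)
    show sub: "subgroup (part ?M d) (add_monoid ?M)" for d
    proof (rule M.subgroup_addI)
      show "\<exists>y\<in>part ?M d. y \<oplus>\<^bsub>?M\<^esub> x = \<zero>\<^bsub>?M\<^esub>" if "x \<in> part ?M d" for x
        using that by (intro bexI[of _ "- x"]) (auto simp: free_algebra_simps in_keys_iff)
      show "x \<oplus>\<^bsub>?M\<^esub> y \<in> part ?M d" if "x \<in> part ?M d" "y \<in> part ?M d" for x y
        using that keys_add[of x y] by (auto simp: free_algebra_simps)
    qed (auto simp: free_algebra_simps)
    fix m assume m: "m \<in> carrier ?M"
    show "\<exists>!c. (\<forall>d. c d \<in> part ?M d) \<and> finite {d. c d \<noteq> \<zero>\<^bsub>?M\<^esub>} \<and>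
        m = (\<Oplus>\<^bsub>?M\<^esub>d\<in>{d. c d \<noteq> \<zero>\<^bsub>?M\<^esub>}. c d)"
    proof (rule M.is_gradingI[where p = trunc, OF sub])
      show "trunc d x \<in> part ?M d" if "x \<in> carrier ?M" for d x
        using that by (auto simp: free_algebra_simps keys_trunc)
      show "trunc d (x \<oplus>\<^bsub>?M\<^esub> y) = trunc d x \<oplus>\<^bsub>?M\<^esub> trunc d y" for d x y
        by (rule poly_mapping_eqI) (simp add: free_algebra_simps lookup_trunc lookup_add)
      show "trunc d x = (if d = e then x else \<zero>\<^bsub>?M\<^esub>)" if "x \<in> part ?M e" for d e x
        using that by (intro poly_mapping_eqI) (auto simp: free_algebra_simps lookup_trunc in_keys_iff)
      have supp: "{d. trunc d x \<noteq> 0} \<subseteq> (\<lambda>w. int (wlen w)) ` Poly_Mapping.keys x"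
        for x :: "nat word \<Rightarrow>\<^sub>0 'k"
      proof
        fix d assume "d \<in> {d. trunc d x \<noteq> 0}"
        then have "Poly_Mapping.keys (trunc d x) \<noteq> {}" by simp
        then obtain w where "w \<in> Poly_Mapping.keys (trunc d x)" by blast
        then show "d \<in> (\<lambda>w. int (wlen w)) ` Poly_Mapping.keys x"
          by (auto simp: keys_trunc)
      qed
      then show "finite {d. trunc d x \<noteq> \<zero>\<^bsub>?M\<^esub>}" for x
        using finite_subset[OF supp[of x]] by (simp add: free_algebra_simps)
      fix x S assume S: "\<zero>\<^bsub>?M\<^esub> \<in> S" "\<And>x y. \<lbrakk>x \<in> S; y \<in> S\<rbrakk> \<Longrightarrow> x \<oplus>\<^bsub>?M\<^esub> y \<in> S" "\<And>d. trunc d x \<in> S"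
      let ?E = "(\<lambda>w. int (wlen w)) ` Poly_Mapping.keys x"
      have sum: "(\<Sum>d\<in>A. trunc d x) \<in> S" if "finite A" for A
        using that S by (induction A rule: finite_induct) (auto simp: free_algebra_simps)
      have "x = (\<Sum>d\<in>?E. trunc d x)"
      proof (rule poly_mapping_eqI)
        fix w
        have "(\<Sum>d\<in>?E. poly_mapping.lookup (trunc d x) w) = (if int (wlen w) \<in> ?E then poly_mapping.lookup x w else 0)"
          by (simp add: lookup_trunc)
        also have "\<dots> = poly_mapping.lookup x w"
          by (auto simp: in_keys_iff)
        finally show "poly_mapping.lookup x w = poly_mapping.lookup (\<Sum>d\<in>?E. trunc d x) w"
          by (simp add: lookup_sum)
      qed
      then show "x \<in> S" using sum[of ?E] by simp
    qed (use m in simp)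
  qed
  show "p \<odot>\<^bsub>?M\<^esub> x \<in> part ?M (i + j)" if "p \<in> part ?R i" "x \<in> part ?M j" for p x i j
    using that by (auto simp: free_algebra_simps dest!: subsetD[OF keys_mult])
qed (auto simp: free_algebra_simps algebra_simps dest!: subsetD[OF keys_mult])

text \<open>Complements \<open>hc_smult\<close>: here the vector is homogeneous and the scalar
  arbitrary. The components of the scalar are those of the regular module, and the proof is a
  homogeneous induction on \<open>p\<close>.\<close>

lemma hc_smult_regular:
  assumes M: "gmod n M" and x: "x \<in> part M D" and p: "p \<in> carrier (free_algebra n)"
  shows "hc M d (p \<odot>\<^bsub>M\<^esub> x) = hc (regular_mod (free_algebra n)) (d - D) p \<odot>\<^bsub>M\<^esub> x"
proof -
  interpret M: gmod n M by (rule M)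
  let ?R = "regular_mod M.R"
  interpret R: gmod n ?R by (rule gmod_regular)
  have xc: "x \<in> carrier M" using x by (rule M.part_carrier)
  have "p \<in> {p \<in> carrier ?R. hc M d (p \<odot>\<^bsub>M\<^esub> x) = hc ?R (d - D) p \<odot>\<^bsub>M\<^esub> x}"
  proof (rule R.hc_induct)
    show "p \<in> carrier ?R" using p by simp
  next
    show "\<zero>\<^bsub>?R\<^esub> \<in> {p \<in> carrier ?R. hc M d (p \<odot>\<^bsub>M\<^esub> x) = hc ?R (d - D) p \<odot>\<^bsub>M\<^esub> x}"
      using R.hc_zero[of "d - D"] xc by (simp add: free_algebra_simps(4) del: R.hc_zero)
  next
    fix q r assume "q \<in> {p \<in> carrier ?R. hc M d (p \<odot>\<^bsub>M\<^esub> x) = hc ?R (d - D) p \<odot>\<^bsub>M\<^esub> x}"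
      "r \<in> {p \<in> carrier ?R. hc M d (p \<odot>\<^bsub>M\<^esub> x) = hc ?R (d - D) p \<odot>\<^bsub>M\<^esub> x}"
    then have q: "q \<in> carrier M.R" "hc M d (q \<odot>\<^bsub>M\<^esub> x) = hc ?R (d - D) q \<odot>\<^bsub>M\<^esub> x"
      and r: "r \<in> carrier M.R" "hc M d (r \<odot>\<^bsub>M\<^esub> x) = hc ?R (d - D) r \<odot>\<^bsub>M\<^esub> x" by simp_all
    have "hc ?R (d - D) (q + r) = hc ?R (d - D) q + hc ?R (d - D) r"
      using R.hc_add[of q r] q(1) r(1) by (simp add: free_algebra_simps(2))
    moreover have "hc ?R (d - D) q \<in> carrier M.R" "hc ?R (d - D) r \<in> carrier M.R"
      using R.hc_carrier[of q] R.hc_carrier[of r] q(1) r(1) by simp_all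
    ultimately have "hc M d ((q + r) \<odot>\<^bsub>M\<^esub> x) = hc ?R (d - D) (q + r) \<odot>\<^bsub>M\<^esub> x"
      using q r xc by (simp add: M.smult_add_left M.hc_add)
    then show "q \<oplus>\<^bsub>?R\<^esub> r \<in> {p \<in> carrier ?R. hc M d (p \<odot>\<^bsub>M\<^esub> x) = hc ?R (d - D) p \<odot>\<^bsub>M\<^esub> x}"
      using free_algebra_add_closed[OF q(1) r(1)] by (simp add: free_algebra_simps(2))
  next
    fix e
    have q: "hc ?R e p \<in> part M.R e" "hc ?R e p \<in> carrier M.R"
      using R.hc_in_part[of p e] R.hc_carrier[of p e] p by simp_all
    have "hc M d (hc ?R e p \<odot>\<^bsub>M\<^esub> x) = (if d = e + D then hc ?R e p \<odot>\<^bsub>M\<^esub> x else \<zero>\<^bsub>M\<^esub>)"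
      by (rule M.hc_part) (rule M.smult_part[OF q(1) x])
    moreover have "hc ?R (d - D) (hc ?R e p) = (if d - D = e then hc ?R e p else 0)"
      using R.hc_hc[of p "d - D" e] p by (simp add: free_algebra_simps(4))
    ultimately show "hc ?R e p \<in> {p \<in> carrier ?R. hc M d (p \<odot>\<^bsub>M\<^esub> x) = hc ?R (d - D) p \<odot>\<^bsub>M\<^esub> x}"
      using q(2) xc by auto
  qed auto
  then show ?thesis by simp
qed

text \<open>The submodule of pairs generated by the \<open>(x v, y v)\<close>. The coefficients
  \<open>a\<close>, shared by both sides, are kept explicit because freeness is a statement about
  such families of coefficients.\<close>

definition lspan :: "nat \<Rightarrow> (nat word \<Rightarrow>\<^sub>0 'k::field, 'u) graded \<Rightarrow> (nat word \<Rightarrow>\<^sub>0 'k, 'v) graded \<Rightarrow>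
    'i set \<Rightarrow> ('i \<Rightarrow> 'u) \<Rightarrow> ('i \<Rightarrow> 'v) \<Rightarrow> ('u \<times> 'v) set" where
  "lspan n M N A x y = {(\<Oplus>\<^bsub>M\<^esub>v\<in>A. a v \<odot>\<^bsub>M\<^esub> x v, \<Oplus>\<^bsub>N\<^esub>v\<in>A. a v \<odot>\<^bsub>N\<^esub> y v) | a.
     \<forall>v\<in>A. a v \<in> carrier (free_algebra n)}"

text \<open>Closure under components relies on the common degree \<open>D\<close> of all
  \<open>x v\<close> and \<open>y v\<close>: the components of degree \<open>d - D\<close> of the
  coefficients then serve both sides at once.\<close>

lemma rsub_lspan:
  assumes M: "gmod n M" and N: "gmod n N" and A: "finite A"
    and x: "\<And>v. v \<in> A \<Longrightarrow> x v \<in> part M D" and y: "\<And>v. v \<in> A \<Longrightarrow> y v \<in> part N D"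
  shows "rsub n M N (lspan n M N A x y)"
proof -
  interpret M: gmod n M by (rule M)
  interpret N: gmod n N by (rule N)
  let ?f = "\<lambda>a. \<Oplus>\<^bsub>M\<^esub>v\<in>A. a v \<odot>\<^bsub>M\<^esub> x v" and ?g = "\<lambda>a. \<Oplus>\<^bsub>N\<^esub>v\<in>A. a v \<odot>\<^bsub>N\<^esub> y v"
  have xy: "x v \<in> carrier M" "y v \<in> carrier N" if "v \<in> A" for v
    using M.part_carrier[OF x[OF that]] N.part_carrier[OF y[OF that]] .
  have mem: "(?f a, ?g a) \<in> lspan n M N A x y" if "\<And>v. v \<in> A \<Longrightarrow> a v \<in> carrier M.R" for a
    using that unfolding lspan_def by blast
  show ?thesis
  proof (rule rsubI)
    fix p q assume "(p, q) \<in> lspan n M N A x y"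
    then obtain a where a: "p = ?f a" "q = ?g a" "\<And>v. v \<in> A \<Longrightarrow> a v \<in> carrier M.R"
      unfolding lspan_def by blast
    have axy: "a v \<odot>\<^bsub>M\<^esub> x v \<in> carrier M" "a v \<odot>\<^bsub>N\<^esub> y v \<in> carrier N" if "v \<in> A" for v
      using a(3) xy that by simp_all
    show "p \<in> carrier M \<and> q \<in> carrier N"
      unfolding a(1,2) using axy by (auto intro!: M.M.finsum_closed N.M.finsum_closed)
    show "(r \<odot>\<^bsub>M\<^esub> p, r \<odot>\<^bsub>N\<^esub> q) \<in> lspan n M N A x y" if r: "r \<in> carrier M.R" for r
    proof -
      have "r \<odot>\<^bsub>M\<^esub> p = ?f (\<lambda>v. r * a v)"
      proof -
        have "r \<odot>\<^bsub>M\<^esub> p = (\<Oplus>\<^bsub>M\<^esub>v\<in>A. r \<odot>\<^bsub>M\<^esub> (a v \<odot>\<^bsub>M\<^esub> x v))"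
          unfolding a(1) by (rule M.smult_finsum[OF A r]) (rule axy)
        also have "\<dots> = ?f (\<lambda>v. r * a v)"
          by (intro M.M.finsum_cong') (use r a(3) xy in \<open>auto simp: M.smult_mult axy\<close>)
        finally show ?thesis .
      qed
      moreover have "r \<odot>\<^bsub>N\<^esub> q = ?g (\<lambda>v. r * a v)"
      proof -
        have "r \<odot>\<^bsub>N\<^esub> q = (\<Oplus>\<^bsub>N\<^esub>v\<in>A. r \<odot>\<^bsub>N\<^esub> (a v \<odot>\<^bsub>N\<^esub> y v))"
          unfolding a(2) by (rule N.smult_finsum[OF A r]) (rule axy)
        also have "\<dots> = ?g (\<lambda>v. r * a v)"
          by (intro N.M.finsum_cong') (use r a(3) xy in \<open>auto simp: N.smult_mult axy\<close>)
        finally show ?thesis .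
      qed
      moreover have "r * a v \<in> carrier M.R" if "v \<in> A" for v
        using ring.ring_simprules(5)[OF ring_free_algebra r a(3)[OF that]] by (simp add: free_algebra_simps(3))
      ultimately show ?thesis using mem[of "\<lambda>v. r * a v"] by simp
    qed
    show "(hc M d p, hc N d q) \<in> lspan n M N A x y" for d
    proof -
      let ?b = "\<lambda>v. hc (regular_mod M.R) (d - D) (a v)"
      have b: "?b v \<in> carrier M.R" if "v \<in> A" for v
        using gmod.hc_carrier[OF gmod_regular, of "a v" n "d - D"] a(3)[OF that] by simp
      have "hc M d p = ?f ?b"
      proof -
        have "hc M d p = (\<Oplus>\<^bsub>M\<^esub>v\<in>A. hc M d (a v \<odot>\<^bsub>M\<^esub> x v))"
          unfolding a(1) by (rule M.hc_finsum[OF A]) (rule axy)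
        also have "\<dots> = ?f ?b"
          by (intro M.M.finsum_cong') (use b xy hc_smult_regular[OF M x a(3)] in auto)
        finally show ?thesis .
      qed
      moreover have "hc N d q = ?g ?b"
      proof -
        have "hc N d q = (\<Oplus>\<^bsub>N\<^esub>v\<in>A. hc N d (a v \<odot>\<^bsub>N\<^esub> y v))"
          unfolding a(2) by (rule N.hc_finsum[OF A]) (rule axy)
        also have "\<dots> = ?g ?b"
          by (intro N.M.finsum_cong') (use b xy hc_smult_regular[OF N y a(3)] in auto)
        finally show ?thesis .
      qed
      ultimately show ?thesis using mem[OF b] by simp
    qed
    fix p' q' assume "(p', q') \<in> lspan n M N A x y"
    then obtain a' where a': "p' = ?f a'" "q' = ?g a'" "\<And>v. v \<in> A \<Longrightarrow> a' v \<in> carrier M.R"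
      unfolding lspan_def by blast
    have axy': "a' v \<odot>\<^bsub>M\<^esub> x v \<in> carrier M" "a' v \<odot>\<^bsub>N\<^esub> y v \<in> carrier N" if "v \<in> A" for v
      using a'(3) xy that by simp_all
    have aa: "a v + a' v \<in> carrier M.R" if "v \<in> A" for v
      using a(3)[OF that] a'(3)[OF that] by (rule free_algebra_add_closed)
    have "?f (\<lambda>v. a v + a' v) = (\<Oplus>\<^bsub>M\<^esub>v\<in>A. a v \<odot>\<^bsub>M\<^esub> x v \<oplus>\<^bsub>M\<^esub> a' v \<odot>\<^bsub>M\<^esub> x v)"
      using axy axy' a(3) a'(3) xy by (intro M.M.finsum_cong') (auto simp: M.smult_add_left)
    also have "\<dots> = p \<oplus>\<^bsub>M\<^esub> p'"
      unfolding a(1) a'(1) using axy axy' by (intro M.M.finsum_addf) auto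
    finally have 1: "?f (\<lambda>v. a v + a' v) = p \<oplus>\<^bsub>M\<^esub> p'" .
    have "?g (\<lambda>v. a v + a' v) = (\<Oplus>\<^bsub>N\<^esub>v\<in>A. a v \<odot>\<^bsub>N\<^esub> y v \<oplus>\<^bsub>N\<^esub> a' v \<odot>\<^bsub>N\<^esub> y v)"
      using axy axy' a(3) a'(3) xy by (intro N.M.finsum_cong') (auto simp: N.smult_add_left)
    also have "\<dots> = q \<oplus>\<^bsub>N\<^esub> q'"
      unfolding a(2) a'(2) using axy axy' by (intro N.M.finsum_addf) auto
    finally have 2: "?g (\<lambda>v. a v + a' v) = q \<oplus>\<^bsub>N\<^esub> q'" .
    have "(?f (\<lambda>v. a v + a' v), ?g (\<lambda>v. a v + a' v)) \<in> lspan n M N A x y"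
      by (rule mem) (rule aa)
    then show "(p \<oplus>\<^bsub>M\<^esub> p', q \<oplus>\<^bsub>N\<^esub> q') \<in> lspan n M N A x y"
      unfolding 1 2 .
  next
    have "?f (\<lambda>_. 0) = (\<Oplus>\<^bsub>M\<^esub>v\<in>A. \<zero>\<^bsub>M\<^esub>)" "?g (\<lambda>_. 0) = (\<Oplus>\<^bsub>N\<^esub>v\<in>A. \<zero>\<^bsub>N\<^esub>)"
      by (intro M.M.finsum_cong' N.M.finsum_cong'; use xy in simp)+
    then show "(\<zero>\<^bsub>M\<^esub>, \<zero>\<^bsub>N\<^esub>) \<in> lspan n M N A x y"
      using mem[of "\<lambda>_. 0"] M.M.finsum_zero[of A] N.M.finsum_zero[of A] by simp
  qed
qed

lemma lspan_base:
  fixes M :: "(nat word \<Rightarrow>\<^sub>0 'k::field, 'u) graded"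
  assumes M: "gmod n M" and N: "gmod n N" and A: "finite A"
    and x: "\<And>v. v \<in> A \<Longrightarrow> x v \<in> carrier M" and y: "\<And>v. v \<in> A \<Longrightarrow> y v \<in> carrier N" and v: "v \<in> A"
  shows "(x v, y v) \<in> lspan n M N A x y"
proof -
  interpret M: gmod n M by (rule M)
  interpret N: gmod n N by (rule N)
  let ?a = "\<lambda>u. if v = u then 1 else 0 :: nat word \<Rightarrow>\<^sub>0 'k"
  have "(\<Oplus>\<^bsub>M\<^esub>u\<in>A. ?a u \<odot>\<^bsub>M\<^esub> x u) = (\<Oplus>\<^bsub>M\<^esub>u\<in>A. if v = u then x u else \<zero>\<^bsub>M\<^esub>)"
    using x by (intro M.M.finsum_cong') auto
  also have "\<dots> = x v"
    using x v A by (intro M.M.finsum_singleton) auto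
  finally have 1: "(\<Oplus>\<^bsub>M\<^esub>u\<in>A. ?a u \<odot>\<^bsub>M\<^esub> x u) = x v" .
  have "(\<Oplus>\<^bsub>N\<^esub>u\<in>A. ?a u \<odot>\<^bsub>N\<^esub> y u) = (\<Oplus>\<^bsub>N\<^esub>u\<in>A. if v = u then y u else \<zero>\<^bsub>N\<^esub>)"
    using y by (intro N.M.finsum_cong') auto
  also have "\<dots> = y v"
    using y v A by (intro N.M.finsum_singleton) auto
  finally have 2: "(\<Oplus>\<^bsub>N\<^esub>u\<in>A. ?a u \<odot>\<^bsub>N\<^esub> y u) = y v" .
  have "\<forall>u\<in>A. ?a u \<in> carrier M.R"
    by (simp add: free_algebra_simps(1))
  then show ?thesis
    unfolding lspan_def by (intro CollectI exI[of _ ?a]) (simp only: 1 2 simp_thms)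
qed

lemma lspan_subset:
  assumes M: "gmod n M" and N: "gmod n N" and A: "finite A" and G: "rsub n M N G"
    and base: "\<And>v. v \<in> A \<Longrightarrow> (x v, y v) \<in> G"
  shows "lspan n M N A x y \<subseteq> G"
proof -
  interpret M: gmod n M by (rule M)
  interpret N: gmod n N by (rule N)
  have "(\<Oplus>\<^bsub>M\<^esub>v\<in>B. a v \<odot>\<^bsub>M\<^esub> x v, \<Oplus>\<^bsub>N\<^esub>v\<in>B. a v \<odot>\<^bsub>N\<^esub> y v) \<in> G"
    if a: "\<forall>v\<in>A. a v \<in> carrier M.R" and B: "B \<subseteq> A" for a B
    using finite_subset[OF B A] B
  proof (induction B rule: finite_induct)
    case (insert v B)
    have m: "(a u \<odot>\<^bsub>M\<^esub> x u, a u \<odot>\<^bsub>N\<^esub> y u) \<in> G" if "u \<in> A" for u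
      using rsubD(5)[OF G _ base[OF that]] a that by blast
    note c = rsubD(1)[OF G m] rsubD(2)[OF G m]
    have "(\<Oplus>\<^bsub>M\<^esub>v\<in>insert v B. a v \<odot>\<^bsub>M\<^esub> x v) = a v \<odot>\<^bsub>M\<^esub> x v \<oplus>\<^bsub>M\<^esub> (\<Oplus>\<^bsub>M\<^esub>v\<in>B. a v \<odot>\<^bsub>M\<^esub> x v)"
      using insert(1,2,4) c(1) by (intro M.M.finsum_insert) auto
    moreover have "(\<Oplus>\<^bsub>N\<^esub>v\<in>insert v B. a v \<odot>\<^bsub>N\<^esub> y v) = a v \<odot>\<^bsub>N\<^esub> y v \<oplus>\<^bsub>N\<^esub> (\<Oplus>\<^bsub>N\<^esub>v\<in>B. a v \<odot>\<^bsub>N\<^esub> y v)"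
      using insert(1,2,4) c(2) by (intro N.M.finsum_insert) auto
    ultimately show ?case
      using rsubD(4)[OF G m[of v]] insert(3,4) by simp
  qed (use rsubD(3)[OF G] in simp)
  then show ?thesis
    unfolding lspan_def by blast
qed


section \<open>The object \<open>\<O>\<close> and maps prescribed on words of one length\<close>

locale structure_sheaf =
  fixes n :: nat and \<iota> :: "(nat word \<Rightarrow>\<^sub>0 'k::field) \<Rightarrow> 'u"
  assumes inj: "inj_on \<iota> (carrier (free_algebra n))"
begin

abbreviation R :: "('k, nat word \<Rightarrow>\<^sub>0 'k) graded" where "R \<equiv> free_algebra n"

abbreviation \<O> :: "(nat word \<Rightarrow>\<^sub>0 'k, 'u) graded" where "\<O> \<equiv> transport_mod \<iota> (regular_mod R)"

abbreviation q_cat :: "((nat word \<Rightarrow>\<^sub>0 'k, 'u) graded, 'u q_triple set) category" where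
  "q_cat \<equiv> QGr R"

lemma inj_regular: "inj_on \<iota> (carrier (regular_mod R))"
  using inj by simp

lemma gmod_O: "gmod n \<O>"
  by (rule gmod.gmod_transport[OF gmod_regular inj_regular])

sublocale reg: gmod n \<O> by (rule gmod_O)

lemma O_simps:
  "carrier \<O> = \<iota> ` carrier R" "\<zero>\<^bsub>\<O>\<^esub> = \<iota> 0" "part \<O> d = \<iota> ` part R d"
  "\<lbrakk>p \<in> carrier R; q \<in> carrier R\<rbrakk> \<Longrightarrow> \<iota> p \<oplus>\<^bsub>\<O>\<^esub> \<iota> q = \<iota> (p + q)"
  "q \<in> carrier R \<Longrightarrow> p \<odot>\<^bsub>\<O>\<^esub> \<iota> q = \<iota> (p * q)"
  using gmod.carrier_transport[OF gmod_regular inj_regular] gmod.zero_transport[OF gmod_regular inj_regular]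
    gmod.part_transport[OF gmod_regular inj_regular, of d] gmod.add_transport[OF gmod_regular inj_regular, of p q]
    gmod.smult_transport[OF gmod_regular inj_regular, of q p]
  by (simp_all add: free_algebra_simps(2-5))

abbreviation gen :: 'u where "gen \<equiv> \<iota> 1"

lemma one_carrier: "1 \<in> carrier R"
  using single_in_free_algebra[of 0 n 1] by simp

lemma gen_carrier: "gen \<in> carrier \<O>"
  using one_carrier by (simp add: O_simps(1))

lemma smult_gen: "p \<odot>\<^bsub>\<O>\<^esub> gen = \<iota> p"
  using O_simps(5)[OF one_carrier, of p] by simp

lemma X_gen_part: "w \<in> words n \<Longrightarrow> X w \<odot>\<^bsub>\<O>\<^esub> gen \<in> part \<O> (int (wlen w))"
  unfolding smult_gen O_simps(3) by (rule imageI) (rule X_in_part)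

text \<open>Pulls a sum in the transported module back to a polynomial, whose coefficients can be
  inspected. Membership in the carrier is recorded because \<open>\<iota>\<close> is injective only
  there.\<close>

lemma finsum_gen:
  assumes "finite A" "\<And>v. v \<in> A \<Longrightarrow> v \<in> words n" "\<And>v. v \<in> A \<Longrightarrow> a v \<in> carrier R"
  shows "(\<Oplus>\<^bsub>\<O>\<^esub>v\<in>A. a v \<odot>\<^bsub>\<O>\<^esub> (X v \<odot>\<^bsub>\<O>\<^esub> gen)) = \<iota> (\<Sum>v\<in>A. a v * X v) \<and> (\<Sum>v\<in>A. a v * X v) \<in> carrier R"
  using assms
proof (induction A rule: finite_induct)
  case (insert v A)
  have t: "a u \<odot>\<^bsub>\<O>\<^esub> (X u \<odot>\<^bsub>\<O>\<^esub> gen) = \<iota> (a u * X u)" "a u * X u \<in> carrier R" if "u \<in> insert v A" for u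
  proof -
    have u: "a u \<in> carrier R" "X u \<in> carrier R" using insert.prems that by simp_all
    show "a u \<odot>\<^bsub>\<O>\<^esub> (X u \<odot>\<^bsub>\<O>\<^esub> gen) = \<iota> (a u * X u)"
      unfolding smult_gen O_simps(5)[OF u(2)] ..
    show "a u * X u \<in> carrier R"
      using ring.ring_simprules(5)[OF ring_free_algebra u] by (simp add: free_algebra_simps(3))
  qed
  have "(\<Oplus>\<^bsub>\<O>\<^esub>v\<in>insert v A. a v \<odot>\<^bsub>\<O>\<^esub> (X v \<odot>\<^bsub>\<O>\<^esub> gen)) =
      a v \<odot>\<^bsub>\<O>\<^esub> (X v \<odot>\<^bsub>\<O>\<^esub> gen) \<oplus>\<^bsub>\<O>\<^esub> (\<Oplus>\<^bsub>\<O>\<^esub>v\<in>A. a v \<odot>\<^bsub>\<O>\<^esub> (X v \<odot>\<^bsub>\<O>\<^esub> gen))"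
    using insert.hyps insert.prems gen_carrier by (intro reg.M.finsum_insert) auto
  moreover have IH: "(\<Oplus>\<^bsub>\<O>\<^esub>v\<in>A. a v \<odot>\<^bsub>\<O>\<^esub> (X v \<odot>\<^bsub>\<O>\<^esub> gen)) = \<iota> (\<Sum>v\<in>A. a v * X v)"
    "(\<Sum>v\<in>A. a v * X v) \<in> carrier R"
    using insert.IH insert.prems by simp_all
  moreover have "\<iota> (a v * X v) \<oplus>\<^bsub>\<O>\<^esub> \<iota> (\<Sum>v\<in>A. a v * X v) = \<iota> (a v * X v + (\<Sum>v\<in>A. a v * X v))"
    by (rule O_simps(4)) (use t(2)[of v] IH in simp_all)
  ultimately show ?case
    using t[of v] insert.hyps free_algebra_add_closed[OF t(2)[of v] IH(2)] by simp
qed (simp add: O_simps(2))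

lemma lookup_mult_X:
  "poly_mapping.lookup (p * X v) w = (\<Sum>u\<in>Poly_Mapping.keys p. poly_mapping.lookup p u when w = u + v)"
  for p :: "nat word \<Rightarrow>\<^sub>0 'k"
proof -
  have "p = (\<Sum>u\<in>Poly_Mapping.keys p. Poly_Mapping.single u (poly_mapping.lookup p u))"
    by (rule poly_mapping_eqI) (simp add: lookup_sum lookup_single when_def in_keys_iff)
  then have "p * X v = (\<Sum>u\<in>Poly_Mapping.keys p. Poly_Mapping.single u (poly_mapping.lookup p u) * X v)"
    by (metis sum_distrib_right)
  also have "\<dots> = (\<Sum>u\<in>Poly_Mapping.keys p. Poly_Mapping.single (u + v) (poly_mapping.lookup p u))"
    by (simp add: mult_single)
  finally show ?thesis
    by (simp add: lookup_sum lookup_single when_def eq_commute)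
qed

text \<open>The coefficient of the sum at \<open>u + v\<close> sees only \<open>a v\<close> at
  \<open>u\<close>: the words in \<open>A\<close> have equal length, so by \<open>words_eqI\<close>
  the suffix identifies \<open>v\<close>.\<close>

lemma words_independent:
  fixes a :: "nat word \<Rightarrow> nat word \<Rightarrow>\<^sub>0 'k"
  assumes "finite A" "\<And>v. v \<in> A \<Longrightarrow> wlen v = D" "(\<Sum>v\<in>A. a v * X v) = 0" "v \<in> A"
  shows "a v = 0"
proof (rule poly_mapping_eqI)
  fix u
  have split: "u + v = u' + v' \<longleftrightarrow> u = u' \<and> v = v'" if "v' \<in> A" for u' v'
    using words_eqI[of u v u' v'] assms(2)[OF that] assms(2)[OF assms(4)] by auto
  have "0 = (\<Sum>v'\<in>A. poly_mapping.lookup (a v' * X v') (u + v))"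
    using assms(3) by (metis lookup_sum lookup_zero)
  also have "\<dots> = (\<Sum>v'\<in>A. if v = v' then poly_mapping.lookup (a v) u else 0)"
  proof (rule sum.cong[OF refl])
    fix v' assume v': "v' \<in> A"
    have "poly_mapping.lookup (a v' * X v') (u + v) =
        (\<Sum>u'\<in>Poly_Mapping.keys (a v'). if u = u' then (if v = v' then poly_mapping.lookup (a v') u' else 0) else 0)"
      unfolding lookup_mult_X by (rule sum.cong[OF refl]) (simp add: split[OF v'] when_def)
    also have "\<dots> = (if v = v' then poly_mapping.lookup (a v) u else 0)"
      by (simp add: in_keys_iff)
    finally show "poly_mapping.lookup (a v' * X v') (u + v) = (if v = v' then poly_mapping.lookup (a v) u else 0)" .
  qed
  also have "\<dots> = poly_mapping.lookup (a v) u"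
    using assms(1,4) by simp
  finally show "poly_mapping.lookup (a v) u = poly_mapping.lookup 0 u" by simp
qed

text \<open>Saturations are submodules and \<open>gen\<close> generates \<open>\<O>\<close>, so
  \<open>gen\<close> alone decides.\<close>

lemma ev_gen:
  assumes K: "gsub n \<O> K" and ev: "ev n (\<lambda>w. X w \<odot>\<^bsub>\<O>\<^esub> gen \<in> K)"
  shows "satur n \<O> K = carrier \<O>"
proof -
  have "x \<in> satur n \<O> K" if "x \<in> carrier \<O>" for x
  proof -
    obtain p where p: "p \<in> carrier R" "x = \<iota> p"
      using \<open>x \<in> carrier \<O>\<close> unfolding O_simps(1) by blast
    have "gen \<in> satur n \<O> K" using gen_carrier ev by (rule saturI)
    from gsubD(4)[OF reg.gsub_satur[OF K] p(1) this] show ?thesis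
      unfolding p(2) smult_gen .
  qed
  then show ?thesis unfolding satur_def by blast
qed

abbreviation lift :: "nat \<Rightarrow> (nat word \<Rightarrow>\<^sub>0 'k, 'u) graded \<Rightarrow> (nat word \<Rightarrow> 'u) \<Rightarrow> ('u \<times> 'u) set" where
  "lift D M x \<equiv> lspan n \<O> M {v \<in> words n. wlen v = D} (\<lambda>v. X v \<odot>\<^bsub>\<O>\<^esub> gen) x"

text \<open>The words of length \<open>D\<close> freely generate the left ideal of all elements of degree at least \<open>D\<close>,
  so their images in any module can be prescribed.\<close>

lemma corr_lift:
  assumes M: "gmod n M" and x: "\<And>v. \<lbrakk>v \<in> words n; wlen v = D\<rbrakk> \<Longrightarrow> x v \<in> part M (int D)"
  shows "corr n \<O> M (lift D M x)"
    and "\<lbrakk>v \<in> words n; wlen v = D\<rbrakk> \<Longrightarrow> (X v \<odot>\<^bsub>\<O>\<^esub> gen, x v) \<in> lift D M x"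
proof -
  interpret M: gmod n M by (rule M)
  let ?A = "{v \<in> words n. wlen v = D}" and ?L = "lift D M x"
  have fin: "finite ?A" by (rule finite_words_of_length)
  have L: "rsub n \<O> M ?L"
  proof (rule rsub_lspan[OF gmod_O M fin])
    fix v assume v: "v \<in> ?A"
    then show "X v \<odot>\<^bsub>\<O>\<^esub> gen \<in> part \<O> (int D)" using X_gen_part[of v] by simp
    show "x v \<in> part M (int D)" using v x by simp
  qed
  have base: "(X v \<odot>\<^bsub>\<O>\<^esub> gen, x v) \<in> ?L" if v: "v \<in> words n" "wlen v = D" for v
  proof (rule lspan_base[OF gmod_O M fin, where x = "\<lambda>v. X v \<odot>\<^bsub>\<O>\<^esub> gen" and y = x])
    show "X v \<odot>\<^bsub>\<O>\<^esub> gen \<in> carrier \<O>" if "v \<in> ?A" for v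
      using that gen_carrier by simp
    show "x v \<in> carrier M" if "v \<in> ?A" for v
      using that x M.part_carrier by blast
    show "v \<in> ?A" using v by simp
  qed
  then show "\<lbrakk>v \<in> words n; wlen v = D\<rbrakk> \<Longrightarrow> (X v \<odot>\<^bsub>\<O>\<^esub> gen, x v) \<in> ?L" .
  have "satur n \<O> (Domain ?L) = carrier \<O>"
  proof (rule ev_gen[OF gsub_Domain[OF L]])
    have "X w \<odot>\<^bsub>\<O>\<^esub> gen \<in> Domain ?L" if w: "w \<in> words n" "D \<le> wlen w" for w
    proof -
      from word_split[OF w] obtain u v where
        uv: "w = u + v" "u \<in> words n" "v \<in> words n" "wlen v = D" "wlen u = wlen w - D" .
      show ?thesis
        using rsub_X[OF L uv(2) base[OF uv(3,4)]] reg.X_X[OF uv(2,3) gen_carrier] unfolding uv(1) by auto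
    qed
    then show "ev n (\<lambda>w. X w \<odot>\<^bsub>\<O>\<^esub> gen \<in> Domain ?L)"
      unfolding ev_def by blast
  qed
  \<comment> \<open>Freeness makes the relation single-valued: a vanishing combination of the words
    has zero coefficients, hence value zero.\<close>
  moreover have "y = \<zero>\<^bsub>M\<^esub>" if y: "(\<zero>\<^bsub>\<O>\<^esub>, y) \<in> ?L" for y
  proof -
    obtain a where a: "\<zero>\<^bsub>\<O>\<^esub> = (\<Oplus>\<^bsub>\<O>\<^esub>v\<in>?A. a v \<odot>\<^bsub>\<O>\<^esub> (X v \<odot>\<^bsub>\<O>\<^esub> gen))" "y = (\<Oplus>\<^bsub>M\<^esub>v\<in>?A. a v \<odot>\<^bsub>M\<^esub> x v)"
      "\<forall>v\<in>?A. a v \<in> carrier R"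
      using y unfolding lspan_def by blast
    have s: "\<zero>\<^bsub>\<O>\<^esub> = \<iota> (\<Sum>v\<in>?A. a v * X v)" "(\<Sum>v\<in>?A. a v * X v) \<in> carrier R"
      using finsum_gen[OF fin, of a] a(3) unfolding a(1) by simp_all
    have "(\<Sum>v\<in>?A. a v * X v) = 0"
      by (rule inj_onD[OF inj _ s(2)]) (use s(1) O_simps(2) reg.zero_in_carrier in simp_all)
    then have "a v = 0" if "v \<in> ?A" for v
      using words_independent[OF fin _ _ that, of D a] by simp
    moreover have "x v \<in> carrier M" if "v \<in> ?A" for v
      using that x M.part_carrier by blast
    ultimately have "y = (\<Oplus>\<^bsub>M\<^esub>v\<in>?A. \<zero>\<^bsub>M\<^esub>)"
      unfolding a(2) by (intro M.M.finsum_cong') auto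
    then show ?thesis using M.M.finsum_zero[of ?A] by simp
  qed
  ultimately show "corr n \<O> M ?L"
    unfolding corr_def using L gsubD(2)[OF M.gsub_torsion] by blast
qed

lemma lift_subset:
  assumes M: "gmod n M" and G: "rsub n \<O> M G"
    and "\<And>v. \<lbrakk>v \<in> words n; wlen v = D\<rbrakk> \<Longrightarrow> (X v \<odot>\<^bsub>\<O>\<^esub> gen, x v) \<in> G"
  shows "lift D M x \<subseteq> G"
  by (rule lspan_subset[OF gmod_O M finite_words_of_length G]) (use assms(3) in blast)

text \<open>The relation \<open>F O E\<inverse>\<close> is a multivalued lift; freeness selects a single-valued part of it.\<close>

lemma projective_O: "projective_object q_cat \<O>"
  unfolding projective_object_def
proof (intro conjI allI impI ballI)
  show "\<O> \<in> Obj q_cat" by (simp add: gmod_O)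
  fix M N e f assume e: "epimorphism q_cat M N e" and f: "f \<in> Hom q_cat \<O> N"
  have M: "gmod n M" and N: "gmod n N" and e': "e \<in> q_hom R M N"
    using e by (simp_all add: epimorphism_def)
  interpret MN: gmod_pair n M N using M N by (rule gmod_pair.intro)
  interpret OM: gmod_pair n \<O> M using gmod_O M by (rule gmod_pair.intro)
  interpret ON: gmod_pair n \<O> N using gmod_O N by (rule gmod_pair.intro)
  obtain E where E: "corr n M N E" "e = arr n M N E" using e' by (rule MN.q_homE)
  obtain F where F: "corr n \<O> N F" "f = arr n \<O> N F" using f unfolding QGr_simps by (rule ON.q_homE)
  note Er = corrD(1)[OF E(1)] and Fr = corrD(1)[OF F(1)]
  have epi: "satur n N (Range E) = carrier N"
    using e M N E(1) unfolding E(2) by (rule epimorphism_Range)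
  let ?C = "F O E\<inverse>"
  have C: "rsub n \<O> M ?C"
    by (rule rsub_comp[OF Fr rsub_converse[OF Er]])
  \<comment> \<open>One long word brings \<open>gen\<close> into the domain of \<open>F\<close>; by
    \<open>epi\<close> a further one brings the value into the range of \<open>E\<close>.\<close>
  have "ev n (\<lambda>w. X w \<odot>\<^bsub>\<O>\<^esub> gen \<in> Domain ?C)"
  proof (rule ev_ev, rule ev_mono[OF corrD(2)[OF F(1) gen_carrier]])
    fix v assume v: "v \<in> words n" "X v \<odot>\<^bsub>\<O>\<^esub> gen \<in> Domain F"
    then obtain y where y: "(X v \<odot>\<^bsub>\<O>\<^esub> gen, y) \<in> F" by blast
    then have "y \<in> satur n N (Range E)" using rsubD(2)[OF Fr y] epi by simp
    from saturD(2)[OF this] show "ev n (\<lambda>u. X (u + v) \<odot>\<^bsub>\<O>\<^esub> gen \<in> Domain ?C)"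
    proof (rule ev_mono)
      fix u assume u: "u \<in> words n" "X u \<odot>\<^bsub>N\<^esub> y \<in> Range E"
      then obtain x where x: "(x, X u \<odot>\<^bsub>N\<^esub> y) \<in> E" by blast
      have "(X (u + v) \<odot>\<^bsub>\<O>\<^esub> gen, X u \<odot>\<^bsub>N\<^esub> y) \<in> F"
        using rsub_X[OF Fr u(1) y] unfolding reg.X_X[OF u(1) v(1) gen_carrier] .
      then show "X (u + v) \<odot>\<^bsub>\<O>\<^esub> gen \<in> Domain ?C" using x by blast
    qed
  qed
  then obtain D where D: "\<forall>w\<in>words n. D \<le> wlen w \<longrightarrow> X w \<odot>\<^bsub>\<O>\<^esub> gen \<in> Domain ?C"
    unfolding ev_def by blast
  then have "\<forall>w. \<exists>x. w \<in> words n \<and> D \<le> wlen w \<longrightarrow> (X w \<odot>\<^bsub>\<O>\<^esub> gen, x) \<in> ?C" by blast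
  then obtain x' where x': "\<And>w. w \<in> words n \<and> D \<le> wlen w \<longrightarrow> (X w \<odot>\<^bsub>\<O>\<^esub> gen, x' w) \<in> ?C"
    by metis
  \<comment> \<open>The chosen values need not be homogeneous. For words of length \<open>D\<close>
    their components of degree \<open>D\<close> still belong to the relation, since the word itself
    has degree \<open>D\<close>.\<close>
  define x where "x w = hc M (int D) (x' w)" for w
  have x: "x v \<in> part M (int D)" "(X v \<odot>\<^bsub>\<O>\<^esub> gen, x v) \<in> ?C" if v: "v \<in> words n" "wlen v = D" for v
  proof -
    have xv: "(X v \<odot>\<^bsub>\<O>\<^esub> gen, x' v) \<in> ?C" using x'[of v] v by simp
    show "x v \<in> part M (int D)"
      unfolding x_def by (rule MN.M.hc_in_part) (rule rsubD(2)[OF C xv])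
    have "hc \<O> (int D) (X v \<odot>\<^bsub>\<O>\<^esub> gen) = X v \<odot>\<^bsub>\<O>\<^esub> gen"
      using reg.hc_part[OF X_gen_part[OF v(1)], of "int D"] v(2) by simp
    then show "(X v \<odot>\<^bsub>\<O>\<^esub> gen, x v) \<in> ?C"
      using rsubD(6)[OF C xv, of "int D"] unfolding x_def by simp
  qed
  let ?L = "lift D M x"
  have L: "corr n \<O> M ?L" by (rule corr_lift(1)[OF M x(1)])
  have LC: "?L \<subseteq> ?C" by (rule lift_subset[OF M C x(2)])
  \<comment> \<open>A pair \<open>(p, m)\<close> of the lift lies in \<open>?C\<close>, witnessed by
    some \<open>z\<close>: then \<open>y\<close> and \<open>z\<close> are values of \<open>E\<close>
    at \<open>m\<close>, while \<open>z\<close> and \<open>y'\<close> are values of \<open>F\<close>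
    at \<open>p\<close>.\<close>
  have "eqv n N (?L O E) F"
  proof (rule eqvI)
    fix p y y' assume "(p, y) \<in> ?L O E" and y': "(p, y') \<in> F"
    then obtain m where m: "(p, m) \<in> ?L" "(m, y) \<in> E" by blast
    then obtain z where z: "(p, z) \<in> F" "(m, z) \<in> E" using LC by blast
    show "teq n N y y'"
      using corr_fibre_teq[OF M N E(1) m(2) z(2)] corr_fibre_teq[OF gmod_O N F(1) z(1) y'] by (rule teq_trans)
  qed
  then have "q_comp R \<O> M N e (arr n \<O> M ?L) = f"
    using ON.arr_eq_iff[OF corr_comp[OF gmod_O M N L E(1)] F(1)]
    unfolding E(2) F(2) q_comp_arr[OF gmod_O M N L E(1)] by simp
  then show "\<exists>g\<in>Hom q_cat \<O> M. Comp q_cat \<O> M N e g = f"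
    unfolding QGr_simps using OM.arr_in_q_hom[OF L] by blast
qed

text \<open>Distinct morphisms have values at some element that differ by more than torsion. A
  suitable homogeneous component of it, multiplied into a degree \<open>D \<ge> 0\<close>, is a
  value of a map defined on the words of length \<open>D\<close>.\<close>

lemma generator_O: "generator_object q_cat \<O>"
  unfolding generator_object_def
proof (intro conjI allI impI ballI)
  show "\<O> \<in> Obj q_cat" by (simp add: gmod_O)
  fix M N f g assume "M \<in> Obj q_cat" "N \<in> Obj q_cat" and f: "f \<in> Hom q_cat M N" and g: "g \<in> Hom q_cat M N"
    and ne: "f \<noteq> g"
  then have M: "gmod n M" and N: "gmod n N" by simp_all
  interpret MN: gmod_pair n M N using M N by (rule gmod_pair.intro)
  interpret OM: gmod_pair n \<O> M using gmod_O M by (rule gmod_pair.intro)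
  interpret ON: gmod_pair n \<O> N using gmod_O N by (rule gmod_pair.intro)
  obtain F where F: "corr n M N F" "f = arr n M N F" using f unfolding QGr_simps by (rule MN.q_homE)
  obtain G where G: "corr n M N G" "g = arr n M N G" using g unfolding QGr_simps by (rule MN.q_homE)
  note Fr = corrD(1)[OF F(1)] and Gr = corrD(1)[OF G(1)]
  have "\<not> eqv n N F G"
    using ne MN.arr_eq_iff[OF F(1) G(1)] unfolding F(2) G(2) by simp
  then obtain m y y' where m: "(m, y) \<in> F" "(m, y') \<in> G" "\<not> teq n N y y'"
    unfolding eqv_def by blast
  have c: "m \<in> carrier M" "y \<in> carrier N" "y' \<in> carrier N"
    using rsubD(1,2)[OF Fr m(1)] rsubD(2)[OF Gr m(2)] .
  \<comment> \<open>If all components agreed up to torsion, the difference of \<open>y\<close> and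
    \<open>y'\<close> would be torsion by homogeneous induction.\<close>
  obtain e where e: "\<not> teq n N (hc N e y) (hc N e y')"
  proof (rule ccontr)
    assume "\<not> thesis"
    then have all: "teq n N (hc N e y) (hc N e y')" for e using that by blast
    have "y \<ominus>\<^bsub>N\<^esub> y' \<in> torsion n N"
    proof (rule MN.N.hc_induct)
      show "y \<ominus>\<^bsub>N\<^esub> y' \<in> carrier N" using c by simp
      show "hc N e (y \<ominus>\<^bsub>N\<^esub> y') \<in> torsion n N" for e
        using all[of e] c MN.N.teq_iff[of "hc N e y" "hc N e y'"]
        by (simp add: a_minus_def MN.N.hc_add MN.N.hc_minus)
    qed (use gsubD[OF MN.N.gsub_torsion] in blast)+
    then show False using m(3) MN.N.teq_iff[OF c(2,3)] by simp
  qed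
  define z where "z = hc M e m"
  have z: "z \<in> part M e" "z \<in> carrier M" "(z, hc N e y) \<in> F" "(z, hc N e y') \<in> G"
    unfolding z_def using MN.M.hc_in_part[OF c(1)] MN.M.hc_carrier[OF c(1)] rsubD(6)[OF Fr m(1)] rsubD(6)[OF Gr m(2)]
    by simp_all
  have yc: "hc N e y \<in> carrier N" "hc N e y' \<in> carrier N" using c by simp_all
  \<comment> \<open>\<open>D\<close> is the larger of \<open>e\<close> and zero, and
    \<open>k\<close> is the degree still missing: words have nonnegative degree, so a component of
    negative degree is first raised to degree zero.\<close>
  define D where "D = nat e"
  define k where "k = nat (int D - e)"
  have Dk: "int k + e = int D" unfolding D_def k_def by simp
  \<comment> \<open>If every word of length \<open>k\<close> identified the two values up to
    torsion, so would every longer word, whose last \<open>k\<close> letters act first;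
    \<open>teq_ev\<close> would then identify the values themselves.\<close>
  obtain w where w: "w \<in> words n" "wlen w = k" "\<not> teq n N (X w \<odot>\<^bsub>N\<^esub> hc N e y) (X w \<odot>\<^bsub>N\<^esub> hc N e y')"
  proof (rule ccontr)
    note obtained = that
    assume "\<not> thesis"
    then have all: "teq n N (X w \<odot>\<^bsub>N\<^esub> hc N e y) (X w \<odot>\<^bsub>N\<^esub> hc N e y')" if "w \<in> words n" "wlen w = k" for w
      using obtained[of w] that by blast
    have "teq n N (hc N e y) (hc N e y')"
    proof (rule MN.N.teq_ev[OF yc])
      have "teq n N (X u \<odot>\<^bsub>N\<^esub> hc N e y) (X u \<odot>\<^bsub>N\<^esub> hc N e y')" if u: "u \<in> words n" "k \<le> wlen u" for u
      proof -
        from word_split[OF u] obtain u' v where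
          uv: "u = u' + v" "u' \<in> words n" "v \<in> words n" "wlen v = k" "wlen u' = wlen u - k" .
        show ?thesis
          using MN.N.teq_X[OF all[OF uv(3,4)] _ _ uv(2)] uv(3) yc
          unfolding uv(1) by (simp add: MN.N.X_X uv(2,3))
      qed
      then show "ev n (\<lambda>u. teq n N (X u \<odot>\<^bsub>N\<^esub> hc N e y) (X u \<odot>\<^bsub>N\<^esub> hc N e y'))"
        unfolding ev_def by blast
    qed
    then show False using e by simp
  qed
  have wz: "X w \<odot>\<^bsub>M\<^esub> z \<in> part M (int D)"
    using MN.M.smult_part[OF X_in_part[OF w(1)] z(1)] w(2) Dk by simp
  \<comment> \<open>All words of length \<open>D\<close> receive the same value; a single one,
    \<open>v\<close>, is enough to tell the composites apart.\<close>
  let ?L = "lift D M (\<lambda>_. X w \<odot>\<^bsub>M\<^esub> z)"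
  have L: "corr n \<O> M ?L" by (rule corr_lift(1)[OF M wz])
  obtain v where v: "v \<in> words n" "wlen v = D" using ex_word_of_length by blast
  have vL: "(X v \<odot>\<^bsub>\<O>\<^esub> gen, X w \<odot>\<^bsub>M\<^esub> z) \<in> ?L"
    by (rule corr_lift(2)[OF M wz v])
  have "\<not> eqv n N (?L O F) (?L O G)"
  proof
    assume "eqv n N (?L O F) (?L O G)"
    then have "teq n N (X w \<odot>\<^bsub>N\<^esub> hc N e y) (X w \<odot>\<^bsub>N\<^esub> hc N e y')"
      by (rule eqvD) (rule relcompI[OF vL], rule rsub_X[OF Fr w(1) z(3)],
        rule relcompI[OF vL], rule rsub_X[OF Gr w(1) z(4)])
    then show False using w(3) by simp
  qed
  then have "q_comp R \<O> M N f (arr n \<O> M ?L) \<noteq> q_comp R \<O> M N g (arr n \<O> M ?L)"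
    unfolding F(2) G(2) q_comp_arr[OF gmod_O M N L F(1)] q_comp_arr[OF gmod_O M N L G(1)]
    using ON.arr_eq_iff[OF corr_comp[OF gmod_O M N L F(1)] corr_comp[OF gmod_O M N L G(1)]] by simp
  then show "\<exists>h\<in>Hom q_cat \<O> M. Comp q_cat \<O> M N f h \<noteq> Comp q_cat \<O> M N g h"
    unfolding QGr_simps using OM.arr_in_q_hom[OF L] by blast
qed

end


section \<open>Subobjects and finite generation\<close>

lemma directed_Union_gsub:
  assumes "F \<noteq> {}" "\<And>a. a \<in> F \<Longrightarrow> gsub n M (S a)"
    and dir: "\<And>a b. \<lbrakk>a \<in> F; b \<in> F\<rbrakk> \<Longrightarrow> \<exists>c\<in>F. S a \<subseteq> S c \<and> S b \<subseteq> S c"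
  shows "gsub n M (\<Union>a\<in>F. S a)"
  unfolding gsub_def
proof (intro conjI ballI allI subsetI)
  show "\<zero>\<^bsub>M\<^esub> \<in> (\<Union>a\<in>F. S a)"
    using assms(1) gsubD(2)[OF assms(2)] by blast
  fix x assume "x \<in> (\<Union>a\<in>F. S a)"
  then obtain a where a: "a \<in> F" "x \<in> S a" by (rule UN_E)
  note A = assms(2)[OF a(1)]
  show "x \<in> carrier M" using gsubD(6)[OF A a(2)] .
  show "p \<odot>\<^bsub>M\<^esub> x \<in> (\<Union>a\<in>F. S a)" if "p \<in> carrier (free_algebra n)" for p
    using a(1) gsubD(4)[OF A that a(2)] by (rule UN_I)
  show "hc M d x \<in> (\<Union>a\<in>F. S a)" for d
    using a(1) gsubD(5)[OF A a(2)] by (rule UN_I)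
  fix y assume "y \<in> (\<Union>a\<in>F. S a)"
  then obtain b where b: "b \<in> F" "y \<in> S b" by (rule UN_E)
  obtain c where c: "c \<in> F" "S a \<subseteq> S c" "S b \<subseteq> S c" using dir[OF a(1) b(1)] by blast
  show "x \<oplus>\<^bsub>M\<^esub> y \<in> (\<Union>a\<in>F. S a)"
    using c(1) gsubD(3)[OF assms(2)[OF c(1)] subsetD[OF c(2) a(2)] subsetD[OF c(3) b(2)]] by (rule UN_I)
qed

lemma directed_finite_subset:
  assumes "finite W" "F \<noteq> {}" "W \<subseteq> (\<Union>a\<in>F. S a)"
    and dir: "\<And>a b. \<lbrakk>a \<in> F; b \<in> F\<rbrakk> \<Longrightarrow> \<exists>c\<in>F. S a \<subseteq> S c \<and> S b \<subseteq> S c"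
  shows "\<exists>a\<in>F. W \<subseteq> S a"
  using assms(1,3)
proof (induction W rule: finite_induct)
  case empty
  then show ?case using assms(2) by blast
next
  case (insert x W)
  then obtain a b where ab: "a \<in> F" "W \<subseteq> S a" "b \<in> F" "x \<in> S b" by auto
  then obtain c where "c \<in> F" "S a \<subseteq> S c" "S b \<subseteq> S c" using dir[of a b] by blast
  then show ?case using ab by (intro bexI[of _ c]) auto
qed

text \<open>The factorisation makes \<open>I\<close> equivalent to \<open>H O J\<close>, so long
  multiples of values of \<open>I\<close> agree up to torsion with values of \<open>J\<close>.
  Saturation absorbs this torsion and makes the range an invariant of the subobject.\<close>

lemma satur_Range_mono:
  assumes A: "gmod n A" and B: "gmod n B" and M: "gmod n M" and I: "corr n A M I" and J: "corr n B M J"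
    and le: "sub_le (QGr (free_algebra n)) M (A, arr n A M I) (B, arr n B M J)"
  shows "satur n M (Range I) \<subseteq> satur n M (Range J)"
proof -
  interpret M: gmod n M by (rule M)
  interpret AB: gmod_pair n A B using A B by (rule gmod_pair.intro)
  interpret AM: gmod_pair n A M using A M by (rule gmod_pair.intro)
  note Ir = corrD(1)[OF I] and Jr = corrD(1)[OF J]
  obtain h where h: "h \<in> q_hom (free_algebra n) A B"
    "q_comp (free_algebra n) A B M (arr n B M J) h = arr n A M I"
    using le unfolding sub_le_def by auto
  obtain H where H: "corr n A B H" "h = arr n A B H" using h(1) by (rule AB.q_homE)
  have eqv: "eqv n M (H O J) I"
    using h(2) AM.arr_eq_iff[OF corr_comp[OF A B M H(1) J] I] unfolding H(2) q_comp_arr[OF A B M H(1) J] by simp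
  have RJ: "gsub n M (Range J)" using gsub_Range[OF Jr] .
  note sJ = M.gsub_satur[OF RJ]
  have HJ: "rsub n A M (H O J)" using corrD(1)[OF H(1)] Jr by (rule rsub_comp)
  have "y \<in> satur n M (satur n M (Range J))" if "y \<in> Range I" for y
  proof -
    obtain x where x: "(x, y) \<in> I" using \<open>y \<in> Range I\<close> by blast
    have xc: "x \<in> carrier A" and yc: "y \<in> carrier M" using rsubD(1,2)[OF Ir x] .
    show ?thesis
    proof (rule saturI[OF yc], rule ev_mono[OF corrD(2)[OF corr_comp[OF A B M H(1) J] xc]])
      fix w assume w: "w \<in> words n" "X w \<odot>\<^bsub>A\<^esub> x \<in> Domain (H O J)"
      then obtain y' where y': "(X w \<odot>\<^bsub>A\<^esub> x, y') \<in> H O J" by (elim DomainE)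
      have "ev n (\<lambda>u. X u \<odot>\<^bsub>M\<^esub> y' = X u \<odot>\<^bsub>M\<^esub> (X w \<odot>\<^bsub>M\<^esub> y))"
        using eqvD[OF eqv y' rsub_X[OF Ir w(1) x]] unfolding teq_def .
      then have "ev n (\<lambda>u. X u \<odot>\<^bsub>M\<^esub> (X w \<odot>\<^bsub>M\<^esub> y) \<in> Range J)"
      proof (rule ev_mono)
        fix u assume u: "u \<in> words n" "X u \<odot>\<^bsub>M\<^esub> y' = X u \<odot>\<^bsub>M\<^esub> (X w \<odot>\<^bsub>M\<^esub> y)"
        have "y' \<in> Range J" using y' by blast
        then show "X u \<odot>\<^bsub>M\<^esub> (X w \<odot>\<^bsub>M\<^esub> y) \<in> Range J"
          using gsubD(4)[OF RJ, of "X u" y'] u by simp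
      qed
      then show "X w \<odot>\<^bsub>M\<^esub> y \<in> satur n M (Range J)"
        using w(1) yc by (intro saturI) simp_all
    qed
  qed
  then have "Range I \<subseteq> satur n M (Range J)"
    unfolding M.satur_satur[OF RJ] by blast
  then have "satur n M (Range I) \<subseteq> satur n M (satur n M (Range J))" by (rule satur_mono)
  then show ?thesis unfolding M.satur_satur[OF RJ] .
qed

lemma subobject_corr:
  assumes "a \<in> subobjects (QGr (free_algebra n)) M"
  obtains I where "gmod n (fst a)" "corr n (fst a) M I" "snd a = arr n (fst a) M I"
    "monomorphism (QGr (free_algebra n)) (fst a) M (snd a)"
proof -
  have mono: "monomorphism (QGr (free_algebra n)) (fst a) M (snd a)"
    using assms by (auto simp: subobjects_def)
  then have A: "gmod n (fst a)" and M: "gmod n M" and i: "snd a \<in> q_hom (free_algebra n) (fst a) M"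
    unfolding monomorphism_def by simp_all
  interpret AM: gmod_pair n "fst a" M using A M by (rule gmod_pair.intro)
  obtain I where "corr n (fst a) M I" "snd a = arr n (fst a) M I" using i by (rule AM.q_homE)
  with A mono show ?thesis using that by blast
qed

text \<open>The converse of \<open>I\<close> is an inverse morphism: \<open>whole\<close> makes its
  domain large enough, and \<open>monomorphism_kernel\<close> makes its fibre at zero
  torsion.\<close>

lemma subobject_eq_whole:
  assumes A: "gmod n A" and M: "gmod n M" and I: "corr n A M I"
    and mono: "monomorphism (QGr (free_algebra n)) A M (arr n A M I)"
    and whole: "satur n M (Range I) = carrier M"
  shows "sub_eq (QGr (free_algebra n)) M (A, arr n A M I) (M, Id (QGr (free_algebra n)) M)"
proof -
  interpret AM: gmod_pair n A M using A M by (rule gmod_pair.intro)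
  interpret MA: gmod_pair n M A using M A by (rule gmod_pair.intro)
  interpret MM: gmod_pair n M M using M M by (rule gmod_pair.intro)
  note Ir = corrD(1)[OF I]
  have id: "corr n M M (Id_on (carrier M))"
    unfolding Id_on_image by (rule corr_fun[OF M M]) (auto simp: gr_hom_def)
  have "I O Id_on (carrier M) = I"
    using rsubD(2)[OF Ir] by auto
  then have 1: "q_comp (free_algebra n) A M M (arr n M M (Id_on (carrier M))) (arr n A M I) = arr n A M I"
    using q_comp_arr[OF A M M I id] by simp
  have J: "corr n M A (I\<inverse>)"
  proof (rule corrI[OF rsub_converse[OF Ir]])
    fix x assume "x \<in> carrier M"
    then have "x \<in> satur n M (Range I)" using whole by simp
    from saturD(2)[OF this] show "ev n (\<lambda>w. X w \<odot>\<^bsub>M\<^esub> x \<in> Domain (I\<inverse>))" by simp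
  next
    fix y assume "(\<zero>\<^bsub>M\<^esub>, y) \<in> I\<inverse>"
    then show "y \<in> torsion n A" using monomorphism_kernel[OF mono A M I] by simp
  qed
  have "eqv n M (I\<inverse> O I) (Id_on (carrier M))"
  proof (rule eqvI)
    fix x y y' assume "(x, y) \<in> I\<inverse> O I" "(x, y') \<in> Id_on (carrier M)"
    then obtain a where "(a, x) \<in> I" "(a, y) \<in> I" "y' = x" by auto
    then show "teq n M y y'" using corr_fibre_teq[OF A M I] by simp
  qed
  then have 2: "q_comp (free_algebra n) M A M (arr n A M I) (arr n M A (I\<inverse>)) = arr n M M (Id_on (carrier M))"
    using MM.arr_eq_iff[OF corr_comp[OF M A M J I] id] q_comp_arr[OF M A M J I] by simp
  show ?thesis
    unfolding sub_eq_def sub_le_def QGr_Id[OF M] QGr_simps fst_conv snd_conv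
    using 1 2 AM.arr_in_q_hom[OF I] MA.arr_in_q_hom[OF J] by blast
qed

context structure_sheaf
begin

text \<open>The union \<open>?J\<close> of the saturated ranges gives a subobject above the whole
  family, so by leastness of the sum it contains all long multiples of \<open>gen\<close>. The
  finitely many words of one length \<open>D\<close> then lie in a single \<open>S a\<close> by
  directedness, and they account for all longer words.\<close>

lemma finitely_generated_O: "finitely_generated_object q_cat \<O>"
  unfolding finitely_generated_object_def
proof (intro conjI allI impI)
  show "\<O> \<in> Obj q_cat" by (simp add: gmod_O)
  fix F assume "directed_family q_cat \<O> F \<and> is_sum q_cat \<O> F (\<O>, Id q_cat \<O>)"
  then have sub: "F \<subseteq> subobjects q_cat \<O>" and ne: "F \<noteq> {}"
    and dirF: "\<And>a b. \<lbrakk>a \<in> F; b \<in> F\<rbrakk> \<Longrightarrow> \<exists>c\<in>F. sub_le q_cat \<O> a c \<and> sub_le q_cat \<O> b c"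
    and sum: "\<And>t. \<lbrakk>t \<in> subobjects q_cat \<O>; \<And>a. a \<in> F \<Longrightarrow> sub_le q_cat \<O> a t\<rbrakk> \<Longrightarrow>
      sub_le q_cat \<O> (\<O>, Id q_cat \<O>) t"
    unfolding directed_family_def is_sum_def by blast+
  have "\<forall>a\<in>F. \<exists>I. gmod n (fst a) \<and> corr n (fst a) \<O> I \<and> snd a = arr n (fst a) \<O> I \<and>
      monomorphism q_cat (fst a) \<O> (snd a)"
  proof
    fix a assume "a \<in> F"
    then obtain I where "gmod n (fst a)" "corr n (fst a) \<O> I" "snd a = arr n (fst a) \<O> I"
      "monomorphism q_cat (fst a) \<O> (snd a)"
      using subobject_corr[OF subsetD[OF sub]] by blast
    then show "\<exists>I. gmod n (fst a) \<and> corr n (fst a) \<O> I \<and> snd a = arr n (fst a) \<O> I \<and>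
        monomorphism q_cat (fst a) \<O> (snd a)" by (intro exI conjI)
  qed
  from bchoice[OF this] obtain I where "\<forall>a\<in>F. gmod n (fst a) \<and> corr n (fst a) \<O> (I a) \<and> snd a = arr n (fst a) \<O> (I a) \<and>
      monomorphism q_cat (fst a) \<O> (snd a)"
    by (elim exE)
  then have A: "\<And>a. a \<in> F \<Longrightarrow> gmod n (fst a)" and I: "\<And>a. a \<in> F \<Longrightarrow> corr n (fst a) \<O> (I a)"
    and i: "\<And>a. a \<in> F \<Longrightarrow> snd a = arr n (fst a) \<O> (I a)"
    and mono: "\<And>a. a \<in> F \<Longrightarrow> monomorphism q_cat (fst a) \<O> (snd a)" by blast+
  have pair: "(fst a, arr n (fst a) \<O> (I a)) = a" if "a \<in> F" for a
    using i[OF that] by (cases a) simp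
  \<comment> \<open>Comparison of subobjects gives inclusion of ranges only after saturation, so
    directedness is transferred to these sets.\<close>
  define S where "S a = satur n \<O> (Range (I a))" for a
  have gR: "gsub n \<O> (Range (I a))" if "a \<in> F" for a
    using gsub_Range[OF corrD(1)[OF I[OF that]]] .
  have gS: "gsub n \<O> (S a)" if "a \<in> F" for a
    unfolding S_def by (rule reg.gsub_satur[OF gR[OF that]])
  have RS: "Range (I a) \<subseteq> S a" if "a \<in> F" for a
    unfolding S_def by (rule reg.satur_subset[OF gR[OF that]])
  have mS: "S a \<subseteq> S b" if "a \<in> F" "b \<in> F" "sub_le q_cat \<O> a b" for a b
    using satur_Range_mono[OF A[OF that(1)] A[OF that(2)] gmod_O I[OF that(1)] I[OF that(2)]]
      that(3) unfolding S_def pair[OF that(1)] pair[OF that(2)] by blast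
  have dirS: "\<exists>c\<in>F. S a \<subseteq> S c \<and> S b \<subseteq> S c" if "a \<in> F" "b \<in> F" for a b
    using dirF[OF that] mS that by blast
  let ?J = "\<Union>a\<in>F. S a"
  have J: "gsub n \<O> ?J" by (rule directed_Union_gsub[OF ne]) (rule gS, assumption, rule dirS)
  let ?N = "restrict_mod \<O> ?J"
  have N: "gmod n ?N" by (rule reg.gmod_restrict[OF J])
  note incl = monomorphism_incl[OF gmod_O J]
  have "sub_le q_cat \<O> a (?N, arr n ?N \<O> (Id_on ?J))" if a: "a \<in> F" for a
  proof -
    interpret AN: gmod_pair n "fst a" ?N using A[OF a] N by (rule gmod_pair.intro)
    have RJ: "Range (I a) \<subseteq> ?J" using RS[OF a] a by blast
    \<comment> \<open>The relation \<open>I a\<close> itself, read with a smaller codomain, is the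
      factorisation through \<open>?J\<close>; torsion elements of \<open>\<O>\<close> lying in
      \<open>?J\<close> are torsion there.\<close>
    have IN: "corr n (fst a) ?N (I a)"
    proof (rule corrI)
      show "rsub n (fst a) ?N (I a)"
        by (rule rsub_restrict[OF corrD(1)[OF I[OF a]] gmod_O J RJ])
      show "ev n (\<lambda>w. X w \<odot>\<^bsub>fst a\<^esub> x \<in> Domain (I a))" if "x \<in> carrier (fst a)" for x
        by (rule corrD(2)[OF I[OF a] that])
      show "y \<in> torsion n ?N" if "(\<zero>\<^bsub>fst a\<^esub>, y) \<in> I a" for y
      proof -
        have "y \<in> ?J" using RJ that by blast
        then show ?thesis using saturD(2)[OF corrD(3)[OF I[OF a] that]] by (simp add: satur_def)
      qed
    qed
    have "I a O Id_on ?J = I a" using RJ by auto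
    then have "q_comp R (fst a) ?N \<O> (arr n ?N \<O> (Id_on ?J)) (arr n (fst a) ?N (I a)) = snd a"
      using q_comp_arr[OF A[OF a] N gmod_O IN incl(1)] i[OF a] by simp
    then show ?thesis
      unfolding sub_le_def QGr_simps fst_conv snd_conv using AN.arr_in_q_hom[OF IN] by blast
  qed
  \<comment> \<open>That the sum is all of \<open>\<O>\<close> enters as leastness, tested against
    the subobject on \<open>?J\<close>.\<close>
  then have le: "sub_le q_cat \<O> (\<O>, Id q_cat \<O>) (?N, arr n ?N \<O> (Id_on ?J))"
    using incl(2) by (intro sum) (auto simp: subobjects_def)
  have id: "corr n \<O> \<O> (Id_on (carrier \<O>))"
    unfolding Id_on_image by (rule corr_fun[OF gmod_O gmod_O]) (auto simp: gr_hom_def)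
  have "satur n \<O> (Range (Id_on (carrier \<O>))) \<subseteq> satur n \<O> (Range (Id_on ?J))"
    using satur_Range_mono[OF gmod_O N gmod_O id incl(1)] le unfolding QGr_Id[OF gmod_O] by blast
  moreover have "gen \<in> satur n \<O> (Range (Id_on (carrier \<O>)))"
    using reg.satur_subset[OF reg.gsub_carrier] gen_carrier by auto
  moreover have "Range (Id_on ?J) = ?J" by auto
  ultimately have "gen \<in> satur n \<O> ?J" by auto
  then obtain D where D: "\<And>w. \<lbrakk>w \<in> words n; D \<le> wlen w\<rbrakk> \<Longrightarrow> X w \<odot>\<^bsub>\<O>\<^esub> gen \<in> ?J"
    unfolding satur_def ev_def by blast
  let ?W = "(\<lambda>w. X w \<odot>\<^bsub>\<O>\<^esub> gen) ` {w \<in> words n. wlen w = D}"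
  have "\<exists>a\<in>F. ?W \<subseteq> S a"
  proof (rule directed_finite_subset[OF _ ne])
    show "\<exists>c\<in>F. S a \<subseteq> S c \<and> S b \<subseteq> S c" if "a \<in> F" "b \<in> F" for a b
      using that by (rule dirS)
    show "finite ?W" using finite_words_of_length by (rule finite_imageI)
    show "?W \<subseteq> ?J"
    proof
      fix x assume "x \<in> ?W"
      then obtain w where "w \<in> words n" "wlen w = D" "x = X w \<odot>\<^bsub>\<O>\<^esub> gen" by blast
      then show "x \<in> ?J" using D[of w] by simp
    qed
  qed
  then obtain a where a: "a \<in> F" "?W \<subseteq> S a" by blast
  have "X w \<odot>\<^bsub>\<O>\<^esub> gen \<in> S a" if w: "w \<in> words n" "D \<le> wlen w" for w
  proof -
    from word_split[OF w] obtain u v where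
      uv: "w = u + v" "u \<in> words n" "v \<in> words n" "wlen v = D" "wlen u = wlen w - D" .
    have "X v \<odot>\<^bsub>\<O>\<^esub> gen \<in> S a" using a(2) uv(3,4) by blast
    from gsubD(4)[OF gS[OF a(1)] single_in_free_algebra[OF uv(2), of 1] this] show ?thesis
      unfolding uv(1) reg.X_X[OF uv(2,3) gen_carrier] .
  qed
  then have "ev n (\<lambda>w. X w \<odot>\<^bsub>\<O>\<^esub> gen \<in> S a)" unfolding ev_def by blast
  then have "satur n \<O> (S a) = carrier \<O>" by (rule ev_gen[OF gS[OF a(1)]])
  then have "satur n \<O> (Range (I a)) = carrier \<O>"
    unfolding S_def reg.satur_satur[OF gR[OF a(1)]] .
  then have "sub_eq q_cat \<O> (fst a, arr n (fst a) \<O> (I a)) (\<O>, Id q_cat \<O>)"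
    using mono[OF a(1)] unfolding i[OF a(1)]
    by (intro subobject_eq_whole[OF A[OF a(1)] gmod_O I[OF a(1)]])
  then show "\<exists>a\<in>F. sub_eq q_cat \<O> a (\<O>, Id q_cat \<O>)"
    using a(1) unfolding pair[OF a(1)] by blast
qed

end

theorem theorem1p2:
  fixes n :: nat and \<iota> :: "(nat word \<Rightarrow>\<^sub>0 'k::field) \<Rightarrow> 'u"
  defines "R \<equiv> (free_algebra n :: ('k, nat word \<Rightarrow>\<^sub>0 'k) graded)"
  defines "\<O> \<equiv> pi_obj (transport_mod \<iota> (regular_mod R))"
  assumes "n > 0"
    and "inj_on \<iota> (carrier R)"
  shows "finitely_generated_object (QGr R) \<O> \<and> projective_object (QGr R) \<O> \<and>
    generator_object (QGr R) \<O>"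
proof -
  interpret S: structure_sheaf n \<iota>
    using assms(4) unfolding R_def by (rule structure_sheaf.intro)
  show ?thesis
    unfolding \<O>_def R_def pi_obj_def
    by (intro conjI S.finitely_generated_O S.projective_O S.generator_O)
qed

end
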